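(* For any complexity class $\mathsf{B}$, $\mathsf{P^{SP(P^B)}}\subseteq \mathsf{P/poly^{SP(NP^B)}}$.
   Context: A language is sparse if it has at most $\mathrm{poly}(n)$ elements of length $n$. For a class $\mathsf{D}$, $\mathsf{SP(D)}$ denotes the set of sparse languages in $\mathsf{D}$. $\mathsf{X^Y}=\bigcup_{L\in\mathsf{Y}}\mathsf{X}^L$. $\#$ is a separator symbol. (Bounded advice) A language $L$ is in $\mathsf{C/poly^B}$ if there is a sequence of advice strings $\{a_n\}_{n\in\mathbb N}$ such that (i) there is a deterministic polynomial-time Turing machine $T$ with oracle access to a language in $\mathsf{B}$ which on input $1^n$ halts in $\mathrm{poly}(n)$ time with $a_n$ as the final content of its tape, and (ii) the language $\{x\#a_{|x|}: x\in L\}$ is in $\mathsf{C}$.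
   Formalization: Condition (ii) of bounded advice is read in the Karp–Lipton sense: some D in P has x ∈ L iff x#a_{|x|} ∈ D. Taken literally, with {x#a_{|x|} : x ∈ L} itself in P, the claim fails, e.g. for B = {O} with O a tally language that is not computably enumerable. *)

theory Defs
  imports Main
begin

text \<open>A machine over input alphabet 'a has a work tape (initially holding the input)
and an oracle query tape; tape cells hold 'a option (None = blank).
States are natural numbers below nstates; fixed special states:
0 start, 1 accept, 2 reject, 3 query, 4 oracle-yes, 5 oracle-no.
A transition reads both tapes and yields a list of possible actions
(new state, symbol written on work tape, work head move, symbol written on query tape,
query head move); a deterministic machine has exactly one action.\<close>

type_synonym 'a action = "nat \<times> 'a option \<times> int \<times> 'a option \<times> int"

record 'a tm =
  nstates :: nat
  delta :: "nat \<Rightarrow> 'a option \<Rightarrow> 'a option \<Rightarrow> 'a action list"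

type_synonym 'a tape = "'a option list \<times> nat"
type_synonym 'a config = "nat \<times> 'a tape \<times> 'a tape"

definition q_start :: nat where "q_start = 0"
definition q_acc :: nat where "q_acc = 1"
definition q_rej :: nat where "q_rej = 2"
definition q_query :: nat where "q_query = 3"
definition q_yes :: nat where "q_yes = 4"
definition q_no :: nat where "q_no = 5"

definition tape_read :: "'a tape \<Rightarrow> 'a option" where
  "tape_read t = (if snd t < length (fst t) then fst t ! snd t else None)"

definition tape_write :: "'a option \<Rightarrow> 'a tape \<Rightarrow> 'a tape" where
  "tape_write s t = (if snd t < length (fst t) then ((fst t)[snd t := s], snd t)
      else (fst t @ replicate (snd t - length (fst t)) None @ [s], snd t))"

definition tape_move :: "int \<Rightarrow> 'a tape \<Rightarrow> 'a tape" where
  "tape_move m t = (fst t, nat (int (snd t) + m))"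

definition tape_content :: "'a tape \<Rightarrow> 'a list" where
  "tape_content t = map the (takeWhile (\<lambda>s. s \<noteq> None) (fst t))"

definition wf_tm :: "'a tm \<Rightarrow> bool" where
  "wf_tm M \<longleftrightarrow> 6 \<le> nstates M \<and>
     (\<forall>q r1 r2. q < nstates M \<longrightarrow> delta M q r1 r2 \<noteq> [] \<and>
        (\<forall>(q', w1, m1, w2, m2) \<in> set (delta M q r1 r2).
            q' < nstates M \<and> m1 \<in> {-1, 0, 1} \<and> m2 \<in> {-1, 0, 1}))"

definition deterministic :: "'a tm \<Rightarrow> bool" where
  "deterministic M \<longleftrightarrow> (\<forall>q r1 r2. q < nstates M \<longrightarrow> length (delta M q r1 r2) = 1)"

definition halted :: "'a config \<Rightarrow> bool" where
  "halted c \<longleftrightarrow> fst c = q_acc \<or> fst c = q_rej"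

definition work_tape :: "'a config \<Rightarrow> 'a tape" where
  "work_tape c = fst (snd c)"

definition tm_step :: "'a list set \<Rightarrow> 'a tm \<Rightarrow> 'a config \<Rightarrow> 'a config \<Rightarrow> bool" where
  "tm_step Orc M c c' \<longleftrightarrow>
     (case c of (q, w, qt) \<Rightarrow>
       if q = q_acc \<or> q = q_rej then False
       else if q = q_query then
         c' = ((if tape_content qt \<in> Orc then q_yes else q_no), w, ([], 0))
       else (\<exists>(q', w1, m1, w2, m2) \<in> set (delta M q (tape_read w) (tape_read qt)).
               c' = (q', tape_move m1 (tape_write w1 w), tape_move m2 (tape_write w2 qt))))"

definition init_config :: "'a list \<Rightarrow> 'a config" where
  "init_config x = (q_start, (map Some x, 0), ([], 0))"

definition runs_within :: "'a list set \<Rightarrow> 'a tm \<Rightarrow> 'a list \<Rightarrow> nat \<Rightarrow> bool" where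
  "runs_within Orc M x t \<longleftrightarrow> \<not> (\<exists>c. (tm_step Orc M ^^ Suc t) (init_config x) c)"

definition accepts :: "'a list set \<Rightarrow> 'a tm \<Rightarrow> 'a list \<Rightarrow> bool" where
  "accepts Orc M x \<longleftrightarrow> (\<exists>k c. (tm_step Orc M ^^ k) (init_config x) c \<and> fst c = q_acc)"

definition poly_bounded :: "(nat \<Rightarrow> nat) \<Rightarrow> bool" where
  "poly_bounded f \<longleftrightarrow> (\<exists>k. \<forall>n. f n \<le> k * n ^ k + k)"

definition P_O :: "'a list set \<Rightarrow> 'a list set set" where
  "P_O Orc = {L. \<exists>M t. wf_tm M \<and> deterministic M \<and> poly_bounded t \<and>
      (\<forall>x. runs_within Orc M x (t (length x)) \<and> (x \<in> L \<longleftrightarrow> accepts Orc M x))}"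

definition NP_O :: "'a list set \<Rightarrow> 'a list set set" where
  "NP_O Orc = {L. \<exists>M t. wf_tm M \<and> poly_bounded t \<and>
      (\<forall>x. runs_within Orc M x (t (length x)) \<and> (x \<in> L \<longleftrightarrow> accepts Orc M x))}"

definition P_rel :: "'a list set set \<Rightarrow> 'a list set set" where
  "P_rel Y = (\<Union>L\<in>Y. P_O L)"

definition NP_rel :: "'a list set set \<Rightarrow> 'a list set set" where
  "NP_rel Y = (\<Union>L\<in>Y. NP_O L)"

definition P_class :: "'a list set set" where
  "P_class = P_O {}"

definition sparse :: "'a list set \<Rightarrow> bool" where
  "sparse L \<longleftrightarrow> (\<exists>k. \<forall>n. card {x \<in> L. length x = n} \<le> k * n ^ k + k)"

definition SP :: "'a list set set \<Rightarrow> 'a list set set" where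
  "SP D = {L \<in> D. sparse L}"

text \<open>Languages are over the binary alphabet (bool); x#a is a word over the alphabet
bool option, with None playing the role of the separator #.\<close>
definition sep_word :: "bool list \<Rightarrow> bool list \<Rightarrow> bool option list" where
  "sep_word x a = map Some x @ [None] @ map Some a"

definition Ppoly_B :: "bool list set set \<Rightarrow> bool list set set" where
  "Ppoly_B Bc = {L. \<exists>a :: nat \<Rightarrow> bool list.
      (\<exists>A\<in>Bc. \<exists>M t. wf_tm M \<and> deterministic M \<and> poly_bounded t \<and>
         (\<forall>n. runs_within A M (replicate n True) (t n) \<and>
              (\<exists>k c. (tm_step A M ^^ k) (init_config (replicate n True)) c \<and> halted c \<and>
                     tape_content (work_tape c) = a n))) \<and>
      (\<exists>D \<in> (P_class :: bool option list set set).
         \<forall>x. x \<in> L \<longleftrightarrow> sep_word x (a (length x)) \<in> D)}"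

end

theory Submission
  imports Defs
begin

text \<open>Let \<open>L\<close> be decided by a machine \<open>M\<close> with a sparse oracle \<open>S\<close> in time \<open>p\<close>. The advice
  for length \<open>n\<close> lists all words of \<open>S\<close> of length at most \<open>p(n)\<close>, followed by \<open>p(n)\<close> padding symbols.
  If \<open>S\<close> is in P relative to an oracle, then the words \<open>u 1 0\<^sup>j\<close> such that \<open>u\<close> extends by \<open>j\<close> letters
  to a word in \<open>S\<close> form a sparse language in NP relative to the same oracle. With queries to it, a depth-first
  search of the binary tree finds the words of \<open>S\<close>. Only nodes with answer yes are expanded, so
  sparsity bounds the number of queries polynomially.

  Given the advice, \<open>M\<close> is simulated by looking up its queries in the list. The length of the advice
  serves as a clock, so that the simulation stops on malformed inputs, too. The padding is an
  unterminated word and therefore never matches. The machines for the search and for the simulation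
  are compiled from programs that work on several stacks.\<close>

section \<open>Tapes as functions\<close>

text \<open>The trailing zeros of a query fix the length of the missing part; this keeps the prefix
  language sparse, and the existential quantifier over the missing part is the reason for NP in
  place of P. Finitely many words of \<open>S\<close> can replace the oracle afterwards because
  \<open>p(n)\<close> steps cannot write a query longer than \<open>p(n)\<close>. Without padding
  the clock could be too short, as \<open>S\<close> may have few words or none. A clock is required
  because \<open>M\<close> is known to stop only with oracle \<open>S\<close>, whereas a corrupt
  table may answer differently. The machine model is the main obstacle: one work tape, one query
  tape, and an oracle call that forgets the control state and blanks the query tape. All data that
  must survive a call therefore lie on the work tape, which is divided into stacks. Between calls
  the query tape is free; it receives the input at the start, keeps the advice table during the
  simulation and carries the output at the end of the search.\<close>

type_synonym 'a ftape = "(nat \<Rightarrow> 'a option) \<times> nat"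

text \<open>Lists that differ only in trailing blanks become equal, so that writing beyond the end
  of the list is an ordinary function update.\<close>

definition tape_fun :: "'a tape \<Rightarrow> 'a ftape" where
  "tape_fun t = ((\<lambda>p. if p < length (fst t) then fst t ! p else None), snd t)"

definition word_fun :: "'a list \<Rightarrow> nat \<Rightarrow> 'a option" where
  "word_fun x = (\<lambda>p. if p < length x then Some (x ! p) else None)"

definition blank :: "'a ftape" where
  "blank = (\<lambda>_. None, 0)"

definition fread :: "'a ftape \<Rightarrow> 'a option" where
  "fread t = fst t (snd t)"

definition fwr :: "'a option \<Rightarrow> int \<Rightarrow> 'a ftape \<Rightarrow> 'a ftape" where
  "fwr s m t = ((fst t)(snd t := s), nat (int (snd t) + m))"

definition fcontent :: "(nat \<Rightarrow> 'a option) \<Rightarrow> 'a list" where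
  "fcontent f = map (the \<circ> f) [0..<LEAST n. f n = None]"

lemma tape_read_fun: "tape_read t = fread (tape_fun t)"
  by (simp add: tape_read_def fread_def tape_fun_def)

lemma tape_act_fun: "tape_fun (tape_move m (tape_write s t)) = fwr s m (tape_fun t)"
  by (auto simp: tape_fun_def tape_move_def tape_write_def fwr_def fun_eq_iff nth_append
      nth_Cons' nth_list_update)

lemma fcontentI:
  assumes "\<And>i. i < length xs \<Longrightarrow> f i = Some (xs ! i)" "f (length xs) = None"
  shows "fcontent f = xs"
proof -
  have "(LEAST n. f n = None) = length xs"
    using assms by (intro Least_equality) (auto simp: not_less[symmetric])
  then show ?thesis
    using assms by (auto simp: fcontent_def intro!: nth_equalityI)
qed

lemma fcontentD:
  assumes "f n = None"
  shows "length (fcontent f) \<le> n" "f (length (fcontent f)) = None"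
    "\<And>i. i < length (fcontent f) \<Longrightarrow> f i = Some (fcontent f ! i)"
proof -
  have 1: "length (fcontent f) = (LEAST n. f n = None)"
    by (simp add: fcontent_def)
  show "length (fcontent f) \<le> n" "f (length (fcontent f)) = None"
    using assms by (auto simp: 1 intro: Least_le LeastI)
  show "f i = Some (fcontent f ! i)" if "i < length (fcontent f)" for i
    using that not_less_Least[of i "\<lambda>n. f n = None"] 1 by (auto simp: fcontent_def)
qed

lemma fcontent_word_fun [simp]: "fcontent (word_fun x) = x"
  by (rule fcontentI) (auto simp: word_fun_def)

lemma tape_content_fun: "tape_content t = fcontent (fst (tape_fun t))"
proof (rule fcontentI[symmetric])
  let ?l = "takeWhile (\<lambda>s. s \<noteq> None) (fst t)"
  have len: "length ?l \<le> length (fst t)" by (rule length_takeWhile_le)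
  show "fst (tape_fun t) i = Some (tape_content t ! i)" if "i < length (tape_content t)" for i
  proof -
    have i: "i < length ?l" using that by (simp add: tape_content_def)
    then have "?l ! i \<noteq> None" using nth_mem by (fastforce dest: set_takeWhileD)
    then show ?thesis
      using i len by (auto simp: tape_fun_def tape_content_def takeWhile_nth)
  qed
  show "fst (tape_fun t) (length (tape_content t)) = None"
    using nth_length_takeWhile[of "\<lambda>s. s \<noteq> None" "fst t"]
    by (auto simp: tape_fun_def tape_content_def)
qed

section \<open>Steps on function tapes\<close>

type_synonym ('s, 'a) fconfig = "'s \<times> 'a ftape \<times> 'a ftape"

definition cfun :: "'a config \<Rightarrow> (nat, 'a) fconfig" where
  "cfun c = (fst c, tape_fun (fst (snd c)), tape_fun (snd (snd c)))"

definition nstep :: "'a list set \<Rightarrow> 'a tm \<Rightarrow> (nat, 'a) fconfig \<Rightarrow> (nat, 'a) fconfig \<Rightarrow> bool" where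
  "nstep Orc M C C' \<longleftrightarrow> (case C of (q, w, x) \<Rightarrow>
     if q = 1 \<or> q = 2 then False
     else if q = 3 then C' = (if fcontent (fst x) \<in> Orc then 4 else 5, w, blank)
     else \<exists>(q', w1, m1, w2, m2) \<in> set (delta M q (fread w) (fread x)).
            C' = (q', fwr w1 m1 w, fwr w2 m2 x))"

definition finit :: "'a list \<Rightarrow> (nat, 'a) fconfig" where
  "finit x = (0, (word_fun x, 0), blank)"

lemmas q_defs = q_start_def q_acc_def q_rej_def q_query_def q_yes_def q_no_def

lemma cfun_init: "cfun (init_config x) = finit x"
  by (auto simp: cfun_def init_config_def finit_def tape_fun_def word_fun_def blank_def q_defs
      fun_eq_iff)

lemma tape_fun_empty: "tape_fun ([], 0) = blank"
  by (simp add: tape_fun_def blank_def)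

lemma tm_step_nstep: "tm_step Orc M c c' \<Longrightarrow> nstep Orc M (cfun c) (cfun c')"
  by (cases c)
    (fastforce simp: tm_step_def nstep_def cfun_def q_defs tape_content_fun tape_fun_empty
      tape_read_fun tape_act_fun split: if_splits prod.splits)

text \<open>\<open>cfun\<close> is not injective, so a step of the image is lifted only to some list
  configuration \<open>c'\<close>. This suffices, as halting, acceptance and tape content depend on
  the image alone.\<close>

lemma nstep_tm_step:
  assumes "nstep Orc M (cfun c) C'"
  shows "\<exists>c'. tm_step Orc M c c' \<and> cfun c' = C'"
proof -
  obtain q w x where c: "c = (q, w, x)" by (cases c)
  show ?thesis
  proof (cases "q = 3")
    case True
    then show ?thesis
      using assms unfolding c
      by (intro exI[of _ "(if tape_content x \<in> Orc then 4 else 5, w, ([], 0))"])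
        (auto simp: tm_step_def nstep_def cfun_def q_defs tape_content_fun tape_fun_empty)
  next
    case False
    then obtain q' w1 m1 w2 m2 where
      "(q', w1, m1, w2, m2) \<in> set (delta M q (tape_read w) (tape_read x))"
      "C' = (q', fwr w1 m1 (tape_fun w), fwr w2 m2 (tape_fun x))" "q \<noteq> 1" "q \<noteq> 2"
      using assms unfolding c
      by (auto simp: nstep_def cfun_def tape_read_fun split: if_splits)
    then show ?thesis
      using False unfolding c
      by (intro exI[of _ "(q', tape_move m1 (tape_write w1 w), tape_move m2 (tape_write w2 x))"])
        (fastforce simp: tm_step_def cfun_def q_defs tape_act_fun)
  qed
qed

lemma steps_nsteps: "(tm_step Orc M ^^ k) c c' \<Longrightarrow> (nstep Orc M ^^ k) (cfun c) (cfun c')"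
proof (induction k arbitrary: c')
  case (Suc k)
  then show ?case by (metis relpowp_Suc_E relpowp_Suc_I tm_step_nstep)
qed simp

lemma nsteps_steps:
  "(nstep Orc M ^^ k) (cfun c) C' \<Longrightarrow> \<exists>c'. (tm_step Orc M ^^ k) c c' \<and> cfun c' = C'"
proof (induction k arbitrary: C')
  case (Suc k)
  then obtain D where D: "(nstep Orc M ^^ k) (cfun c) D" "nstep Orc M D C'" by auto
  from Suc.IH[OF D(1)] obtain d where d: "(tm_step Orc M ^^ k) c d" "cfun d = D" by blast
  with D(2) nstep_tm_step[of Orc M d C'] show ?case by (meson relpowp_Suc_I)
qed simp

lemma runs_within_iff:
  "runs_within Orc M x t \<longleftrightarrow> \<not> (\<exists>C. (nstep Orc M ^^ Suc t) (finit x) C)"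
  unfolding runs_within_def cfun_init[symmetric]
  by (meson steps_nsteps nsteps_steps)

lemma accepts_iff:
  "accepts Orc M x \<longleftrightarrow> (\<exists>k C. (nstep Orc M ^^ k) (finit x) C \<and> fst C = 1)"
proof -
  have [simp]: "fst (cfun c) = fst c" for c :: "'a config" by (simp add: cfun_def)
  show ?thesis
    unfolding accepts_def cfun_init[symmetric] q_defs
    by (metis \<open>\<And>c. fst (cfun c) = fst c\<close> steps_nsteps nsteps_steps)
qed

subsection \<open>Deterministic machines\<close>

type_synonym ('s, 'a) gdelta =
  "'s \<Rightarrow> 'a option \<Rightarrow> 'a option \<Rightarrow> 's \<times> 'a option \<times> int \<times> 'a option \<times> int"

text \<open>The special state with number \<open>i\<close> is \<open>sp i\<close>. Halted configurations are fixed points,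
  so that \<open>t\<close> steps are \<open>t\<close>-fold iteration.\<close>
definition gstep :: "(nat \<Rightarrow> 's) \<Rightarrow> 'a list set \<Rightarrow> ('s, 'a) gdelta \<Rightarrow>
    ('s, 'a) fconfig \<Rightarrow> ('s, 'a) fconfig" where
  "gstep sp Orc d C = (case C of (q, w, x) \<Rightarrow>
     if q = sp 1 \<or> q = sp 2 then C
     else if q = sp 3 then (sp (if fcontent (fst x) \<in> Orc then 4 else 5), w, blank)
     else case d q (fread w) (fread x) of (q', w1, m1, w2, m2) \<Rightarrow>
            (q', fwr w1 m1 w, fwr w2 m2 x))"

abbreviation dstep :: "'a list set \<Rightarrow> 'a tm \<Rightarrow> (nat, 'a) fconfig \<Rightarrow> (nat, 'a) fconfig" where
  "dstep Orc M \<equiv> gstep (\<lambda>i. i) Orc (\<lambda>q a b. hd (delta M q a b))"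

abbreviation fhalted :: "(nat, 'a) fconfig \<Rightarrow> bool" where
  "fhalted C \<equiv> fst C = 1 \<or> fst C = 2"

lemma dstep_halted: "fhalted C \<Longrightarrow> (dstep Orc M ^^ k) C = C"
  by (induction k) (auto simp: gstep_def split: prod.split)

lemma dstep_halted_mono:
  assumes "fhalted ((dstep Orc M ^^ i) C)" "i \<le> j"
  shows "(dstep Orc M ^^ j) C = (dstep Orc M ^^ i) C"
proof -
  have "(dstep Orc M ^^ j) C = (dstep Orc M ^^ (j - i)) ((dstep Orc M ^^ i) C)"
    using assms(2) by (simp flip: funpow_add comp_apply[of "_ ^^ _"])
  then show ?thesis using dstep_halted[OF assms(1)] by simp
qed

context
  fixes M :: "'a tm"
  assumes wf: "wf_tm M" and det: "deterministic M"
begin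

lemma det_delta:
  assumes "q < nstates M"
  shows "delta M q a b = [hd (delta M q a b)]" "fst (hd (delta M q a b)) < nstates M"
proof -
  show *: "delta M q a b = [hd (delta M q a b)]"
    using det assms unfolding deterministic_def
    by (metis length_0_conv length_Suc_conv list.sel(1) One_nat_def)
  then have "hd (delta M q a b) \<in> set (delta M q a b)"
    by (metis list.set_intros(1))
  then show "fst (hd (delta M q a b)) < nstates M"
    using wf assms unfolding wf_tm_def by fastforce
qed

lemma dstep_state: "fst C < nstates M \<Longrightarrow> fst (dstep Orc M C) < nstates M"
  using det_delta(2) wf
  by (auto simp: gstep_def wf_tm_def split: prod.splits) (metis fst_conv)+

lemma dsteps_state: "fst C < nstates M \<Longrightarrow> fst ((dstep Orc M ^^ k) C) < nstates M"
  by (induction k) (auto intro: dstep_state)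

lemma nstep_dstep:
  assumes "fst C < nstates M"
  shows "nstep Orc M C C' \<longleftrightarrow> \<not> fhalted C \<and> C' = dstep Orc M C"
proof -
  obtain q w x where C: "C = (q, w, x)" by (cases C)
  have "delta M q (fread w) (fread x) = [hd (delta M q (fread w) (fread x))]"
    using det_delta(1) assms C by auto
  then obtain v where v: "delta M q (fread w) (fread x) = [v]" by blast
  show ?thesis
    unfolding C nstep_def gstep_def by (auto simp: v split: prod.splits)
qed

lemma nsteps_dsteps:
  assumes "fst C < nstates M"
  shows "(nstep Orc M ^^ k) C C' \<longleftrightarrow>
    C' = (dstep Orc M ^^ k) C \<and> (\<forall>i<k. \<not> fhalted ((dstep Orc M ^^ i) C))"
proof (induction k arbitrary: C')
  case (Suc k)
  have "(nstep Orc M ^^ Suc k) C C' \<longleftrightarrow> (\<exists>D. (nstep Orc M ^^ k) C D \<and> nstep Orc M D C')"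
    by (simp only: relpowp.simps(2) relcompp.simps) metis
  also have "\<dots> \<longleftrightarrow> nstep Orc M ((dstep Orc M ^^ k) C) C' \<and>
      (\<forall>i<k. \<not> fhalted ((dstep Orc M ^^ i) C))"
    unfolding Suc.IH by auto
  also have "\<dots> \<longleftrightarrow> C' = (dstep Orc M ^^ Suc k) C \<and>
      (\<forall>i<Suc k. \<not> fhalted ((dstep Orc M ^^ i) C))"
    unfolding nstep_dstep[OF dsteps_state[OF assms]] less_Suc_eq by auto
  finally show ?case .
qed auto

lemma finit_state: "fst (finit x) < nstates M"
  using wf by (auto simp: finit_def wf_tm_def)

text \<open>A step number \<open>t + 1\<close> exists exactly if none of the configurations at times
  0 to \<open>t\<close> is halted. Halted configurations persist under \<open>dstep\<close>, so only
  time \<open>t\<close> has to be inspected.\<close>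

lemma runs_within_dstep:
  "runs_within Orc M x t \<longleftrightarrow> fhalted ((dstep Orc M ^^ t) (finit x))"
proof -
  have "runs_within Orc M x t \<longleftrightarrow> (\<exists>i\<le>t. fhalted ((dstep Orc M ^^ i) (finit x)))"
    unfolding runs_within_iff nsteps_dsteps[OF finit_state] by (auto simp: less_Suc_eq_le)
  also have "\<dots> \<longleftrightarrow> fhalted ((dstep Orc M ^^ t) (finit x))"
    by (metis dstep_halted_mono order_refl)
  finally show ?thesis .
qed

lemma accepts_dstep:
  "accepts Orc M x \<longleftrightarrow> (\<exists>k. fst ((dstep Orc M ^^ k) (finit x)) = 1)"
proof
  assume "\<exists>k. fst ((dstep Orc M ^^ k) (finit x)) = 1"
  then obtain k where k: "fst ((dstep Orc M ^^ k) (finit x)) = 1"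
    "\<And>i. i < k \<Longrightarrow> fst ((dstep Orc M ^^ i) (finit x)) \<noteq> 1"
    using exists_least_iff[of "\<lambda>k. fst ((dstep Orc M ^^ k) (finit x)) = 1"] by blast
  \<comment> \<open>A halted configuration before \<open>k\<close> would persist up to
    \<open>k\<close>, hence be accepting already, against the minimality of
    \<open>k\<close>.\<close>
  have "\<not> fhalted ((dstep Orc M ^^ i) (finit x))" if "i < k" for i
    using k dstep_halted_mono[where i=i and C="finit x" and j=k] that by fastforce
  then show "accepts Orc M x"
    using k unfolding accepts_iff nsteps_dsteps[OF finit_state] by blast
qed (auto simp: accepts_iff nsteps_dsteps[OF finit_state])

text \<open>\<open>tm_step\<close> has no step out of a halted configuration, so the genuine run
  ends at the first halting time \<open>k\<close>, where \<open>dstep\<close> has already reached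
  the configuration of time \<open>t\<close>.\<close>

lemma halts_with_content:
  assumes "fhalted ((dstep Orc M ^^ t) (finit x))"
  shows "\<exists>k c. (tm_step Orc M ^^ k) (init_config x) c \<and> halted c \<and>
    tape_content (work_tape c) = fcontent (fst (fst (snd ((dstep Orc M ^^ t) (finit x)))))"
proof -
  obtain k where k: "fhalted ((dstep Orc M ^^ k) (finit x))"
    "\<And>i. i < k \<Longrightarrow> \<not> fhalted ((dstep Orc M ^^ i) (finit x))"
    using assms exists_least_iff[of "\<lambda>k. fhalted ((dstep Orc M ^^ k) (finit x))"] by blast
  have eq: "(dstep Orc M ^^ t) (finit x) = (dstep Orc M ^^ k) (finit x)"
    using k assms dstep_halted_mono[where i=k and C="finit x" and j=t] by (metis not_less)
  have "(nstep Orc M ^^ k) (cfun (init_config x)) ((dstep Orc M ^^ k) (finit x))"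
    using k unfolding cfun_init nsteps_dsteps[OF finit_state] by blast
  from nsteps_steps[OF this] obtain c where
    "(tm_step Orc M ^^ k) (init_config x) c" "cfun c = (dstep Orc M ^^ t) (finit x)"
    unfolding eq by blast
  moreover from this have "halted c"
    using assms by (auto simp: halted_def q_defs cfun_def dest: arg_cong[of _ _ fst])
  moreover have "tape_content (work_tape c) = fcontent (fst (fst (snd (cfun c))))"
    by (simp add: work_tape_def tape_content_fun cfun_def)
  ultimately show ?thesis by metis
qed

end

subsection \<open>Numbering the states\<close>

datatype 'u st = Sp nat | Us 'u

text \<open>Machines may thus be described over structured states. Only the finite closed set
  \<open>S\<close> matters; numbering \<open>Q\<close> from 6 on keeps the prescribed numbers of the
  special states, and the tapes are not changed at all, so runs correspond step by step.\<close>

lemma ex_tm_of_gdelta: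
  fixes d :: "('u st, 'a) gdelta"
  assumes fin: "finite Q"
    and S: "S = Sp ` {..<6} \<union> Us ` Q"
    and cl: "\<And>s a b q w1 m1 w2 m2. s \<in> S \<Longrightarrow> d s a b = (q, w1, m1, w2, m2) \<Longrightarrow>
      q \<in> S \<and> m1 \<in> {-1, 0, 1} \<and> m2 \<in> {-1, 0, 1}"
  shows "\<exists>M enc. wf_tm M \<and> deterministic M \<and>
    (\<forall>i<6. enc (Sp i) = i) \<and>
    (\<forall>Orc x t. (dstep Orc M ^^ t) (finit x) =
      (case (gstep Sp Orc d ^^ t) (Sp 0, (word_fun x, 0), blank) of (s, w, y) \<Rightarrow> (enc s, w, y)))"
proof -
  obtain ix :: "'u \<Rightarrow> nat" and N where ix: "ix ` Q = {i. i < N}" "inj_on ix Q"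
    using finite_imp_inj_to_nat_seg[OF fin] by blast
  define enc where "enc s = (case s of Sp i \<Rightarrow> i | Us u \<Rightarrow> 6 + ix u)" for s
  have inj: "inj_on enc S"
    using ix(2) by (auto simp: S enc_def inj_on_def split: st.splits)
  have enc_less: "enc s < 6 + N" if "s \<in> S" for s
    using that ix(1) by (auto simp: S enc_def split: st.splits)
  have enc_surj: "\<exists>s\<in>S. enc s = i" if "i < 6 + N" for i
  proof (cases "i < 6")
    case True
    then show ?thesis by (intro bexI[of _ "Sp i"]) (auto simp: enc_def S)
  next
    case False
    then have "i - 6 \<in> ix ` Q" using that ix(1) by auto
    then obtain u where "u \<in> Q" "ix u = i - 6" by auto
    then show ?thesis using False by (intro bexI[of _ "Us u"]) (auto simp: enc_def S)
  qed
  define dec where "dec i = inv_into S enc i" for i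
  have dec: "dec (enc s) = s" if "s \<in> S" for s
    using inj that by (simp add: dec_def)
  have dec_in: "dec i \<in> S" if "i < 6 + N" for i
    using enc_surj[OF that] dec by auto
  define M :: "'a tm" where "M = \<lparr>nstates = 6 + N, delta = (\<lambda>i a b.
    case d (dec i) a b of (q, r) \<Rightarrow> [(enc q, r)])\<rparr>"
  have wf: "wf_tm M"
    unfolding wf_tm_def
  proof (intro conjI allI impI)
    show "6 \<le> nstates M" by (simp add: M_def)
    fix i a b assume "i < nstates M"
    then have i: "dec i \<in> S" using dec_in by (simp add: M_def)
    obtain q w1 m1 w2 m2 where r: "d (dec i) a b = (q, w1, m1, w2, m2)"
      by (metis prod_cases5)
    from cl[OF i r] enc_less
    show "\<forall>(q', w1, m1, w2, m2)\<in>set (delta M i a b).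
            q' < nstates M \<and> m1 \<in> {- 1, 0, 1} \<and> m2 \<in> {- 1, 0, 1}"
      by (simp add: M_def r)
    show "delta M i a b \<noteq> []" by (simp add: M_def r)
  qed
  have dt: "deterministic M"
    by (auto simp: deterministic_def M_def split: prod.splits)
  have sp: "enc (Sp i) = i" for i by (simp add: enc_def)
  have spS: "Sp i \<in> S" if "i < 6" for i using that by (auto simp: S)
  have enc_eq: "enc s = i \<longleftrightarrow> s = Sp i" if "s \<in> S" "i < 6" for s i
    using inj_onD[OF inj _ that(1) spS[OF that(2)]] sp by metis
  define emb where "emb C = (case C of (s, w, y) \<Rightarrow> (enc s, w, y))" for C :: "('u st, 'a) fconfig"
  have step: "dstep Orc M (emb C) = emb (gstep Sp Orc d C) \<and> fst (gstep Sp Orc d C) \<in> S"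
    if CS: "fst C \<in> S" for C Orc
  proof -
    obtain s w y where C: "C = (s, w, y)" by (cases C)
    have s: "s \<in> S" using CS C by simp
    obtain q w1 m1 w2 m2 where r: "d s (fread w) (fread y) = (q, w1, m1, w2, m2)"
      by (metis prod_cases5)
    have q: "q \<in> S" using cl[OF s r] by blast
    show ?thesis
      using s q r
      by (auto simp: C emb_def gstep_def enc_eq sp spS M_def dec)
  qed
  have "(dstep Orc M ^^ t) (emb (Sp 0, w, y)) = emb ((gstep Sp Orc d ^^ t) (Sp 0, w, y)) \<and>
     fst ((gstep Sp Orc d ^^ t) (Sp 0, w, y)) \<in> S" for t Orc w y
    using step by (induction t) (auto simp: spS)
  moreover have "emb (Sp 0, (word_fun x, 0), blank) = finit x" for x
    by (simp add: emb_def finit_def sp)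
  ultimately have "(dstep Orc M ^^ t) (finit x) =
      emb ((gstep Sp Orc d ^^ t) (Sp 0, (word_fun x, 0), blank))" for t Orc x
    by metis
  then show ?thesis
    using wf dt sp unfolding emb_def by (intro exI[of _ M] exI[of _ enc]) blast
qed

section \<open>Stack programs\<close>

definition reach :: "('x \<Rightarrow> 'x) \<Rightarrow> nat \<Rightarrow> 'x \<Rightarrow> 'x \<Rightarrow> bool" where
  "reach f n x y \<longleftrightarrow> (\<exists>m\<le>n. (f ^^ m) x = y)"

lemma reach_refl [simp]: "reach f n x x"
  by (auto simp: reach_def intro: exI[of _ 0])

lemma reach_trans: "reach f n x y \<Longrightarrow> reach f m y z \<Longrightarrow> reach f (n + m) x z"
  unfolding reach_def
proof (elim exE conjE)
  fix i j assume "i \<le> n" "j \<le> m" "(f ^^ i) x = y" "(f ^^ j) y = z"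
  then show "\<exists>k\<le>n + m. (f ^^ k) x = z"
    by (intro exI[of _ "j + i"]) (auto simp: funpow_add)
qed

lemma reach_step: "f x = y \<Longrightarrow> reach f n y z \<Longrightarrow> reach f (Suc n) x z"
  unfolding reach_def by (metis Suc_le_mono comp_apply funpow_Suc_right)

lemma reach_mono: "reach f n x y \<Longrightarrow> n \<le> m \<Longrightarrow> reach f m x y"
  unfolding reach_def by (elim exE conjE) (rule exI, rule conjI, erule (1) order_trans)

lemma fread_simp [simp]: "fread (f, p) = f p"
  by (simp add: fread_def)

lemma fwr_simps [simp]:
  "fwr a 0 (f, p) = (f(p := a), p)"
  "fwr a 1 (f, p) = (f(p := a), Suc p)"
  "fwr a (-1) (f, p) = (f(p := a), p - 1)"
  by (auto simp: fwr_def)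

lemma fwr_stay [simp]: "fwr (fread t) 0 t = t"
  by (cases t) simp

lemma gstep_Us: "gstep Sp Orc d (Us u, w, y) = (case d (Us u) (fread w) (fread y) of
    (q', w1, m1, w2, m2) \<Rightarrow> (q', fwr w1 m1 w, fwr w2 m2 y))"
  by (simp add: gstep_def)

text \<open>\<open>'c\<close> is control data held in the machine state, and \<open>Aux\<close> acts
  on the query tape. Conditions see the control only, so a stack is tested by popping:
  \<open>Pop\<close> delivers \<open>None\<close> on an empty stack.\<close>

datatype ('a, 'c) cmd =
    Push nat "'c \<Rightarrow> 'a"
  | Pop nat "'c \<Rightarrow> 'a option \<Rightarrow> 'c"
  | Aux "'c \<Rightarrow> 'a option \<Rightarrow> 'c \<times> 'a option \<times> int"
  | Semi "('a, 'c) cmd" "('a, 'c) cmd" (infixr ";;" 60)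
  | Cond "'c \<Rightarrow> bool" "('a, 'c) cmd" "('a, 'c) cmd"
  | Loop "'c \<Rightarrow> bool" "('a, 'c) cmd"

text \<open>\<open>Emit\<close> asks for copying the query tape to the work tape, where the output
  of a machine is expected.\<close>

datatype verdict = Ask | Halt bool | Emit

definition top :: "'a list \<Rightarrow> 'a option" where
  "top xs = (case xs of [] \<Rightarrow> None | x # _ \<Rightarrow> Some x)"

lemma top_simps [simp]: "top [] = None" "top (x # xs) = Some x"
  by (simp_all add: top_def)

type_synonym ('a, 'c) sconf = "('a, 'c) cmd list \<times> 'c \<times> (nat \<Rightarrow> 'a list) \<times> 'a ftape"

primrec wf_cmd :: "nat \<Rightarrow> 'c set \<Rightarrow> ('a, 'c) cmd \<Rightarrow> bool" where
  "wf_cmd K C (Push j g) \<longleftrightarrow> j < K"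
| "wf_cmd K C (Pop j h) \<longleftrightarrow> j < K \<and> (\<forall>c\<in>C. \<forall>a. h c a \<in> C)"
| "wf_cmd K C (Aux f) \<longleftrightarrow> (\<forall>c\<in>C. \<forall>a. case f c a of (c', w, m) \<Rightarrow> c' \<in> C \<and> m \<in> {-1, 0, 1})"
| "wf_cmd K C (p ;; q) \<longleftrightarrow> wf_cmd K C p \<and> wf_cmd K C q"
| "wf_cmd K C (Cond b p q) \<longleftrightarrow> wf_cmd K C p \<and> wf_cmd K C q"
| "wf_cmd K C (Loop b p) \<longleftrightarrow> wf_cmd K C p"

text \<open>The list of pending commands is part of the machine state. This set is finite although
  programs loop, since a loop body is followed by the same loop with the same rest
  \<open>k\<close>.\<close>

primrec conts :: "('a, 'c) cmd \<Rightarrow> ('a, 'c) cmd list \<Rightarrow> ('a, 'c) cmd list set" where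
  "conts (Push j g) k = {Push j g # k}"
| "conts (Pop j h) k = {Pop j h # k}"
| "conts (Aux f) k = {Aux f # k}"
| "conts (p ;; q) k = insert ((p ;; q) # k) (conts p (q # k) \<union> conts q k)"
| "conts (Cond b p q) k = insert (Cond b p q # k) (conts p k \<union> conts q k)"
| "conts (Loop b p) k = insert (Loop b p # k) (conts p (Loop b p # k))"

fun csucc :: "('a, 'c) cmd list \<Rightarrow> ('a, 'c) cmd list set" where
  "csucc [] = {}"
| "csucc ((p ;; q) # k) = {p # q # k}"
| "csucc (Cond b p q # k) = {p # k, q # k}"
| "csucc (Loop b p # k) = {p # Loop b p # k, k}"
| "csucc (_ # k) = {k}"

lemma finite_conts: "finite (conts p k)"
  by (induction p arbitrary: k) auto

lemma conts_self: "p # k \<in> conts p k"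
  by (cases p) auto

lemma conts_csucc: "l \<in> conts p k \<Longrightarrow> l' \<in> csucc l \<Longrightarrow> l' \<in> insert k (conts p k)"
proof (induction p arbitrary: k)
  case (Semi p q)
  then show ?case using conts_self[of q k] conts_self[of p "q # k"] by fastforce
next
  case (Cond b p q)
  then show ?case using conts_self[of q k] conts_self[of p k] by fastforce
next
  case (Loop b p)
  then show ?case using conts_self[of p "Loop b p # k"] by fastforce
qed auto

lemma conts_wf: "l \<in> conts p k \<Longrightarrow> wf_cmd K C p \<Longrightarrow> l \<noteq> [] \<and> wf_cmd K C (hd l)"
  by (induction p arbitrary: k) auto

text \<open>A program is run in rounds: a round that ends in verdict \<open>Ask\<close> puts the content of the
  auxiliary tape to the oracle, and the next round starts in control state \<open>cy\<close> or \<open>cn\<close>. Thus the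
  continuation need not survive the query.\<close>
record ('a, 'c) prg =
  code :: "('a, 'c) cmd"
  cinit :: 'c
  cyes :: 'c
  cno :: 'c
  verd :: "'c \<Rightarrow> verdict"

fun sstep :: "('a, 'c) prg \<Rightarrow> 'a list set \<Rightarrow> ('a, 'c) sconf \<Rightarrow> ('a, 'c) sconf" where
  "sstep P Orc ([], c, s, y) = (if verd P c = Ask
     then ([code P], if fcontent (fst y) \<in> Orc then cyes P else cno P, s, blank)
     else ([], c, s, y))"
| "sstep P Orc (Push j g # k, c, s, y) = (k, c, s(j := g c # s j), y)"
| "sstep P Orc (Pop j h # k, c, s, y) = (k, h c (top (s j)), s(j := tl (s j)), y)"
| "sstep P Orc (Aux f # k, c, s, y) =
     (case f c (fread y) of (c', w, m) \<Rightarrow> (k, c', s, fwr w m y))"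
| "sstep P Orc ((p ;; q) # k, c, s, y) = (p # q # k, c, s, y)"
| "sstep P Orc (Cond b p q # k, c, s, y) = ((if b c then p else q) # k, c, s, y)"
| "sstep P Orc (Loop b p # k, c, s, y) = (if b c then p # Loop b p # k else k, c, s, y)"

subsection \<open>Compilation to machines\<close>

text \<open>A push or pop walks to the first free entry of its stack (\<open>Scan\<close>). A pop
  then checks at the block edge whether it is block 0 (\<open>Chk\<close>) and fetches the top entry
  (\<open>Take\<close>). Finally the head walks back to cell 0 (\<open>Home\<close>).
  \<open>Mv n d q\<close> stands for \<open>n\<close> remaining moves before phase
  \<open>q\<close>.\<close>

datatype phase = Start | Scan | Home | Chk | Take | Mv nat bool phase

text \<open>\<open>Ld1\<close> and \<open>Ld2\<close> carry the input over to the query tape and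
  rewind; \<open>Out1\<close> and \<open>Out2\<close> rewind and bring the output back.\<close>

datatype ('a, 'c) pstate = Ld1 | Ld2 | Run "('a, 'c) cmd list" 'c phase | Out1 | Out2

type_synonym ('a, 'c) paction =
  "'a option \<Rightarrow> 'a option \<Rightarrow> ('a, 'c) pstate st \<times> 'a option \<times> int \<times> 'a option \<times> int"

text \<open>The work tape consists of blocks of width \<open>K + 1\<close>. Cell 0 of a block is nonblank only
  in block 0; cell \<open>j + 1\<close> of block \<open>i\<close> holds the entry of stack \<open>j\<close> at height \<open>i\<close>.\<close>
definition lay :: "nat \<Rightarrow> 'a \<Rightarrow> (nat \<Rightarrow> 'a list) \<Rightarrow> nat \<Rightarrow> 'a option" where
  "lay K mk s p = (let i = p div Suc K; o' = p mod Suc K in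
     if o' = 0 then (if i = 0 then Some mk else None)
     else if i < length (s (o' - 1)) then Some (rev (s (o' - 1)) ! i) else None)"

context
  fixes K :: nat and mk :: 'a and P :: "('a, 'c) prg" and C :: "'c set"
  assumes wfP: "wf_cmd K C (code P)" and finC: "finite C"
    and CP: "cinit P \<in> C" "cyes P \<in> C" "cno P \<in> C"
begin

fun pdelta_run :: "('a, 'c) cmd list \<Rightarrow> 'c \<Rightarrow> ('a, 'c) paction" where
  "pdelta_run [] c a b = (case verd P c of
      Ask \<Rightarrow> (Sp 3, a, 0, b, 0)
    | Halt v \<Rightarrow> (Sp (if v then 1 else 2), a, 0, b, 0)
    | Emit \<Rightarrow> (Us Out1, a, 0, b, -1))"
| "pdelta_run (Push j g # k) c a b = (Us (Run (Push j g # k) c (Mv (Suc j) True Scan)), a, 0, b, 0)"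
| "pdelta_run (Pop j h # k) c a b = (Us (Run (Pop j h # k) c (Mv (Suc j) True Scan)), a, 0, b, 0)"
| "pdelta_run (Aux f # k) c a b =
    (case f c b of (c', w, m) \<Rightarrow> (Us (Run k c' Start), a, 0, w, m))"
| "pdelta_run ((p ;; q) # k) c a b = (Us (Run (p # q # k) c Start), a, 0, b, 0)"
| "pdelta_run (Cond t p q # k) c a b = (Us (Run ((if t c then p else q) # k) c Start), a, 0, b, 0)"
| "pdelta_run (Loop t p # k) c a b =
    (Us (Run (if t c then p # Loop t p # k else k) c Start), a, 0, b, 0)"

fun pdelta_scan :: "('a, 'c) cmd list \<Rightarrow> 'c \<Rightarrow> ('a, 'c) paction" where
  "pdelta_scan (Push j g # k) c a b =
    (if a \<noteq> None then (Us (Run (Push j g # k) c (Mv (Suc K) True Scan)), a, 0, b, 0)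
     else (Us (Run (Push j g # k) c (Mv (Suc j) False Home)), Some (g c), 0, b, 0))"
| "pdelta_scan (Pop j h # k) c a b =
    (if a \<noteq> None then (Us (Run (Pop j h # k) c (Mv (Suc K) True Scan)), a, 0, b, 0)
     else (Us (Run (Pop j h # k) c (Mv (Suc j) False Chk)), a, 0, b, 0))"
| "pdelta_scan _ c a b = (Sp 2, a, 0, b, 0)"

fun pdelta_chk :: "('a, 'c) cmd list \<Rightarrow> 'c \<Rightarrow> ('a, 'c) paction" where
  "pdelta_chk (Pop j h # k) c a b =
    (if a \<noteq> None then (Us (Run k (h c None) Start), a, 0, b, 0)
     else (Us (Run (Pop j h # k) c (Mv (K - j) False Take)), a, 0, b, 0))"
| "pdelta_chk _ c a b = (Sp 2, a, 0, b, 0)"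

fun pdelta_take :: "('a, 'c) cmd list \<Rightarrow> 'c \<Rightarrow> ('a, 'c) paction" where
  "pdelta_take (Pop j h # k) c a b =
    (Us (Run (Pop j h # k) (h c a) (Mv (Suc j) False Home)), None, 0, b, 0)"
| "pdelta_take _ c a b = (Sp 2, a, 0, b, 0)"

fun pdelta_home :: "('a, 'c) cmd list \<Rightarrow> 'c \<Rightarrow> ('a, 'c) paction" where
  "pdelta_home (Push j g # k) c a b =
    (if a \<noteq> None then (Us (Run k c Start), a, 0, b, 0)
     else (Us (Run (Push j g # k) c (Mv (Suc K) False Home)), a, 0, b, 0))"
| "pdelta_home (Pop j h # k) c a b =
    (if a \<noteq> None then (Us (Run k c Start), a, 0, b, 0)
     else (Us (Run (Pop j h # k) c (Mv (Suc K) False Home)), a, 0, b, 0))"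
| "pdelta_home _ c a b = (Sp 2, a, 0, b, 0)"

fun pdelta :: "(('a, 'c) pstate st, 'a) gdelta" where
  "pdelta (Sp n) a b = (
    if n = 0 then (Us Ld1, Some mk, 1, a, 1)
    else if n = 4 then (Us (Run [code P] (cyes P) Start), a, 0, b, 0)
    else if n = 5 then (Us (Run [code P] (cno P) Start), a, 0, b, 0)
    else (Sp 2, a, 0, b, 0))"
| "pdelta (Us Ld1) a b = (if a \<noteq> None then (Us Ld1, None, 1, a, 1) else (Us Ld2, None, -1, b, -1))"
| "pdelta (Us Ld2) a b = (if a \<noteq> None then (Us (Run [code P] (cinit P) Start), a, 0, b, 0)
     else (Us Ld2, None, -1, b, -1))"
| "pdelta (Us Out1) a b = (if b \<noteq> None then (Us Out1, a, 0, b, -1) else (Us Out2, a, 0, b, 1))"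
| "pdelta (Us Out2) a b = (if b \<noteq> None then (Us Out2, b, 1, b, 1) else (Sp 1, None, 0, None, 0))"
| "pdelta (Us (Run l c Start)) a b = pdelta_run l c a b"
| "pdelta (Us (Run l c (Mv 0 d q))) a b = (Us (Run l c q), a, 0, b, 0)"
| "pdelta (Us (Run l c (Mv (Suc n) d q))) a b =
     (Us (Run l c (Mv n d q)), a, (if d then 1 else -1), b, 0)"
| "pdelta (Us (Run l c Scan)) a b = pdelta_scan l c a b"
| "pdelta (Us (Run l c Chk)) a b = pdelta_chk l c a b"
| "pdelta (Us (Run l c Take)) a b = pdelta_take l c a b"
| "pdelta (Us (Run l c Home)) a b = pdelta_home l c a b"

definition "phases = {Start, Scan, Home, Chk, Take} \<union>
  (\<Union>n\<in>{..Suc K}. \<Union>d. Mv n d ` {Scan, Home, Chk, Take})"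

definition "lsts = insert [] (conts (code P) [])"

definition "pstates = {Ld1, Ld2, Out1, Out2} \<union> (\<Union>l\<in>lsts. \<Union>c\<in>C. Run l c ` phases)"

lemma finite_pstates: "finite pstates"
  unfolding pstates_def phases_def lsts_def
  by (intro finite_UnI finite_UN_I finite_imageI finC)
    (auto simp: finite_conts)

lemma lsts_csucc: "l \<in> lsts \<Longrightarrow> l' \<in> csucc l \<Longrightarrow> l' \<in> lsts"
  using conts_csucc by (fastforce simp: lsts_def)

lemma lsts_wf: "p # k \<in> lsts \<Longrightarrow> wf_cmd K C p"
  using conts_wf[OF _ wfP, of "p # k" "[]"] by (auto simp: lsts_def)

lemma lsts_code: "[code P] \<in> lsts"
  using conts_self by (auto simp: lsts_def)

lemma lsts_tl: "p # k \<in> lsts \<Longrightarrow> \<exists>j g h. p = Push j g \<or> p = Pop j h \<Longrightarrow> k \<in> lsts"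
  using lsts_csucc[of "p # k" k] by auto

lemma run_in_pstates [simp]:
  "Run l c q \<in> pstates \<longleftrightarrow> l \<in> lsts \<and> c \<in> C \<and> q \<in> phases"
  "Ld1 \<in> pstates" "Ld2 \<in> pstates" "Out1 \<in> pstates" "Out2 \<in> pstates"
  by (auto simp: pstates_def)

lemma mv_in_phases [simp]:
  "Mv n d q \<in> phases \<longleftrightarrow> n \<le> Suc K \<and> q \<in> {Scan, Home, Chk, Take}"
  "Start \<in> phases" "Scan \<in> phases" "Home \<in> phases" "Chk \<in> phases" "Take \<in> phases"
  by (auto simp: phases_def)

lemma Us_in_states [simp]: "Us u \<in> Sp ` A \<union> Us ` Q \<longleftrightarrow> u \<in> Q" "Sp i \<in> Sp ` A \<union> Us ` Q \<longleftrightarrow> i \<in> A"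
  by auto

lemma pdelta_run_closed:
  assumes l: "l \<in> lsts" and c: "c \<in> C" and r: "pdelta_run l c a b = (q, w1, m1, w2, m2)"
  shows "q \<in> Sp ` {..<6} \<union> Us ` pstates \<and> m1 \<in> {-1, 0, 1} \<and> m2 \<in> {-1, 0, 1}"
proof (cases l)
  case Nil
  then show ?thesis using r by (auto split: verdict.splits)
next
  case (Cons p k)
  have wf: "wf_cmd K C p" using lsts_wf l Cons by blast
  have su: "l' \<in> lsts" if "l' \<in> csucc (p # k)" for l'
    using lsts_csucc l that Cons by blast
  show ?thesis
    using r l c wf su Cons
    by (cases p) (auto simp del: Un_iff split: prod.splits)
qed

lemma pdelta_closed:
  assumes s: "s \<in> Sp ` {..<6} \<union> Us ` pstates" and r: "pdelta s a b = (q, w1, m1, w2, m2)"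
  shows "q \<in> Sp ` {..<6} \<union> Us ` pstates \<and> m1 \<in> {-1, 0, 1} \<and> m2 \<in> {-1, 0, 1}"
proof (cases s)
  case (Sp n)
  then show ?thesis using r CP lsts_code by (auto simp del: Un_iff split: if_splits)
next
  case (Us u)
  then have u: "u \<in> pstates" using s by auto
  show ?thesis
  proof (cases u)
    case (Run l c ph)
    then have l: "l \<in> lsts" and c: "c \<in> C" and ph: "ph \<in> phases" using u by auto
    show ?thesis
    proof (cases ph)
      case Start
      then show ?thesis using r Us Run pdelta_run_closed[OF l c] by simp
    next
      case Scan
      show ?thesis
      proof (cases l)
        case Nil
        with r Us Run Scan show ?thesis by (auto simp del: Un_iff)
      next
        case (Cons p k)
        then show ?thesis
          using r Us Run Scan l c lsts_wf[of p k] lsts_tl[of p k]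
          by (cases p) (auto simp del: Un_iff split: if_splits)
      qed
    next
      case Home
      show ?thesis
      proof (cases l)
        case Nil
        with r Us Run Home show ?thesis by (auto simp del: Un_iff)
      next
        case (Cons p k)
        then show ?thesis
          using r Us Run Home l c lsts_wf[of p k] lsts_tl[of p k]
          by (cases p) (auto simp del: Un_iff split: if_splits)
      qed
    next
      case Chk
      show ?thesis
      proof (cases l)
        case Nil
        with r Us Run Chk show ?thesis by (auto simp del: Un_iff)
      next
        case (Cons p k)
        then show ?thesis
          using r Us Run Chk l c lsts_wf[of p k] lsts_tl[of p k]
          by (cases p) (auto simp del: Un_iff split: if_splits)
      qed
    next
      case Take
      show ?thesis
      proof (cases l)
        case Nil
        with r Us Run Take show ?thesis by (auto simp del: Un_iff)
      next
        case (Cons p k)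
        then show ?thesis
          using r Us Run Take l c lsts_wf[of p k] lsts_tl[of p k]
          by (cases p) (auto simp del: Un_iff split: if_splits)
      qed
    next
      case (Mv n d q')
      then show ?thesis
        using r Us Run l c ph by (cases n) (auto simp del: Un_iff split: if_splits)
    qed
  qed (use r Us CP lsts_code in \<open>auto simp del: Un_iff split: if_splits\<close>)
qed

section \<open>Stack operations on the interleaved tape\<close>

definition edge :: "nat \<Rightarrow> nat" where "edge i = i * Suc K"

definition cell :: "nat \<Rightarrow> nat \<Rightarrow> nat" where "cell i j = i * Suc K + Suc j"

lemma cell_moves:
  "edge 0 = 0" "cell 0 j = Suc j" "cell i j - Suc j = edge i" "edge (Suc i) - Suc K = edge i"
  "cell i j + Suc K = cell (Suc i) j" "j < K \<Longrightarrow> edge (Suc i) - (K - j) = cell i j"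
  by (simp_all add: edge_def cell_def)

lemma cell_div_mod:
  assumes "j < K"
  shows "cell i j div Suc K = i" "cell i j mod Suc K = Suc j"
proof -
  have "cell i j = Suc j + i * Suc K" by (simp add: cell_def)
  moreover have "(Suc j + i * Suc K) div Suc K = i + Suc j div Suc K"
    by (rule div_mult_self1) simp
  moreover have "(Suc j + i * Suc K) mod Suc K = Suc j mod Suc K"
    by (rule mod_mult_self1)
  ultimately show "cell i j div Suc K = i" "cell i j mod Suc K = Suc j"
    using assms by (simp_all only: div_less mod_less Suc_less_eq add_0_right)
qed

lemma edge_div_mod: "edge i div Suc K = i" "edge i mod Suc K = 0"
  unfolding edge_def by (simp_all only: nonzero_mult_div_cancel_right mod_mult_self2_is_0)

lemma cell_eq_iff: "j < K \<Longrightarrow> j' < K \<Longrightarrow> cell i j = cell i' j' \<longleftrightarrow> i = i' \<and> j = j'"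
  by (metis cell_div_mod Suc_inject)

lemma edge_neq_cell: "j < K \<Longrightarrow> edge i \<noteq> cell i' j"
  by (metis cell_div_mod(2) edge_div_mod(2) Suc_not_Zero)

lemma lay_cell: "j < K \<Longrightarrow>
    lay K mk s (cell i j) = (if i < length (s j) then Some (rev (s j) ! i) else None)"
  by (simp add: lay_def cell_div_mod Let_def)

lemma lay_edge: "lay K mk s (edge i) = (if i = 0 then Some mk else None)"
  by (simp add: lay_def edge_div_mod Let_def)

lemma lay_eqI:
  assumes "\<And>i. f (edge i) = (if i = 0 then Some mk else None)"
    and "\<And>i j. j < K \<Longrightarrow> f (cell i j) = (if i < length (s j) then Some (rev (s j) ! i) else None)"
  shows "f = lay K mk s"
proof
  fix p
  show "f p = lay K mk s p"
  proof (cases "p mod Suc K")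
    case 0
    then have "p = edge (p div Suc K)"
      unfolding edge_def by (metis add.right_neutral div_mult_mod_eq)
    then show ?thesis using assms(1)[of "p div Suc K"] lay_edge[of s "p div Suc K"] by metis
  next
    case (Suc j)
    then have j: "j < K" by (metis Suc_less_eq mod_less_divisor zero_less_Suc)
    have "p = cell (p div Suc K) j" unfolding cell_def by (metis Suc div_mult_mod_eq)
    then show ?thesis using assms(2)[OF j, of "p div Suc K"] lay_cell[OF j, of s "p div Suc K"]
      by metis
  qed
qed

text \<open>Entries are addressed by their height above the bottom, so older entries keep their
  cells and exactly the first free cell changes.\<close>

lemma lay_push:
  assumes "j < K"
  shows "(lay K mk s)(cell (length (s j)) j := Some a) = lay K mk (s(j := a # s j))"
proof (rule lay_eqI)
  show "((lay K mk s)(cell (length (s j)) j := Some a)) (edge i) =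
      (if i = 0 then Some mk else None)" for i
    using edge_neq_cell[OF assms] lay_edge by (metis fun_upd_other)
  show "((lay K mk s)(cell (length (s j)) j := Some a)) (cell i j') =
      (if i < length ((s(j := a # s j)) j')
       then Some (rev ((s(j := a # s j)) j') ! i) else None)" if "j' < K" for i j'
    using that assms
    by (auto simp: cell_eq_iff lay_cell nth_append less_Suc_eq)
qed

lemma lay_pop:
  assumes "j < K" "s j \<noteq> []"
  shows "(lay K mk s)(cell (length (s j) - 1) j := None) = lay K mk (s(j := tl (s j)))"
proof (rule lay_eqI)
  show "((lay K mk s)(cell (length (s j) - 1) j := None)) (edge i) =
      (if i = 0 then Some mk else None)" for i
    using edge_neq_cell[OF assms(1)] lay_edge by (metis fun_upd_other)
  obtain x xs where x: "s j = x # xs" using assms(2) by (cases "s j") auto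
  show "((lay K mk s)(cell (length (s j) - 1) j := None)) (cell i j') =
      (if i < length ((s(j := tl (s j))) j')
       then Some (rev ((s(j := tl (s j))) j') ! i) else None)" if "j' < K" for i j'
    using that assms
    by (auto simp: cell_eq_iff lay_cell nth_append less_Suc_eq x)
qed

lemma lay_top:
  assumes "j < K" "s j \<noteq> []"
  shows "lay K mk s (cell (length (s j) - 1) j) = top (s j)"
  using assms by (cases "s j") (auto simp: lay_cell nth_append)

abbreviation "G Orc \<equiv> gstep Sp Orc pdelta"

definition emb :: "('a, 'c) sconf \<Rightarrow> (('a, 'c) pstate st, 'a) fconfig" where
  "emb S = (case S of (l, c, s, y) \<Rightarrow> (Us (Run l c Start), (lay K mk s, 0), y))"

lemma mv_right: "reach (G Orc) (Suc n) (Us (Run l c (Mv n True q)), (f, p), y)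
    (Us (Run l c q), (f, p + n), y)"
proof (induction n arbitrary: p)
  case (Suc n)
  show ?case
    by (rule reach_step, rule refl, use Suc.IH[of "Suc p"] in \<open>simp add: gstep_Us\<close>)
qed (rule reach_step, rule refl, simp add: gstep_Us)

lemma mv_left: "reach (G Orc) (Suc n) (Us (Run l c (Mv n False q)), (f, p), y)
    (Us (Run l c q), (f, p - n), y)"
proof (induction n arbitrary: p)
  case (Suc n)
  show ?case
    by (rule reach_step, rule refl, use Suc.IH[of "p - 1"] in \<open>simp add: gstep_Us\<close>)
qed (rule reach_step, rule refl, simp add: gstep_Us)

definition stack_head :: "nat \<Rightarrow> ('a, 'c) cmd list \<Rightarrow> bool" where
  "stack_head j l \<longleftrightarrow> (\<exists>k g h. l = Push j g # k \<or> l = Pop j h # k)"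

text \<open>One block costs \<open>K + 3\<close> steps: \<open>K + 1\<close> moves, one step to
  leave the finished \<open>Mv\<close>, one to inspect the cell.\<close>

lemma scan:
  assumes "stack_head j l" "j < K" "i + n = length (s j)"
  shows "reach (G Orc) (n * (K + 3)) (Us (Run l c Scan), (lay K mk s, cell i j), y)
    (Us (Run l c Scan), (lay K mk s, cell (length (s j)) j), y)"
  using assms(3)
proof (induction n arbitrary: i)
  case (Suc n)
  have "lay K mk s (cell i j) \<noteq> None"
    using Suc.prems assms(2) by (simp add: lay_cell)
  then have 1: "G Orc (Us (Run l c Scan), (lay K mk s, cell i j), y) =
     (Us (Run l c (Mv (Suc K) True Scan)), (lay K mk s, cell i j), y)"
    using assms(1) by (auto simp: gstep_Us stack_head_def fun_upd_idem)
  have 2: "reach (G Orc) (Suc (Suc K))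
     (Us (Run l c (Mv (Suc K) True Scan)), (lay K mk s, cell i j), y)
     (Us (Run l c Scan), (lay K mk s, cell (Suc i) j), y)"
    using mv_right[of Orc "Suc K" l c Scan "lay K mk s" "cell i j" y]
    by (simp only: cell_moves)
  have 3: "reach (G Orc) (n * (K + 3)) (Us (Run l c Scan), (lay K mk s, cell (Suc i) j), y)
    (Us (Run l c Scan), (lay K mk s, cell (length (s j)) j), y)"
    using Suc.IH[of "Suc i"] Suc.prems by simp
  from reach_step[OF 1 reach_trans[OF 2 3]] show ?case by (rule reach_mono) simp
qed simp

text \<open>The edge of block 0 is the only nonblank edge, so the walk over edges ends exactly at
  cell 0.\<close>

lemma home:
  assumes "stack_head j l"
  shows "reach (G Orc) (i * (K + 3) + 1) (Us (Run l c Home), (lay K mk s, edge i), y)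
    (emb (tl l, c, s, y))"
proof (induction i)
  case 0
  have "lay K mk s 0 = Some mk" using lay_edge[of s 0] by (simp add: cell_moves)
  then have "G Orc (Us (Run l c Home), (lay K mk s, edge 0), y) = emb (tl l, c, s, y)"
    using assms by (auto simp: gstep_Us emb_def stack_head_def cell_moves fun_upd_idem)
  then have "reach (G Orc) (Suc 0) (Us (Run l c Home), (lay K mk s, edge 0), y) (emb (tl l, c, s, y))"
    by (rule reach_step) simp
  then show ?case by simp
next
  case (Suc i)
  have "lay K mk s (edge (Suc i)) = None"
    using lay_edge[of s "Suc i"] by simp
  then have 1: "G Orc (Us (Run l c Home), (lay K mk s, edge (Suc i)), y) =
     (Us (Run l c (Mv (Suc K) False Home)), (lay K mk s, edge (Suc i)), y)"
    using assms(1) by (auto simp: gstep_Us stack_head_def fun_upd_idem)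
  have 2: "reach (G Orc) (Suc (Suc K))
     (Us (Run l c (Mv (Suc K) False Home)), (lay K mk s, edge (Suc i)), y)
     (Us (Run l c Home), (lay K mk s, edge i), y)"
    using mv_left[of Orc "Suc K" l c Home "lay K mk s" "edge (Suc i)" y]
    by (simp only: cell_moves)
  from reach_step[OF 1 reach_trans[OF 2 Suc.IH]] show ?case by (rule reach_mono) simp
qed

lemma push_sim:
  assumes "j < K"
  shows "reach (G Orc) (2 * (K + 4) * (length (s j) + 1)) (emb (Push j g # k, c, s, y))
    (emb (k, c, s(j := g c # s j), y))"
proof -
  let ?l = "Push j g # k" and ?n = "length (s j)"
  have h: "stack_head j ?l" by (auto simp: stack_head_def)
  have 1: "G Orc (emb (?l, c, s, y)) =
      (Us (Run ?l c (Mv (Suc j) True Scan)), (lay K mk s, 0), y)"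
    by (simp add: gstep_Us emb_def)
  have 2: "reach (G Orc) (j + 2) (Us (Run ?l c (Mv (Suc j) True Scan)), (lay K mk s, 0), y)
      (Us (Run ?l c Scan), (lay K mk s, cell 0 j), y)"
    using mv_right[of Orc "Suc j" ?l c Scan "lay K mk s" 0 y] by (simp add: cell_moves)
  note 3 = scan[OF h assms, of 0 ?n s Orc c y, OF add_0]
  have "lay K mk s (cell ?n j) = None"
    using assms by (simp add: lay_cell)
  then have 4: "G Orc (Us (Run ?l c Scan), (lay K mk s, cell ?n j), y) =
      (Us (Run ?l c (Mv (Suc j) False Home)),
        (lay K mk (s(j := g c # s j)), cell ?n j), y)"
    using lay_push[OF assms, of s "g c"] by (simp add: gstep_Us)
  have 5: "reach (G Orc) (j + 2) (Us (Run ?l c (Mv (Suc j) False Home)),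
        (lay K mk (s(j := g c # s j)), cell ?n j), y)
      (Us (Run ?l c Home), (lay K mk (s(j := g c # s j)), edge ?n), y)"
    using mv_left[of Orc "Suc j" ?l c Home _ "cell ?n j" y] by (simp only: cell_moves) simp
  note 6 = home[OF h, of Orc ?n c "s(j := g c # s j)" y]
  from reach_step[OF 1 reach_trans[OF 2 reach_trans[OF 3 reach_step[OF 4 reach_trans[OF 5 6]]]]]
  show ?thesis unfolding list.sel by (rule reach_mono) (use assms in \<open>simp add: algebra_simps\<close>)
qed

text \<open>From the first free entry the head goes to the edge of that block. The mark there means
  block 0, hence an empty stack; otherwise the top entry lies in the block before,
  \<open>K - j\<close> cells to the left.\<close>

lemma pop_sim:
  assumes "j < K"
  shows "reach (G Orc) (2 * (K + 4) * (length (s j) + 1)) (emb (Pop j h # k, c, s, y))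
    (emb (k, h c (top (s j)), s(j := tl (s j)), y))"
proof -
  let ?l = "Pop j h # k" and ?n = "length (s j)"
  have hd: "stack_head j ?l" by (auto simp: stack_head_def)
  have 1: "G Orc (emb (?l, c, s, y)) =
      (Us (Run ?l c (Mv (Suc j) True Scan)), (lay K mk s, 0), y)"
    by (simp add: gstep_Us emb_def)
  have 2: "reach (G Orc) (j + 2) (Us (Run ?l c (Mv (Suc j) True Scan)), (lay K mk s, 0), y)
      (Us (Run ?l c Scan), (lay K mk s, cell 0 j), y)"
    using mv_right[of Orc "Suc j" ?l c Scan "lay K mk s" 0 y] by (simp add: cell_moves)
  note 3 = scan[OF hd assms, of 0 ?n s Orc c y, OF add_0]
  have "lay K mk s (cell ?n j) = None"
    using assms by (simp add: lay_cell)
  then have 4: "G Orc (Us (Run ?l c Scan), (lay K mk s, cell ?n j), y) =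
      (Us (Run ?l c (Mv (Suc j) False Chk)), (lay K mk s, cell ?n j), y)"
    by (simp add: gstep_Us fun_upd_idem)
  have 5: "reach (G Orc) (j + 2) (Us (Run ?l c (Mv (Suc j) False Chk)),
        (lay K mk s, cell ?n j), y)
      (Us (Run ?l c Chk), (lay K mk s, edge ?n), y)"
    using mv_left[of Orc "Suc j" ?l c Chk _ "cell ?n j" y] by (simp only: cell_moves) simp
  note to_chk = reach_step[OF 1 reach_trans[OF 2 reach_trans[OF 3 reach_step[OF 4 5]]]]
  show ?thesis
  proof (cases "s j")
    case Nil
    have "G Orc (Us (Run ?l c Chk), (lay K mk s, edge ?n), y) =
        emb (k, h c (top (s j)), s(j := tl (s j)), y)"
      using lay_edge[of s 0] Nil by (simp add: gstep_Us emb_def fun_upd_idem cell_moves)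
    then have "reach (G Orc) (Suc 0) (Us (Run ?l c Chk), (lay K mk s, edge ?n), y)
        (emb (k, h c (top (s j)), s(j := tl (s j)), y))"
      by (rule reach_step) simp
    from reach_trans[OF to_chk this]
    show ?thesis by (rule reach_mono) (use assms in \<open>simp add: algebra_simps\<close>)
  next
    case (Cons x xs)
    let ?m = "length xs" and ?s = "s(j := tl (s j))"
    have "lay K mk s (edge ?n) = None" using lay_edge[of s ?n] Cons by simp
    then have 6: "G Orc (Us (Run ?l c Chk), (lay K mk s, edge ?n), y) =
        (Us (Run ?l c (Mv (K - j) False Take)), (lay K mk s, edge ?n), y)"
      by (simp add: gstep_Us fun_upd_idem)
    have 7: "reach (G Orc) (Suc (K - j))
        (Us (Run ?l c (Mv (K - j) False Take)), (lay K mk s, edge ?n), y)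
        (Us (Run ?l c Take), (lay K mk s, cell ?m j), y)"
      using mv_left[of Orc "K - j" ?l c Take _ "edge (Suc ?m)" y] cell_moves(6)[OF assms, of ?m] Cons by simp
    have 8: "G Orc (Us (Run ?l c Take), (lay K mk s, cell ?m j), y) =
        (Us (Run ?l (h c (top (s j))) (Mv (Suc j) False Home)),
         (lay K mk ?s, cell ?m j), y)"
      using lay_pop[OF assms, of s] lay_top[OF assms, of s] Cons
      by (simp add: gstep_Us)
    have 9: "reach (G Orc) (j + 2) (Us (Run ?l (h c (top (s j))) (Mv (Suc j) False Home)),
          (lay K mk ?s, cell ?m j), y)
        (Us (Run ?l (h c (top (s j))) Home), (lay K mk ?s, edge ?m), y)"
      using mv_left[of Orc "Suc j" ?l _ Home _ "cell ?m j" y] by (simp only: cell_moves) simp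
    note 10 = home[OF hd, of Orc ?m "h c (top (s j))" ?s y]
    from reach_trans[OF to_chk reach_step[OF 6 reach_trans[OF 7 reach_step[OF 8
            reach_trans[OF 9 10]]]]]
    show ?thesis unfolding list.sel by (rule reach_mono) (use assms Cons in \<open>simp add: algebra_simps\<close>)
  qed
qed

lemma sstep_lsts: "fst S \<in> lsts \<Longrightarrow> fst (sstep P Orc S) \<in> lsts"
proof -
  assume l: "fst S \<in> lsts"
  obtain l c s y where S: "S = (l, c, s, y)" by (cases S)
  show ?thesis
  proof (cases l)
    case Nil
    then show ?thesis using l S lsts_code by auto
  next
    case (Cons p k)
    have "fst (sstep P Orc S) \<in> csucc (p # k)"
      by (cases p) (auto simp: S Cons split: prod.split)
    then show ?thesis using lsts_csucc l S Cons by fastforce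
  qed
qed

lemma sstep_length:
  "\<forall>j. length (fst (snd (snd S)) j) \<le> n \<Longrightarrow>
    \<forall>j. length (fst (snd (snd (sstep P Orc S))) j) \<le> Suc n"
proof -
  assume a: "\<forall>j. length (fst (snd (snd S)) j) \<le> n"
  obtain l c s y where S: "S = (l, c, s, y)" by (cases S)
  show ?thesis
  proof (cases l)
    case Nil
    then show ?thesis using a S by (auto intro: le_SucI)
  next
    case (Cons p k)
    then show ?thesis using a S
      by (cases p) (auto intro: le_SucI simp: diff_le_self[THEN le_trans] split: prod.split)
  qed
qed

text \<open>The three steps lead into the query state, through the oracle call, and out of the
  answer state.\<close>

lemma ask_sim:
  assumes "verd P c = Ask"
  shows "reach (G Orc) 3 (emb ([], c, s, y)) (emb (sstep P Orc ([], c, s, y)))"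
proof -
  let ?ans = "fcontent (fst y) \<in> Orc"
  have 1: "G Orc (emb ([], c, s, y)) = (Sp 3, (lay K mk s, 0), y)"
    using assms by (simp add: emb_def gstep_Us)
  have 2: "G Orc (Sp 3, (lay K mk s, 0), y) = (Sp (if ?ans then 4 else 5), (lay K mk s, 0), blank)"
    by (simp add: gstep_def)
  have 3: "G Orc (Sp (if ?ans then 4 else 5), (lay K mk s, 0), blank) =
      emb (sstep P Orc ([], c, s, y))"
    using assms by (simp add: gstep_def emb_def)
  have "reach (G Orc) (Suc (Suc (Suc 0))) (emb ([], c, s, y)) (emb (sstep P Orc ([], c, s, y)))"
    by (rule reach_step, rule 1, rule reach_step, rule 2, rule reach_step, rule 3) simp
  then show ?thesis by (simp add: numeral_3_eq_3)
qed

lemma sstep_sim: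
  assumes l: "fst S \<in> lsts" and len: "\<forall>j. length (fst (snd (snd S)) j) \<le> n"
  shows "reach (G Orc) (2 * (K + 4) * (n + 1)) (emb S) (emb (sstep P Orc S))"
proof -
  obtain l c s y where S: "S = (l, c, s, y)" by (cases S)
  show ?thesis
  proof (cases l)
    case Nil
    show ?thesis
    proof (cases "verd P c = Ask")
      case True
      from ask_sim[OF this] show ?thesis unfolding S Nil by (rule reach_mono) simp
    qed (simp add: S Nil)
  next
    case (Cons p k)
    have wf: "wf_cmd K C p" using lsts_wf l S Cons by auto
    have le: "2 * (K + 4) * (length (s j) + 1) \<le> 2 * (K + 4) * (n + 1)" for j
      using len S by (intro mult_le_mono2) simp
    have one: "reach (G Orc) (2 * (K + 4) * (n + 1)) x z" if "G Orc x = z" for x z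
    proof -
      have "reach (G Orc) (Suc 0) x z" using that by (rule reach_step) simp
      then show ?thesis by (rule reach_mono) simp
    qed
    show ?thesis
    proof (cases p)
      case (Push j g)
      have "j < K" using wf Push by simp
      from reach_mono[OF push_sim[OF this, where s = s] le] show ?thesis
        unfolding S Cons Push sstep.simps .
    next
      case (Pop j h)
      have "j < K" using wf Pop by simp
      from reach_mono[OF pop_sim[OF this, where s = s] le] show ?thesis
        unfolding S Cons Pop sstep.simps .
    qed (rule one, simp add: S Cons emb_def gstep_Us split: prod.split)+
  qed
qed

text \<open>All stacks start empty and grow by at most one entry per step, so each of the
  \<open>n\<close> steps costs a number of machine steps linear in \<open>n\<close>, and the total
  is quadratic.\<close>

lemma ssteps_sim:
  assumes "l \<in> lsts"
  shows "reach (G Orc) (2 * (K + 4) * (n * n)) (emb (l, c, \<lambda>_. [], y))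
      (emb ((sstep P Orc ^^ n) (l, c, \<lambda>_. [], y))) \<and>
    fst ((sstep P Orc ^^ n) (l, c, \<lambda>_. [], y)) \<in> lsts \<and>
    (\<forall>j. length (fst (snd (snd ((sstep P Orc ^^ n) (l, c, \<lambda>_. [], y)))) j) \<le> n)"
proof (induction n)
  case (Suc n)
  let ?S = "(sstep P Orc ^^ n) (l, c, \<lambda>_. [], y)"
  have 1: "reach (G Orc) (2 * (K + 4) * (n * n)) (emb (l, c, \<lambda>_. [], y)) (emb ?S)"
    and 2: "fst ?S \<in> lsts" and 3: "\<forall>j. length (fst (snd (snd ?S)) j) \<le> n"
    using Suc by auto
  have "2 * (K + 4) * (n * n) + 2 * (K + 4) * (n + 1) = 2 * (K + 4) * (n * n + n + 1)"
    by (simp only: distrib_left)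
  also have "\<dots> \<le> 2 * (K + 4) * (Suc n * Suc n)"
    by (intro mult_le_mono2) simp
  finally have "reach (G Orc) (2 * (K + 4) * (Suc n * Suc n)) (emb (l, c, \<lambda>_. [], y))
      (emb (sstep P Orc ?S))"
    by (rule reach_mono[OF reach_trans[OF 1 sstep_sim[OF 2 3]]])
  then show ?case using sstep_lsts[OF 2] sstep_length[OF 3] by simp
qed (use assms in simp)

lemma load:
  "reach (G Orc) (2 * length x + 5) (Sp 0, (word_fun x, 0), blank)
    (emb ([code P], cinit P, \<lambda>_. [], (word_fun x, 0)))"
proof -
  \<comment> \<open>\<open>rest p\<close> and \<open>read p\<close> are the two tapes after
    \<open>p\<close> cells: the input is erased from the work tape, whose cell 0 holds the mark, and
    copied to the query tape.\<close>
  define rest where "rest p = (\<lambda>i. if i = 0 then Some mk else if i < p then None else word_fun x i)"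
    for p :: nat
  define read where "read p = (\<lambda>i. if i < p then word_fun x i else None)" for p :: nat
  \<comment> \<open>The first machine step moves the heads even on the empty word, so at least one
    cell is passed.\<close>
  define n where "n = max 1 (length x)"
  have 1: "G Orc (Sp 0, (word_fun x, 0), blank) = (Us Ld1, (rest 1, 1), (read 1, 1))"
    by (auto simp: gstep_def blank_def rest_def read_def fun_eq_iff)
  have 2: "reach (G Orc) k (Us Ld1, (rest p, p), (read p, p)) (Us Ld1, (rest n, n), (read n, n))"
    if "p + k = n" "p \<ge> 1" for p k
    using that
  proof (induction k arbitrary: p)
    case (Suc k)
    have p: "p < length x" using Suc.prems by (auto simp: n_def split: if_splits)
    have "G Orc (Us Ld1, (rest p, p), (read p, p)) =
        (Us Ld1, (rest (Suc p), Suc p), (read (Suc p), Suc p))"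
      using p Suc.prems(2)
      by (auto simp: gstep_Us rest_def read_def fun_eq_iff word_fun_def less_Suc_eq)
    then show ?case by (rule reach_step) (rule Suc.IH; use Suc.prems in simp)
  qed simp
  have e: "read n = word_fun x" "rest n = (\<lambda>i. if i = 0 then Some mk else None)"
    by (auto simp: n_def read_def rest_def word_fun_def fun_eq_iff)
  let ?m = "\<lambda>i :: nat. if i = 0 then Some mk else None"
  have n: "word_fun x n = None" "n > 0" by (auto simp: n_def word_fun_def)
  have 3: "G Orc (Us Ld1, (rest n, n), (read n, n)) = (Us Ld2, (?m, n - 1), (word_fun x, n - 1))"
    unfolding e using n by (auto simp: gstep_Us fun_eq_iff)
  have 4: "reach (G Orc) p (Us Ld2, (?m, p), (word_fun x, p)) (Us Ld2, (?m, 0), (word_fun x, 0))" for p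
  proof (induction p)
    case (Suc p)
    have "G Orc (Us Ld2, (?m, Suc p), (word_fun x, Suc p)) = (Us Ld2, (?m, p), (word_fun x, p))"
      by (auto simp: gstep_Us fun_eq_iff)
    then show ?case by (rule reach_step) (rule Suc.IH)
  qed simp
  have m: "?m = lay K mk (\<lambda>_. [])"
    by (rule lay_eqI) (use edge_neq_cell[of _ 0] in \<open>force simp: edge_def cell_def\<close>)+
  have 5: "G Orc (Us Ld2, (?m, 0), (word_fun x, 0)) =
      emb ([code P], cinit P, \<lambda>_. [], (word_fun x, 0))"
    unfolding emb_def prod.case m[symmetric] by (auto simp: gstep_Us fun_eq_iff)
  have "reach (G Orc) (Suc (n - 1 + Suc (n - 1 + Suc 0))) (Sp 0, (word_fun x, 0), blank)
      (emb ([code P], cinit P, \<lambda>_. [], (word_fun x, 0)))"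
    by (rule reach_step, rule 1, rule reach_trans, rule 2, use n in simp, simp,
        rule reach_step, rule 3, rule reach_trans, rule 4, rule reach_step, rule 5) simp
  then show ?thesis by (rule reach_mono) (auto simp: n_def)
qed

text \<open>The output starts in cell 1 because the blank cell 0 is what stops the rewinding of the
  query tape.\<close>

lemma emit:
  assumes "verd P c = Emit" "f 0 = None" "\<And>i. i < length w \<Longrightarrow> f (Suc i) = Some (w ! i)"
    "f (Suc (length w)) = None"
  shows "\<exists>g m y. reach (G Orc) (2 * length w + 3) (emb ([], c, s, (f, Suc (length w))))
    (Sp 1, (g, m), y) \<and> fcontent g = w"
proof -
  let ?l = "length w" and ?f = "lay K mk s"
  have 1: "G Orc (emb ([], c, s, (f, Suc ?l))) = (Us Out1, (?f, 0), (f, ?l))"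
    using assms(1) by (simp add: gstep_Us emb_def)
  have 2: "reach (G Orc) i (Us Out1, (?f, 0), (f, i)) (Us Out1, (?f, 0), (f, 0))" if "i \<le> ?l" for i
    using that
  proof (induction i)
    case (Suc i)
    have "G Orc (Us Out1, (?f, 0), (f, Suc i)) = (Us Out1, (?f, 0), (f, i))"
      using Suc.prems assms(3)[of i] by (simp add: gstep_Us fun_upd_idem)
    then show ?case by (rule reach_step) (use Suc in simp)
  qed simp
  have 3: "G Orc (Us Out1, (?f, 0), (f, 0)) = (Us Out2, (?f, 0), (f, 1))"
    using assms(2) by (simp add: gstep_Us fun_upd_idem)
  define g where "g n = (\<lambda>i. if i < n then Some (w ! i) else ?f i)" for n
  have 4: "reach (G Orc) k (Us Out2, (g i, i), (f, Suc i)) (Us Out2, (g ?l, ?l), (f, Suc ?l))"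
    if "i + k = ?l" for i k
    using that
  proof (induction k arbitrary: i)
    case (Suc k)
    have "G Orc (Us Out2, (g i, i), (f, Suc i)) = (Us Out2, (g (Suc i), Suc i), (f, Suc (Suc i)))"
      using Suc.prems assms(3)[of i]
      by (auto simp: gstep_Us fun_upd_idem g_def fun_eq_iff)
    then show ?case by (rule reach_step) (use Suc in simp)
  qed simp
  \<comment> \<open>The work cell behind the output is blanked, since remnants of the stacks could
    otherwise extend the content.\<close>
  have 5: "G Orc (Us Out2, (g ?l, ?l), (f, Suc ?l)) =
      (Sp 1, ((g ?l)(?l := None), ?l), (f, Suc ?l))"
    using assms(4) by (simp add: gstep_Us fun_upd_idem)
  have g0: "g 0 = ?f" by (simp add: g_def)
  have 6: "reach (G Orc) ?l (Us Out2, (?f, 0), (f, 1)) (Us Out2, (g ?l, ?l), (f, Suc ?l))"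
    using 4[of 0 ?l] g0 by simp
  have "reach (G Orc) (Suc (?l + Suc (?l + Suc 0))) (emb ([], c, s, (f, Suc ?l)))
      (Sp 1, ((g ?l)(?l := None), ?l), (f, Suc ?l))"
    by (rule reach_step, rule 1, rule reach_trans, rule 2, simp, rule reach_step, rule 3,
        rule reach_trans, rule 6, rule reach_step, rule 5) simp
  then have "reach (G Orc) (2 * ?l + 3) (emb ([], c, s, (f, Suc ?l)))
      (Sp 1, ((g ?l)(?l := None), ?l), (f, Suc ?l))"
    by (rule reach_mono) simp
  moreover have "fcontent ((g ?l)(?l := None)) = w"
    by (rule fcontentI) (auto simp: g_def)
  ultimately show ?thesis by blast
qed

lemma halt:
  assumes "verd P c = Halt b"
  shows "reach (G Orc) 1 (emb ([], c, s, y)) (Sp (if b then 1 else 2), (lay K mk s, 0), y)"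
proof -
  have "reach (G Orc) (Suc 0) (emb ([], c, s, y)) (Sp (if b then 1 else 2), (lay K mk s, 0), y)"
    by (rule reach_step[OF _ reach_refl]) (use assms in \<open>simp add: emb_def gstep_Us\<close>)
  then show ?thesis by simp
qed

text \<open>The machine is chosen before oracle and input. The bounds add loading, quadratic
  simulation and, for \<open>Emit\<close>, the copying of the output. The first clause serves
  decision programs, the second programs that compute a word.\<close>

lemma ex_tm_of_prg:
  "\<exists>M. wf_tm M \<and> deterministic M \<and>
    (\<forall>Orc x n c s y b T.
      (sstep P Orc ^^ n) ([code P], cinit P, \<lambda>_. [], (word_fun x, 0)) = ([], c, s, y) \<longrightarrow>
      verd P c = Halt b \<longrightarrow> 2 * length x + 5 + (2 * (K + 4) * (n * n) + 1) \<le> T \<longrightarrow>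
      runs_within Orc M x T \<and> (accepts Orc M x \<longleftrightarrow> b)) \<and>
    (\<forall>Orc x n c s f w T.
      (sstep P Orc ^^ n) ([code P], cinit P, \<lambda>_. [], (word_fun x, 0)) =
        ([], c, s, (f, Suc (length w))) \<longrightarrow>
      verd P c = Emit \<longrightarrow> f 0 = None \<longrightarrow> (\<forall>i<length w. f (Suc i) = Some (w ! i)) \<longrightarrow>
      f (Suc (length w)) = None \<longrightarrow>
      2 * length x + 5 + (2 * (K + 4) * (n * n) + (2 * length w + 3)) \<le> T \<longrightarrow>
      runs_within Orc M x T \<and> (\<exists>k c. (tm_step Orc M ^^ k) (init_config x) c \<and> halted c \<and>
        tape_content (work_tape c) = w))"
proof -
  obtain M enc where M: "wf_tm M" "deterministic M" and enc: "\<And>i. i < 6 \<Longrightarrow> enc (Sp i) = i"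
    and sim: "\<And>Orc x t. (dstep Orc M ^^ t) (finit x) =
      (case (G Orc ^^ t) (Sp 0, (word_fun x, 0), blank) of (s, w, y) \<Rightarrow> (enc s, w, y))"
  proof -
    have "\<exists>M enc. wf_tm M \<and> deterministic M \<and> (\<forall>i<6. enc (Sp i) = i) \<and>
      (\<forall>Orc x t. (dstep Orc M ^^ t) (finit x) =
        (case (G Orc ^^ t) (Sp 0, (word_fun x, 0), blank) of (s, w, y) \<Rightarrow> (enc s, w, y)))"
      by (rule ex_tm_of_gdelta[OF finite_pstates refl]) (rule pdelta_closed)
    then show ?thesis using that by blast
  qed
  have to_end: "runs_within Orc M x T \<and> (accepts Orc M x \<longleftrightarrow> i = 1) \<and>
      (\<exists>k c. (tm_step Orc M ^^ k) (init_config x) c \<and> halted c \<and>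
           tape_content (work_tape c) = fcontent f)"
    if r: "reach (G Orc) m (emb S) (Sp i, (f, p), y)" and i: "i = 1 \<or> i = 2"
      and S: "(sstep P Orc ^^ n) ([code P], cinit P, \<lambda>_. [], (word_fun x, 0)) = S"
      and T: "2 * length x + 5 + (2 * (K + 4) * (n * n) + m) \<le> T"
    for Orc x n m S i f p y T
  proof -
    have "reach (G Orc) T (Sp 0, (word_fun x, 0), blank) (Sp i, (f, p), y)"
      using reach_trans[OF load reach_trans[OF conjunct1[OF ssteps_sim[OF lsts_code]]]] r T
      unfolding S[symmetric] by (meson reach_mono)
    then obtain t where t: "t \<le> T" "(dstep Orc M ^^ t) (finit x) = (i, (f, p), y)"
      using enc i unfolding reach_def sim by (auto 0 3)
    then have h: "fhalted ((dstep Orc M ^^ t) (finit x))" using i by auto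
    have e: "(dstep Orc M ^^ T) (finit x) = (i, (f, p), y)"
      using dstep_halted_mono[OF h t(1)] t(2) by simp
    \<comment> \<open>Whichever of the times \<open>k\<close> and \<open>t\<close> is earlier, its
      halted configuration persists up to the other one.\<close>
    have "fst ((dstep Orc M ^^ k) (finit x)) = 1 \<Longrightarrow> i = 1" for k
      using dstep_halted_mono[OF h, where j = k] t(2)
        dstep_halted_mono[where i = k and C = "finit x" and j = t and Orc = Orc and M = M]
      by (cases "t \<le> k") auto
    then have "accepts Orc M x \<longleftrightarrow> i = 1"
      unfolding accepts_dstep[OF M] using e by (metis fst_conv)
    then show ?thesis
      using e i runs_within_dstep[OF M, where Orc = Orc and t = T and x = x] halts_with_content[OF M, where Orc = Orc and t = T and x = x] by auto
  qed
  show ?thesis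
  proof (intro exI[of _ M] conjI M allI impI)
    fix Orc x n c s y b T
    assume "(sstep P Orc ^^ n) ([code P], cinit P, \<lambda>_. [], (word_fun x, 0)) = ([], c, s, y)"
      "verd P c = Halt b" "2 * length x + 5 + (2 * (K + 4) * (n * n) + 1) \<le> T"
    from to_end[OF halt[OF this(2)] _ this(1,3)]
    show "runs_within Orc M x T" "accepts Orc M x \<longleftrightarrow> b" by (auto split: if_splits)
  next
    fix Orc x n c s f w T
    assume *: "(sstep P Orc ^^ n) ([code P], cinit P, \<lambda>_. [], (word_fun x, 0)) =
        ([], c, s, (f, Suc (length w)))"
      "verd P c = Emit" "f 0 = None"
      "\<forall>i<length w. f (Suc i) = Some (w ! i)" "f (Suc (length w)) = None"
      "2 * length x + 5 + (2 * (K + 4) * (n * n) + (2 * length w + 3)) \<le> T"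
    obtain g m z where g: "reach (G Orc) (2 * length w + 3)
        (emb ([], c, s, (f, Suc (length w)))) (Sp 1, (g, m), z)" "fcontent g = w"
      using emit[of c f w Orc s] * by blast
    from to_end[OF g(1) _ *(1) *(6)] g(2)
    show "runs_within Orc M x T" "\<exists>k c. (tm_step Orc M ^^ k) (init_config x) c \<and> halted c \<and>
        tape_content (work_tape c) = w" by auto
  qed
qed

end

section \<open>Execution of stack programs\<close>

text \<open>The number \<open>m\<close> of steps is the same for all programs, oracles and
  continuations: a command neither looks at the rest of the list nor asks the oracle, as queries
  happen only when the list is empty.\<close>

definition exec :: "('a, 'c) cmd \<Rightarrow> 'c \<times> (nat \<Rightarrow> 'a list) \<times> 'a ftape \<Rightarrow> nat \<Rightarrow>
    'c \<times> (nat \<Rightarrow> 'a list) \<times> 'a ftape \<Rightarrow> bool" where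
  "exec p S t S' \<longleftrightarrow> (\<exists>m\<le>t. \<forall>P Orc k. (sstep P Orc ^^ m) (p # k, S) = (k, S'))"

lemma exec_mono: "exec p S t S' \<Longrightarrow> t \<le> t' \<Longrightarrow> exec p S t' S'"
  unfolding exec_def by (elim exE conjE) (rule exI, rule conjI, erule (1) order_trans)

lemma exec_conv:
  "exec p S t S' \<Longrightarrow> S = R \<Longrightarrow> S' = R' \<Longrightarrow> t \<le> t' \<Longrightarrow> exec p R t' R'"
  using exec_mono by blast

lemma exec_reach: "exec p S t S' \<Longrightarrow> reach (sstep P Orc) t (p # k, S) (k, S')"
  unfolding exec_def reach_def by blast

lemma exec_1:
  assumes "\<And>P Orc k. sstep P Orc (p # k, S) = (k, S')"
  shows "exec p S 1 S'"
  unfolding exec_def by (rule exI[of _ 1]) (simp add: assms)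

lemma exec_then:
  assumes 1: "\<And>P Orc k. sstep P Orc (p # k, S) = (q # k, S)" and 2: "exec q S t S'"
  shows "exec p S (Suc t) S'"
proof -
  obtain m where "m \<le> t" "\<And>P Orc k. (sstep P Orc ^^ m) (q # k, S) = (k, S')"
    using 2 unfolding exec_def by blast
  then show ?thesis
    unfolding exec_def using 1 by (intro exI[of _ "Suc m"]) (simp add: funpow_swap1)
qed

lemma exec_then2:
  assumes 1: "\<And>P Orc k. sstep P Orc (p # k, S) = (q # r # k, S)"
    and 2: "exec q S t S'" and 3: "exec r S' t' S''"
  shows "exec p S (Suc (t + t')) S''"
proof -
  obtain m where m: "m \<le> t" "\<And>P Orc k. (sstep P Orc ^^ m) (q # k, S) = (k, S')"
    using 2 unfolding exec_def by blast
  obtain n where n: "n \<le> t'" "\<And>P Orc k. (sstep P Orc ^^ n) (r # k, S') = (k, S'')"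
    using 3 unfolding exec_def by blast
  have "(sstep P Orc ^^ (n + Suc m)) (p # k, S) = (k, S'')" for P Orc k
    unfolding funpow_add comp_apply funpow_Suc_right by (simp add: 1 m n)
  then show ?thesis
    unfolding exec_def using m(1) n(1) by (intro exI[of _ "n + Suc m"]) simp
qed

lemma exec_semi: "exec p S t S' \<Longrightarrow> exec q S' t' S'' \<Longrightarrow> exec (p ;; q) S (Suc (t + t')) S''"
  by (rule exec_then2) (cases S, simp)

lemma exec_cond:
  assumes "exec (if b (fst S) then p else q) S t S'"
  shows "exec (Cond b p q) S (Suc t) S'"
  by (rule exec_then[OF _ assms]) (cases S, simp)

lemma exec_cond_True: "b (fst S) \<Longrightarrow> exec p S t S' \<Longrightarrow> exec (Cond b p q) S (Suc t) S'"
  and exec_cond_False: "\<not> b (fst S) \<Longrightarrow> exec q S t S' \<Longrightarrow> exec (Cond b p q) S (Suc t) S'"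
  by (simp_all add: exec_cond)

lemma exec_loop_end: "\<not> b (fst S) \<Longrightarrow> exec (Loop b p) S 1 S"
  by (rule exec_1) (cases S, simp)

lemma exec_loop_step:
  "b (fst S) \<Longrightarrow> exec p S t S' \<Longrightarrow> exec (Loop b p) S' t' S'' \<Longrightarrow> exec (Loop b p) S (Suc (t + t')) S''"
  by (rule exec_then2) (cases S, simp)

subsection \<open>Loop-free code\<close>

text \<open>Symbolic execution for the simplifier. The clauses for \<open>Loop\<close> in
  \<open>ev\<close> and \<open>sz\<close> are placeholders guarded by \<open>loopfree\<close>;
  \<open>sz\<close> counts both branches of a condition and is thus only an upper bound for the
  running time.\<close>

primrec ev :: "('a, 'c) cmd \<Rightarrow> 'c \<times> (nat \<Rightarrow> 'a list) \<times> 'a ftape \<Rightarrow>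
    'c \<times> (nat \<Rightarrow> 'a list) \<times> 'a ftape" where
  "ev (Push j g) S = (case S of (c, s, y) \<Rightarrow> (c, s(j := g c # s j), y))"
| "ev (Pop j h) S = (case S of (c, s, y) \<Rightarrow> (h c (top (s j)), s(j := tl (s j)), y))"
| "ev (Aux f) S = (case S of (c, s, y) \<Rightarrow>
     (case f c (fread y) of (c', w, m) \<Rightarrow> (c', s, fwr w m y)))"
| "ev (p ;; q) S = ev q (ev p S)"
| "ev (Cond b p q) S = (if b (fst S) then ev p S else ev q S)"
| "ev (Loop b p) S = S"

primrec sz :: "('a, 'c) cmd \<Rightarrow> nat" where
  "sz (Push j g) = 1"
| "sz (Pop j h) = 1"
| "sz (Aux f) = 1"
| "sz (p ;; q) = Suc (sz p + sz q)"
| "sz (Cond b p q) = Suc (sz p + sz q)"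
| "sz (Loop b p) = 0"

primrec loopfree :: "('a, 'c) cmd \<Rightarrow> bool" where
  "loopfree (Push j g) = True"
| "loopfree (Pop j h) = True"
| "loopfree (Aux f) = True"
| "loopfree (p ;; q) = (loopfree p \<and> loopfree q)"
| "loopfree (Cond b p q) = (loopfree p \<and> loopfree q)"
| "loopfree (Loop b p) = False"

lemma exec_loopfree: "loopfree p \<Longrightarrow> exec p S (sz p) (ev p S)"
proof (induction p arbitrary: S)
  case (Semi p q)
  then show ?case using exec_semi[OF Semi.IH(1) Semi.IH(2)] by simp
next
  case (Cond b p q)
  have "exec (if b (fst S) then p else q) S (sz p + sz q) (ev (Cond b p q) S)"
    using exec_mono[OF Cond.IH(1), where t' = "sz p + sz q"] exec_mono[OF Cond.IH(2), where t' = "sz p + sz q"]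
      Cond.prems by simp
  then show ?case unfolding sz.simps by (rule exec_cond)
qed (auto intro!: exec_1[simplified] split: prod.splits)

lemma exec_ev: "loopfree p \<Longrightarrow> ev p S = S' \<Longrightarrow> sz p \<le> t \<Longrightarrow> exec p S t S'"
  using exec_loopfree exec_mono by blast

subsection \<open>Iterating over a stack\<close>

text \<open>The second component of the control state is the symbol popped or read last.\<close>

definition pop :: "nat \<Rightarrow> ('a, 'm \<times> 'a option) cmd" where
  "pop j = Pop j (\<lambda>(m, r) a. (m, a))"

definition has :: "'m \<times> 'a option \<Rightarrow> bool" where
  "has c \<longleftrightarrow> snd c \<noteq> None"

definition each :: "nat \<Rightarrow> ('a, 'm \<times> 'a option) cmd \<Rightarrow> ('a, 'm \<times> 'a option) cmd" where
  "each j p = pop j ;; Loop has (p ;; pop j)"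

definition push_reg :: "nat \<Rightarrow> ('a, 'm \<times> 'a option) cmd" where
  "push_reg j = Push j (\<lambda>(m, r). the r)"

definition push_const :: "nat \<Rightarrow> 'a \<Rightarrow> ('a, 'm \<times> 'a option) cmd" where
  "push_const j a = Push j (\<lambda>_. a)"

text \<open>Rewriting the symbol just read without moving makes \<open>Aux\<close> a pure change of
  the control.\<close>

definition set_mode :: "('m \<Rightarrow> 'a option \<Rightarrow> 'm) \<Rightarrow> ('a, 'm \<times> 'a option) cmd" where
  "set_mode f = Aux (\<lambda>(m, r) a. ((f m r, r), a, 0))"

definition aux_move :: "int \<Rightarrow> ('a, 'm \<times> 'a option) cmd" where
  "aux_move d = Aux (\<lambda>c a. (c, a, d))"

definition aux_write :: "('a option \<Rightarrow> 'a option) \<Rightarrow> ('a, 'm \<times> 'a option) cmd" where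
  "aux_write g = Aux (\<lambda>(m, r) a. ((m, r), g r, 1))"

definition aux_read :: "('a, 'm \<times> 'a option) cmd" where
  "aux_read = Aux (\<lambda>(m, r) a. ((m, a), a, 1))"

lemmas cmd_defs = pop_def push_reg_def push_const_def set_mode_def aux_move_def aux_write_def
  aux_read_def

lemma loopfree_cmds [simp]:
  "loopfree (pop j)" "loopfree (push_reg j)" "loopfree (push_const j a)" "loopfree (set_mode f)"
  "loopfree (aux_move d)" "loopfree (aux_write g)" "loopfree aux_read"
  by (simp_all add: cmd_defs)

lemma sz_cmds [simp]:
  "sz (pop j) = 1" "sz (push_reg j) = 1" "sz (push_const j a) = 1" "sz (set_mode f) = 1"
  "sz (aux_move d) = 1" "sz (aux_write g) = 1" "sz aux_read = 1"
  by (simp_all add: cmd_defs)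

lemma ev_cmds [simp]:
  "ev (pop j) ((m, r), s, y) = ((m, top (s j)), s(j := tl (s j)), y)"
  "ev (push_reg j) ((m, r), s, y) = ((m, r), s(j := the r # s j), y)"
  "ev (push_const j a) (c, s, y) = (c, s(j := a # s j), y)"
  "ev (set_mode f) ((m, r), s, y) = ((f m r, r), s, y)"
  "ev (aux_move d) (c, s, y) = (c, s, fwr (fread y) d y)"
  "ev (aux_write g) ((m, r), s, y) = ((m, r), s, fwr (g r) 1 y)"
  "ev aux_read ((m, r), s, y) = ((m, fread y), s, fwr (fread y) 1 y)"
  by (simp_all add: cmd_defs)

lemma wf_cmds [simp]:
  "wf_cmd K (M \<times> UNIV) (pop j) \<longleftrightarrow> j < K"
  "wf_cmd K (M \<times> UNIV) (push_reg j) \<longleftrightarrow> j < K"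
  "wf_cmd K (M \<times> UNIV) (push_const j a) \<longleftrightarrow> j < K"
  "wf_cmd K (M \<times> UNIV) (set_mode f) \<longleftrightarrow> (\<forall>m\<in>M. \<forall>r. f m r \<in> M)"
  "wf_cmd K (M \<times> UNIV) (aux_move d) \<longleftrightarrow> M = {} \<or> d \<in> {-1, 0, 1}"
  "wf_cmd K (M \<times> UNIV) (aux_write g)"
  "wf_cmd K (M \<times> UNIV) aux_read"
  "wf_cmd K (M \<times> UNIV) (each j p) \<longleftrightarrow> j < K \<and> wf_cmd K (M \<times> UNIV) p"
  by (auto simp: cmd_defs each_def)

lemma has_simps [simp]: "has (m, None) = False" "has (m, Some x) = True"
  by (simp_all add: has_def)

text \<open>\<open>A xs z\<close> and \<open>Y z\<close> describe stacks and query tape when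
  \<open>xs\<close> is still on stack \<open>j\<close> and \<open>z\<close> has been accumulated.
  The body may leave any symbol \<open>r\<close> in the register, because the next pop overwrites
  it.\<close>

lemma exec_each:
  assumes get: "\<And>xs z. A xs z j = xs"
    and upd: "\<And>x xs z. (A (x # xs) z)(j := xs) = A xs z"
    and body: "\<And>x xs z. \<exists>r. exec p ((m, Some x), A xs z, Y z) t ((m, r), A xs (g x z), Y (g x z))"
  shows "exec (each j p) ((m, r), A xs z, Y z) ((t + 3) * length xs + 3)
    ((m, None), A [] (fold g xs z), Y (fold g xs z))"
proof -
  have loop: "exec (Loop has (p ;; pop j)) ((m, top xs), A (tl xs) z, Y z) ((t + 3) * length xs + 1)
    ((m, None), A [] (fold g xs z), Y (fold g xs z))" for xs z
  proof (induction xs arbitrary: z)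
    case Nil
    then show ?case by (auto intro: exec_loop_end[simplified])
  next
    case (Cons x xs)
    obtain r where "exec p ((m, Some x), A xs z, Y z) t ((m, r), A xs (g x z), Y (g x z))"
      using body by blast
    moreover have "exec (pop j) ((m, r), A xs (g x z), Y (g x z)) 1
        ((m, top xs), A (tl xs) (g x z), Y (g x z))"
    proof (rule exec_ev)
      have "(A xs z)(j := tl xs) = A (tl xs) z" for z
        using upd[of "hd xs" "tl xs" z] get[of xs z] by (cases xs) (auto simp: fun_upd_idem)
      then show "ev (pop j) ((m, r), A xs (g x z), Y (g x z)) =
          ((m, top xs), A (tl xs) (g x z), Y (g x z))"
        by (simp add: get)
    qed simp_all
    ultimately have "exec (p ;; pop j) ((m, Some x), A xs z, Y z) (Suc (t + 1))
        ((m, top xs), A (tl xs) (g x z), Y (g x z))"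
      by (rule exec_semi)
    note * = exec_loop_step[where b = has, OF _ this Cons.IH]
    show ?case unfolding list.sel top_simps fold_Cons comp_apply
      by (rule exec_mono[OF *]) simp_all
  qed
  have "(A xs z)(j := tl xs) = A (tl xs) z"
    using upd[of "hd xs" "tl xs" z] get[of xs z] by (cases xs) (auto simp: fun_upd_idem)
  then have "exec (pop j) ((m, r), A xs z, Y z) 1 ((m, top xs), A (tl xs) z, Y z)"
    by (intro exec_ev) (simp_all add: get)
  from exec_semi[OF this loop] show ?thesis
    unfolding each_def by (rule exec_mono) simp
qed

section \<open>Polynomial bounds\<close>

lemma poly_bounded_mono: "poly_bounded g \<Longrightarrow> (\<And>n. f n \<le> g n) \<Longrightarrow> poly_bounded f"
  unfolding poly_bounded_def by (meson le_trans)

text \<open>The shape \<open>(n + k) ^ k\<close> is monotone in \<open>n\<close> and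
  \<open>k\<close>, multiplies by adding exponents, and its value is obtained by \<open>k\<close>
  unary multiplications, which the advice machine will carry out.\<close>

lemma poly_bounded_shift:
  assumes "poly_bounded f"
  shows "\<exists>k. \<forall>n. f n \<le> (n + k) ^ k"
proof -
  obtain k where k: "\<And>n. f n \<le> k * n ^ k + k" using assms by (auto simp: poly_bounded_def)
  have "f n \<le> (n + Suc k) ^ Suc k" for n
  proof (cases k)
    case 0
    then show ?thesis using k[of n] by simp
  next
    case (Suc i)
    have "n ^ Suc i + 1 \<le> n * (n + Suc k) ^ i + (n + Suc k) ^ i"
      by (intro add_mono) (auto intro: mult_le_mono2 power_mono)
    also have "\<dots> \<le> (n + Suc k) ^ Suc i" by (simp add: algebra_simps)
    finally have "n ^ k + 1 \<le> (n + Suc k) ^ k" by (simp add: Suc)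
    then have "k * (n ^ k + 1) \<le> (n + Suc k) * (n + Suc k) ^ k"
      by (intro mult_mono) auto
    then show ?thesis using k[of n] by (simp add: algebra_simps)
  qed
  then show ?thesis by blast
qed

lemma poly_bounded_shiftI:
  assumes "\<And>n. f n \<le> (n + k) ^ k"
  shows "poly_bounded f"
proof -
  \<comment> \<open>\<open>2 ^ k\<close> serves as the coefficient if \<open>n > k\<close>,
    \<open>(2 * k) ^ k\<close> as the constant if \<open>n\<close> is at most \<open>k\<close>, and
    the summand \<open>k\<close> makes the exponent large enough.\<close>
  define K where "K = (2 * k) ^ k + 2 ^ k + k"
  have "f n \<le> K * n ^ K + K" for n
  proof -
    have "(n + k) ^ k \<le> (2 * max n k) ^ k"
      by (intro power_mono) auto
    also have "\<dots> \<le> (2 * n) ^ k + (2 * k) ^ k"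
      by (cases "n \<le> k") (simp_all add: max_def)
    also have "\<dots> \<le> K * n ^ K + K"
    proof (cases n)
      case 0
      then show ?thesis by (cases k) (auto simp: K_def)
    next
      case (Suc m)
      have "n ^ k \<le> n ^ K" using Suc by (intro power_increasing) (auto simp: K_def)
      then have "2 ^ k * n ^ k \<le> K * n ^ K" by (intro mult_mono) (auto simp: K_def)
      then show ?thesis by (simp add: K_def power_mult_distrib)
    qed
    finally show ?thesis using assms[of n] by simp
  qed
  then show ?thesis by (auto simp: poly_bounded_def)
qed

lemma shift_mono: "k \<le> l \<Longrightarrow> (n + k) ^ k \<le> (n + l) ^ (l :: nat)" for n :: nat
proof (cases l)
  case (Suc i)
  assume "k \<le> l"
  then have "(n + k) ^ k \<le> (n + l) ^ k" by (intro power_mono) auto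
  also have "\<dots> \<le> (n + l) ^ l" using \<open>k \<le> l\<close> Suc by (intro power_increasing) auto
  finally show ?thesis .
qed simp

lemma poly_bounded_mult:
  assumes "poly_bounded f" "poly_bounded g"
  shows "poly_bounded (\<lambda>n. f n * g n)"
proof -
  obtain k l where "\<And>n. f n \<le> (n + k) ^ k" "\<And>n. g n \<le> (n + l) ^ l"
    using assms poly_bounded_shift by metis
  moreover have "(n + k) ^ k \<le> (n + (k + l)) ^ k" "(n + l) ^ l \<le> (n + (k + l)) ^ l" for n
    by (simp_all add: power_mono)
  ultimately have "f n * g n \<le> (n + (k + l)) ^ (k + l)" for n
    unfolding power_add by (intro mult_mono) (meson le_trans zero_le)+
  then show ?thesis by (rule poly_bounded_shiftI)
qed

lemma poly_bounded_add:
  assumes "poly_bounded f" "poly_bounded g"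
  shows "poly_bounded (\<lambda>n. f n + g n)"
proof -
  obtain k l where kl: "\<And>n. f n \<le> (n + k) ^ k" "\<And>n. g n \<le> (n + l) ^ l"
    using assms poly_bounded_shift by metis
  define m where "m = max k l"
  have "f n + g n \<le> (n + (m + 2)) ^ (m + 2)" for n
  proof -
    have "f n \<le> (n + m) ^ m" "g n \<le> (n + m) ^ m"
      using kl shift_mono[of k m n] shift_mono[of l m n] by (auto simp: m_def intro: le_trans)
    then have "f n + g n \<le> (n + (m + 2)) * (n + m) ^ m" by (simp add: algebra_simps)
    also have "\<dots> \<le> (n + (m + 2)) * (n + (m + 2)) ^ m" by (intro mult_le_mono2 power_mono) auto
    also have "\<dots> \<le> (n + (m + 2)) ^ (m + 2)" by (simp add: algebra_simps)
    finally show ?thesis .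
  qed
  then show ?thesis by (rule poly_bounded_shiftI)
qed

lemma poly_bounded_const [simp]: "poly_bounded (\<lambda>_. c)"
  unfolding poly_bounded_def by (rule exI[of _ c]) simp

lemma poly_bounded_id [simp]: "poly_bounded (\<lambda>n. n)"
  unfolding poly_bounded_def by (rule exI[of _ 1]) simp

lemma poly_bounded_power: "poly_bounded f \<Longrightarrow> poly_bounded (\<lambda>n. f n ^ k)"
  by (induction k) (auto intro: poly_bounded_mult)

lemmas poly_bounded_intros = poly_bounded_const poly_bounded_id poly_bounded_add
  poly_bounded_mult poly_bounded_power

section \<open>Computing the advice\<close>

abbreviation ones :: "nat \<Rightarrow> bool list" where
  "ones n \<equiv> replicate n True"

text \<open>Roles of the stacks in the search: \<open>N\<close> holds \<open>n + e\<close> in unary,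
  \<open>P\<close> the number of longer word lengths still to be searched, \<open>U\<close> the path
  from the root with its last letter on top, \<open>J\<close> the number of missing letters in
  unary, \<open>V\<close> is scratch space and \<open>Z\<close> collects the advice.\<close>

definition st6 :: "'a list \<Rightarrow> 'a list \<Rightarrow> 'a list \<Rightarrow> 'a list \<Rightarrow> 'a list \<Rightarrow> 'a list \<Rightarrow> nat \<Rightarrow> 'a list" where
  "st6 N P U J V Z = (\<lambda>_. [])(0 := N, 1 := P, 2 := U, 3 := J, 4 := V, 5 := Z)"

lemma st6_upd [simp]:
  "(st6 N P U J V Z)(0 := X) = st6 X P U J V Z"
  "(st6 N P U J V Z)(Suc 0 := X) = st6 N X U J V Z"
  "(st6 N P U J V Z)(2 := X) = st6 N P X J V Z"
  "(st6 N P U J V Z)(3 := X) = st6 N P U X V Z"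
  "(st6 N P U J V Z)(4 := X) = st6 N P U J X Z"
  "(st6 N P U J V Z)(5 := X) = st6 N P U J V X"
  by (auto simp: st6_def fun_eq_iff)

lemma st6_get [simp]:
  "st6 N P U J V Z 0 = N" "st6 N P U J V Z (Suc 0) = P" "st6 N P U J V Z 2 = U"
  "st6 N P U J V Z 3 = J" "st6 N P U J V Z 4 = V" "st6 N P U J V Z 5 = Z"
  by (auto simp: st6_def)

definition wtape :: "'a list \<Rightarrow> 'a ftape" where
  "wtape xs = (word_fun xs, length xs)"

lemma wtape_Nil: "wtape [] = blank"
  by (auto simp: wtape_def word_fun_def blank_def)

lemma fwr_wtape [simp]: "fwr (Some b) 1 (wtape xs) = wtape (xs @ [b])"
  by (auto simp: wtape_def word_fun_def fun_eq_iff nth_append less_Suc_eq)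

text \<open>Cell 0 stays blank as the stop for the rewinding in \<open>emit\<close>.\<close>

definition otape :: "'a list \<Rightarrow> 'a ftape" where
  "otape xs = ((\<lambda>p. case p of 0 \<Rightarrow> None | Suc i \<Rightarrow> word_fun xs i), Suc (length xs))"

lemma otape_Nil: "fwr None 1 blank = otape []"
  by (auto simp: otape_def word_fun_def blank_def fun_eq_iff split: nat.split)

lemma fwr_otape [simp]: "fwr (Some b) 1 (otape xs) = otape (xs @ [b])"
  by (auto simp: otape_def word_fun_def fun_eq_iff nth_append less_Suc_eq split: nat.split)

type_synonym tcmd = "(bool, nat \<times> bool option) cmd"

section \<open>Unary input and unary arithmetic\<close>

definition t_read :: tcmd where
  "t_read = Aux (\<lambda>(m, r) a. ((m, a), None, if a = None then 0 else 1))"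

text \<open>The query tape has no mark at its left end, so stack 4 counts how many moves lead back
  to cell 0, from where the queries will be written.\<close>

definition t_load :: tcmd where
  "t_load = (t_read ;; Loop has (push_const 0 True ;; push_const 4 True ;; t_read)) ;;
     each 4 (aux_move (-1))"

lemma t_load:
  "exec t_load ((m, r), st6 [] [] [] [] [] [], (word_fun (ones n), 0)) (10 * n + 7)
    ((m, None), st6 (ones n) [] [] [] [] [], blank)"
proof -
  define y where "y p = (\<lambda>i. if i < p then None else word_fun (ones n) i, p)" for p
  have rd: "exec t_read ((m, r), s, y p) 1 ((m, if p < n then Some True else None), s,
      y (if p < n then Suc p else p))" for p s r
    by (rule exec_ev) (auto simp: t_read_def y_def word_fun_def fun_eq_iff less_Suc_eq)
  have "exec (Loop has (push_const 0 True ;; push_const 4 True ;; t_read))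
      ((m, if p < n then Some True else None), st6 (ones p) [] [] [] (ones p) [],
        y (if p < n then Suc p else p)) (6 * k + 1)
      ((m, None), st6 (ones n) [] [] [] (ones n) [], y n)" if "p + k = n" for p k
    using that
  proof (induction k arbitrary: p)
    case 0
    then show ?case by (auto intro: exec_loop_end[simplified])
  next
    case (Suc k)
    have b: "exec (push_const 0 True ;; push_const 4 True ;; t_read)
        ((m, Some True), st6 (ones p) [] [] [] (ones p) [], y (Suc p)) 5
        ((m, if Suc p < n then Some True else None), st6 (ones (Suc p)) [] [] [] (ones (Suc p)) [],
          y (if Suc p < n then Suc (Suc p) else Suc p))"
    proof -
      have 1: "exec (push_const 0 True :: tcmd)
        ((m, Some True), st6 (ones p) [] [] [] (ones p) [], y (Suc p)) 1
        ((m, Some True), st6 (ones (Suc p)) [] [] [] (ones p) [], y (Suc p))"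
        by (rule exec_ev) simp_all
      have 2: "exec (push_const 4 True :: tcmd)
        ((m, Some True), st6 (ones (Suc p)) [] [] [] (ones p) [], y (Suc p)) 1
        ((m, Some True), st6 (ones (Suc p)) [] [] [] (ones (Suc p)) [], y (Suc p))"
        by (rule exec_ev) simp_all
      show ?thesis by (rule exec_mono[OF exec_semi[OF 1 exec_semi[OF 2 rd]]]) simp
    qed
    have h: "has (fst ((m, Some True), st6 (ones p) [] [] [] (ones p) [], y (Suc p)))" by simp
    have p: "p < n" using Suc.prems by simp
    from exec_loop_step[OF h b Suc.IH] Suc.prems show ?case
      unfolding if_P[OF p] by (auto elim!: exec_mono)
  qed
  note loop = this[of 0 n]
  have 1: "exec (t_read ;; Loop has (push_const 0 True ;; push_const 4 True ;; t_read))
      ((m, r), st6 [] [] [] [] [] [], y 0) (6 * n + 3)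
      ((m, None), st6 (ones n) [] [] [] (ones n) [], y n)"
    using exec_semi[OF rd[of r _ 0] loop] by (rule exec_conv) simp_all
  have "\<exists>r. exec (aux_move (-1) :: tcmd) ((m, Some x), st6 (ones n) [] [] [] xs [], (\<lambda>_. None, p)) 1
      ((m, r), st6 (ones n) [] [] [] xs [], (\<lambda>_. None, p - 1))" for x xs p
    by (rule exI, rule exec_ev) (auto simp: fun_eq_iff)
  from exec_each[where A = "\<lambda>xs z. st6 (ones n) [] [] [] xs []" and Y = "\<lambda>p. (\<lambda>_. None, p)"
      and j = 4 and g = "\<lambda>_ p. p - 1", OF _ _ this, of None "ones n" n]
  have 2: "exec (each 4 (aux_move (-1)) :: tcmd) ((m, None), st6 (ones n) [] [] [] (ones n) [], y n)
      (4 * n + 3) ((m, None), st6 (ones n) [] [] [] [] [], (\<lambda>_. None, fold (\<lambda>_ p. p - 1) (ones n) n))"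
    by (rule exec_conv) (auto simp: y_def word_fun_def fun_eq_iff)
  have "fold (\<lambda>_ p. p - 1) xs (q + length xs) = q" for xs :: "bool list" and q :: nat
    by (induction xs) auto
  from this[of "ones n" 0] have f: "fold (\<lambda>_ p. p - 1) (ones n) n = 0" by simp
  show ?thesis
    using exec_semi[OF 1 2] unfolding f t_load_def
    by (rule exec_conv) (simp_all add: y_def blank_def)
qed

primrec rep :: "nat \<Rightarrow> ('a, 'm \<times> 'a option) cmd \<Rightarrow> ('a, 'm \<times> 'a option) cmd" where
  "rep 0 p = set_mode (\<lambda>m r. m)"
| "rep (Suc n) p = p ;; rep n p"

text \<open>Multiplies stack 1 by stack 0. Reading a stack destroys it; therefore stack 0 is saved
  on stack 4 during every addition.\<close>

definition t_mult :: tcmd where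
  "t_mult = each 1 (each 0 (push_const 4 True ;; push_const 2 True) ;; each 4 (push_const 0 True)) ;;
     each 2 (push_const 1 True)"

lemma fold_tally: "fold (\<lambda>_ k. k + a) xs (b :: nat) = b + length xs * a"
  by (induction xs arbitrary: b) auto

lemma funpow_tally: "((\<lambda>k. k + a) ^^ n) (b :: nat) = b + n * a"
  by (induction n) auto

lemma t_mult:
  "exec t_mult ((m, r), st6 (ones a) (ones b) [] [] [] Z, y) (14 * a * b + 10 * b + 7)
    ((m, None), st6 (ones a) (ones (b * a)) [] [] [] Z, y)"
proof -
  have in1: "exec (each 0 (push_const 4 True ;; push_const 2 True))
      ((m, r), st6 (ones a) P (ones k) [] [] Z, y) (6 * a + 3)
      ((m, None), st6 [] P (ones (k + a)) [] (ones a) Z, y)" for P k r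
  proof -
    have b: "\<exists>r. exec (push_const 4 True ;; push_const 2 True)
        ((m, Some x), st6 xs P (ones (k + i)) [] (ones i) Z, y) 3
        ((m, r), st6 xs P (ones (k + (i + 1))) [] (ones (i + 1)) Z, y)" for x xs i
      by (rule exI, rule exec_ev) auto
    from exec_each[where A = "\<lambda>xs i. st6 xs P (ones (k + i)) [] (ones i) Z" and Y = "\<lambda>_. y",
        where j = 0, OF _ _ b, where r = r and xs = "ones a" and z = 0]
    show ?thesis by (simp add: fold_tally)
  qed
  have in2: "exec (each 4 (push_const 0 True))
      ((m, r), st6 [] P U [] (ones a) Z, y) (4 * a + 3)
      ((m, None), st6 (ones a) P U [] [] Z, y)" for P U r
  proof -
    have b: "\<exists>r. exec (push_const 0 True)
        ((m, Some x), st6 (ones i) P U [] xs Z, y) 1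
        ((m, r), st6 (ones (i + 1)) P U [] xs Z, y)" for x xs i
      by (rule exI, rule exec_ev) auto
    from exec_each[where A = "\<lambda>xs i. st6 (ones i) P U [] xs Z" and Y = "\<lambda>_. y",
        where j = 4, OF _ _ b, where r = r and xs = "ones a" and z = 0]
    show ?thesis by (simp add: fold_tally)
  qed
  have 1: "exec (each 1 (each 0 (push_const 4 True ;; push_const 2 True) ;; each 4 (push_const 0 True)))
      ((m, r), st6 (ones a) (ones b) [] [] [] Z, y) ((10 * a + 10) * b + 3)
      ((m, None), st6 (ones a) [] (ones (b * a)) [] [] Z, y)"
  proof -
    have b: "\<exists>r. exec (each 0 (push_const 4 True ;; push_const 2 True) ;; each 4 (push_const 0 True))
        ((m, Some x), st6 (ones a) xs (ones k) [] [] Z, y) (10 * a + 7)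
        ((m, r), st6 (ones a) xs (ones (k + a)) [] [] Z, y)" for x xs k
      by (rule exI, rule exec_mono[OF exec_semi[OF in1 in2]]) simp
    from exec_each[where A = "\<lambda>xs k. st6 (ones a) xs (ones k) [] [] Z" and Y = "\<lambda>_. y",
        where j = 1, OF _ _ b, where r = r and xs = "ones b" and z = 0]
    show ?thesis by (rule exec_conv) (simp_all add: fold_tally funpow_tally algebra_simps)
  qed
  have 2: "exec (each 2 (push_const 1 True))
      ((m, None), st6 (ones a) [] (ones (b * a)) [] [] Z, y) (4 * (b * a) + 3)
      ((m, None), st6 (ones a) (ones (b * a)) [] [] [] Z, y)"
  proof -
    have b: "\<exists>r. exec (push_const 1 True)
        ((m, Some x), st6 (ones a) (ones i) xs [] [] Z, y) 1
        ((m, r), st6 (ones a) (ones (i + 1)) xs [] [] Z, y)" for x xs i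
      by (rule exI, rule exec_ev) auto
    from exec_each[where A = "\<lambda>xs i. st6 (ones a) (ones i) xs [] [] Z" and Y = "\<lambda>_. y",
        where j = 2, OF _ _ b, where r = None and xs = "ones (b * a)" and z = 0]
    show ?thesis by (simp add: fold_tally)
  qed
  show ?thesis
    unfolding t_mult_def by (rule exec_mono[OF exec_semi[OF 1 2]]) (simp add: algebra_simps)
qed

text \<open>The factor \<open>(a + 1) ^ e\<close> dominates the growth of the tally during all
  remaining multiplications, which makes the induction go through with \<open>b * a\<close> in place
  of \<open>b\<close>.\<close>

lemma t_power:
  "exec (rep e t_mult) ((m, r), st6 (ones a) (ones b) [] [] [] Z, y)
    (e * (24 * (a + 1) ^ e * b * (a + 1) + 8) + 1)
    ((m, if e = 0 then r else None), st6 (ones a) (ones (b * a ^ e)) [] [] [] Z, y)"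
proof (induction e arbitrary: b r)
  case 0
  show ?case by (rule exec_ev) (auto simp: fun_eq_iff)
next
  case (Suc e)
  have 1: "exec t_mult ((m, r), st6 (ones a) (ones b) [] [] [] Z, y)
      (24 * (a + 1) ^ Suc e * b * (a + 1) + 7)
      ((m, None), st6 (ones a) (ones (b * a)) [] [] [] Z, y)"
  proof (rule exec_mono[OF t_mult])
    have "14 * a * b + 10 * b \<le> 24 * (b * (a + 1))" by (simp add: algebra_simps)
    also have "\<dots> = 24 * (b * (a + 1)) * 1" by simp
    also have "\<dots> \<le> 24 * (b * (a + 1)) * (a + 1) ^ Suc e"
      by (intro mult_le_mono2 one_le_power) simp
    finally show "14 * a * b + 10 * b + 7 \<le> 24 * (a + 1) ^ Suc e * b * (a + 1) + 7"
      by (simp only: ac_simps)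
  qed
  have 2: "exec (rep e t_mult) ((m, None), st6 (ones a) (ones (b * a)) [] [] [] Z, y)
      (e * (24 * (a + 1) ^ Suc e * b * (a + 1) + 8) + 1)
      ((m, None), st6 (ones a) (ones (b * a ^ Suc e)) [] [] [] Z, y)"
  proof (rule exec_mono)
    show "exec (rep e t_mult) ((m, None), st6 (ones a) (ones (b * a)) [] [] [] Z, y)
      (e * (24 * (a + 1) ^ e * (b * a) * (a + 1) + 8) + 1)
      ((m, None), st6 (ones a) (ones (b * a ^ Suc e)) [] [] [] Z, y)"
      using Suc.IH[of None "b * a"] by (simp add: ac_simps)
    have "(a + 1) ^ e * (b * a) * (a + 1) \<le> (a + 1) ^ e * (b * (a + 1)) * (a + 1)"
      by (intro mult_le_mono1 mult_le_mono2) simp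
    then show "e * (24 * (a + 1) ^ e * (b * a) * (a + 1) + 8) + 1 \<le>
        e * (24 * (a + 1) ^ Suc e * b * (a + 1) + 8) + 1"
      by (intro add_mono mult_le_mono2) (simp_all add: ac_simps)
  qed
  show ?case unfolding rep.simps by (rule exec_conv[OF exec_semi[OF 1 2]]) simp_all
qed

text \<open>The tally \<open>(n + e) ^ e\<close> is needed twice: on stack 1 to count the word
  lengths, on stack 5 as the padding of the advice.\<close>

definition t_init :: "nat \<Rightarrow> tcmd" where
  "t_init e = t_load ;; rep e (push_const 0 True) ;; push_const 1 True ;; rep e t_mult ;;
     each 1 (push_const 4 True ;; push_const 5 True) ;; each 4 (push_const 1 True)"

lemma exec_rep_push:
  "exec (rep e (push_const 0 True)) ((m, r), st6 (ones n) P U J V Z, y) (2 * e + 1)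
    ((m, r), st6 (ones (n + e)) P U J V Z, y)"
proof (induction e arbitrary: n)
  case 0
  show ?case by (rule exec_ev) (auto simp: fun_eq_iff)
next
  case (Suc e)
  have "exec (push_const 0 True) ((m, r), st6 (ones n) P U J V Z, y) 1
      ((m, r), st6 (ones (Suc n)) P U J V Z, y)"
    by (rule exec_ev) auto
  from exec_semi[OF this Suc.IH] show ?case unfolding rep.simps
    by (rule exec_conv) simp_all
qed

definition t_bound :: "nat \<Rightarrow> nat \<Rightarrow> nat" where
  "t_bound e n = (n + e) ^ e"

definition t_init_time :: "nat \<Rightarrow> nat \<Rightarrow> nat" where
  "t_init_time e n = 10 * n + 2 * e + e * (24 * (n + e + 1) ^ e * (n + e + 1) + 8) +
     10 * t_bound e n + 22"

lemma t_init:
  "\<exists>r'. exec (t_init e) ((m, r), st6 [] [] [] [] [] [], (word_fun (ones n), 0)) (t_init_time e n)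
    ((m, r'), st6 (ones (n + e)) (ones (t_bound e n)) [] [] [] (ones (t_bound e n)), blank)"
proof -
  let ?N = "ones (n + e)" and ?p = "t_bound e n"
  define X where "X = e * (24 * (n + e + 1) ^ e * (n + e + 1) + 8)"
  have 1: "exec (push_const 1 True) ((m, None), st6 ?N [] [] [] [] [], blank) 1
      ((m, None), st6 ?N (ones 1) [] [] [] [], blank)"
    by (rule exec_ev) auto
  have "exec (rep e t_mult) ((m, None), st6 ?N (ones 1) [] [] [] [], blank)
      (e * (24 * (n + e + 1) ^ e * 1 * (n + e + 1) + 8) + 1)
      ((m, None), st6 ?N (ones (1 * (n + e) ^ e)) [] [] [] [], blank)"
    using t_power[of e m None "n + e" 1 "[]" blank] by (rule exec_conv) simp_all
  then have 2: "exec (rep e t_mult) ((m, None), st6 ?N (ones 1) [] [] [] [], blank)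
      (X + 1) ((m, None), st6 ?N (ones ?p) [] [] [] [], blank)"
    by (rule exec_conv) (simp_all add: t_bound_def X_def)
  have b: "\<exists>r. exec (push_const 4 True ;; push_const 5 True)
      ((m, Some x), st6 ?N xs [] [] (ones i) (ones i), blank) 3
      ((m, r), st6 ?N xs [] [] (ones (i + 1)) (ones (i + 1)), blank)" for x xs i
    by (rule exI, rule exec_ev) auto
  have 3: "exec (each 1 (push_const 4 True ;; push_const 5 True))
      ((m, None), st6 ?N (ones ?p) [] [] [] [], blank) (6 * ?p + 3)
      ((m, None), st6 ?N [] [] [] (ones ?p) (ones ?p), blank)"
    using exec_each[where A = "\<lambda>xs i. st6 ?N xs [] [] (ones i) (ones i)" and Y = "\<lambda>_. blank",
        where j = 1, OF _ _ b, where r = None and xs = "ones ?p" and z = 0]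
    by (rule exec_conv) (simp_all add: fold_tally funpow_tally)
  have b: "\<exists>r. exec (push_const 1 True)
      ((m, Some x), st6 ?N (ones i) [] [] xs (ones ?p), blank) 1
      ((m, r), st6 ?N (ones (i + 1)) [] [] xs (ones ?p), blank)" for x xs i
    by (rule exI, rule exec_ev) auto
  have 4: "exec (each 4 (push_const 1 True))
      ((m, None), st6 ?N [] [] [] (ones ?p) (ones ?p), blank) (4 * ?p + 3)
      ((m, None), st6 ?N (ones ?p) [] [] [] (ones ?p), blank)"
    using exec_each[where A = "\<lambda>xs i. st6 ?N (ones i) [] [] xs (ones ?p)" and Y = "\<lambda>_. blank",
        where j = 4, OF _ _ b, where r = None and xs = "ones ?p" and z = 0]
    by (rule exec_conv) (simp_all add: fold_tally funpow_tally)
  show ?thesis unfolding t_init_def t_init_time_def X_def[symmetric]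
    using exec_semi[OF t_load[of m r n] exec_semi[OF exec_rep_push exec_semi[OF 1 exec_semi[OF 2
            exec_semi[OF 3 4]]]]]
    by (intro exI[of _ None]) (erule exec_mono, linarith)
qed

text \<open>The control modes are 0 (start), 1 and 2 (the oracle said yes or no), 3 (the next query is
  set up), 4 (the search is over) and 5 (the current subtree is done).\<close>

definition t_word :: tcmd where
  "t_word = push_const 5 False ;; each 2 (push_reg 4 ;; push_reg 5 ;; push_const 5 True) ;;
     each 4 (push_reg 2)"

definition t_next :: tcmd where
  "t_next = (pop 2 ;; Loop (\<lambda>(m, r). r = Some True) (push_const 3 True ;; pop 2)) ;;
     Cond has (push_const 2 True ;; set_mode (\<lambda>_ _. 3))
       (pop 1 ;; Cond has (push_const 3 True ;; set_mode (\<lambda>_ _. 3)) (set_mode (\<lambda>_ _. 4)))"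

text \<open>A node with answer yes is extended by \<open>False\<close> if letters are missing;
  otherwise it is a complete word and is recorded. In mode 5 \<open>t_next\<close> looks for the
  next node.\<close>

abbreviation t_branch :: tcmd where
  "t_branch \<equiv> Cond (\<lambda>(m, r). m = 1)
     (pop 3 ;; Cond has (push_const 2 False ;; set_mode (\<lambda>_ _. 3)) (t_word ;; set_mode (\<lambda>_ _. 5)))
     (set_mode (\<lambda>_ _. 5))"

definition t_answer :: tcmd where
  "t_answer = t_branch ;;
   Cond (\<lambda>(m, r). m = 5) t_next (set_mode (\<lambda>m _. m))"

definition t_query :: tcmd where
  "t_query = each 2 (push_reg 4) ;; each 4 (push_reg 2 ;; aux_write (\<lambda>r. r)) ;;
     aux_write (\<lambda>_. Some True) ;; each 3 (push_const 4 True) ;;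
     each 4 (push_const 3 True ;; aux_write (\<lambda>_. Some False))"

definition t_output :: tcmd where
  "t_output = aux_write (\<lambda>_. None) ;; each 5 (aux_write (\<lambda>r. r))"

definition t_finish :: tcmd where
  "t_finish = Cond (\<lambda>(m, r). m = 3) t_query t_output"

text \<open>Mode 0 starts the first round only. Later rounds start from the answer in mode 1 or 2
  and find the position of the search on the stacks.\<close>

definition t_prog :: "nat \<Rightarrow> (bool, nat \<times> bool option) prg" where
  "t_prog e = \<lparr>code = Cond (\<lambda>(m, r). m = 0) (t_init e ;; set_mode (\<lambda>_ _. 3)) t_answer ;; t_finish,
     cinit = (0, None), cyes = (1, None), cno = (2, None),
     verd = (\<lambda>(m, r). if m = 3 then Ask else Emit)\<rparr>"

text \<open>A \<open>True\<close> before each letter and a final \<open>False\<close> make the code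
  self-delimiting. A run of \<open>True\<close> alone decodes to letters without end, which is why
  the padding can follow the words.\<close>

definition enc_word :: "bool list \<Rightarrow> bool list" where
  "enc_word w = concat (map (\<lambda>b. [True, b]) w) @ [False]"

lemma t_word:
  "exec t_word ((m, r), st6 N P U J [] Z, y) (12 * length U + 9)
    ((m, None), st6 N P U J [] (enc_word (rev U) @ Z), y)"
proof -
  have 1: "exec (push_const 5 False) ((m, r), st6 N P U J [] Z, y) 1
      ((m, r), st6 N P U J [] (False # Z), y)"
    by (rule exec_ev) auto
  have b: "\<exists>r. exec (push_reg 4 ;; push_reg 5 ;; push_const 5 True)
      ((m, Some x), st6 N P xs J (fst z) (snd z), y) 5
      ((m, r), st6 N P xs J (fst (x # fst z, True # x # snd z)) (snd (x # fst z, True # x # snd z)), y)"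
    for x xs z
    by (rule exI, rule exec_ev) auto
  have f: "fold (\<lambda>x z. (x # fst z, True # x # snd z)) xs (v, z) =
      (rev xs @ v, concat (map (\<lambda>b. [True, b]) (rev xs)) @ z)" for xs and v z :: "bool list"
    by (induction xs arbitrary: v z) auto
  have 2: "exec (each 2 (push_reg 4 ;; push_reg 5 ;; push_const 5 True))
      ((m, r), st6 N P U J [] (False # Z), y) (8 * length U + 3)
      ((m, None), st6 N P [] J (rev U) (enc_word (rev U) @ Z), y)"
    using exec_each[where A = "\<lambda>xs z. st6 N P xs J (fst z) (snd z)" and Y = "\<lambda>_. y",
        where j = 2, OF _ _ b, where r = r and xs = U and z = "([], False # Z)"]
    by (rule exec_conv) (simp_all add: f enc_word_def)
  have b: "\<exists>r. exec (push_reg 2) ((m, Some x), st6 N P z J xs Z', y) 1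
      ((m, r), st6 N P (x # z) J xs Z', y)" for x xs z Z'
    by (rule exI, rule exec_ev) auto
  have 3: "exec (each 4 (push_reg 2)) ((m, None), st6 N P [] J (rev U) Z', y) (4 * length U + 3)
      ((m, None), st6 N P U J [] Z', y)" for Z'
    using exec_each[where A = "\<lambda>xs z. st6 N P z J xs Z'" and Y = "\<lambda>_. y",
        where j = 4, OF _ _ b, where r = None and xs = "rev U" and z = "[]"]
    by (rule exec_conv) (simp_all add: fold_Cons_rev)
  show ?thesis unfolding t_word_def
    using exec_semi[OF 1 exec_semi[OF 2 3]] by (rule exec_conv) simp_all
qed

text \<open>Backtracking: a \<open>True\<close> on top is a right child whose subtree is done and
  goes back to the missing letters, a \<open>False\<close> turns into its sibling, and the empty
  path leads on to the tree for the next word length.\<close>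

fun nxt :: "bool list \<Rightarrow> nat \<Rightarrow> nat \<Rightarrow> (bool list \<times> nat \<times> nat) option" where
  "nxt (True # U) j q = nxt U (Suc j) q"
| "nxt (False # U) j q = Some (True # U, j, q)"
| "nxt [] j 0 = None"
| "nxt [] j (Suc q) = Some ([], Suc j, q)"

lemma t_next:
  "\<exists>r' m' U' j' q'. exec t_next ((5, r), st6 N (ones q) U (ones j) [] Z, y) (4 * length U + 15)
    ((m', r'), st6 N (ones q') U' (ones j') [] Z, y) \<and>
    (case nxt U j q of None \<Rightarrow> m' = 4 | Some X \<Rightarrow> m' = 3 \<and> X = (U', j', q'))"
proof -
  let ?loop = "Loop (\<lambda>(m, r). r = Some True) (push_const 3 True ;; pop 2) :: tcmd"
  have "exec ?loop ((5, top U), st6 N (ones q) (tl U) (ones j) [] Z, y) (4 * length U + 1)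
      ((5, top (dropWhile (\<lambda>x. x) U)),
       st6 N (ones q) (tl (dropWhile (\<lambda>x. x) U)) (ones (j + length (takeWhile (\<lambda>x. x) U))) [] Z, y)" for j
  proof (induction U arbitrary: j)
    case Nil
    then show ?case by (auto intro: exec_loop_end[simplified])
  next
    case (Cons x U)
    show ?case
    proof (cases x)
      case True
      have b: "exec (push_const 3 True ;; pop 2)
         ((5, Some True), st6 N (ones q) U (ones j) [] Z, y) 3
         ((5, top U), st6 N (ones q) (tl U) (ones (Suc j)) [] Z, y)"
        by (rule exec_ev) auto
      have h: "case fst ((5 :: nat, Some True), st6 N (ones q) U (ones j) [] Z, y) of
          (m, r) \<Rightarrow> r = Some True" by simp
      show ?thesis using True
        by (intro exec_conv[OF exec_loop_step[OF h b Cons.IH]]) simp_all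
    next
      case False
      then show ?thesis by (intro exec_conv[OF exec_loop_end]) simp_all
    qed
  qed
  moreover have "exec (pop 2) ((5, r), st6 N (ones q) U (ones j) [] Z, y) 1
      ((5, top U), st6 N (ones q) (tl U) (ones j) [] Z, y)"
    by (rule exec_ev) auto
  ultimately have 1: "exec (pop 2 ;; ?loop) ((5, r), st6 N (ones q) U (ones j) [] Z, y)
      (4 * length U + 3) ((5, top (dropWhile (\<lambda>x. x) U)),
       st6 N (ones q) (tl (dropWhile (\<lambda>x. x) U)) (ones (j + length (takeWhile (\<lambda>x. x) U))) [] Z, y)"
    using exec_semi by (intro exec_conv[OF exec_semi]) auto
  \<comment> \<open>Closed form of \<open>nxt\<close> in terms of the block of leading
    \<open>True\<close>, which is what the loop removes.\<close>
  have nx: "nxt U j q = (case dropWhile (\<lambda>x. x) U of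
      [] \<Rightarrow> nxt [] (j + length (takeWhile (\<lambda>x. x) U)) q
    | x # V \<Rightarrow> Some (True # V, j + length (takeWhile (\<lambda>x. x) U), q))"
  proof (induction U arbitrary: j)
    case (Cons x U)
    show ?case using Cons[of "Suc j"] by (cases x; cases "dropWhile (\<lambda>x. x) U")
        (simp_all del: dropWhile_eq_Nil_conv)
  qed simp
  let ?t = "Cond has (push_const 2 True ;; set_mode (\<lambda>_ _. 3))
       (pop 1 ;; Cond has (push_const 3 True ;; set_mode (\<lambda>_ _. 3)) (set_mode (\<lambda>_ _. 4))) :: tcmd"
  let ?S = "((5, top (dropWhile (\<lambda>x. x) U)),
       st6 N (ones q) (tl (dropWhile (\<lambda>x. x) U)) (ones (j + length (takeWhile (\<lambda>x. x) U))) [] Z, y)"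
  have 2: "exec ?t ?S 11 (ev ?t ?S)" by (rule exec_ev) simp_all
  have 3: "\<exists>r' m' U' j' q'. ev ?t ?S = ((m', r'), st6 N (ones q') U' (ones j') [] Z, y) \<and>
    (case nxt U j q of None \<Rightarrow> m' = 4 | Some X \<Rightarrow> m' = 3 \<and> X = (U', j', q'))"
  proof (cases "dropWhile (\<lambda>x. x) U")
    case Nil
    show ?thesis
    proof (cases q)
      case 0
      have "nxt U j q = None" using nx Nil 0 by (simp del: dropWhile_eq_Nil_conv)
      then show ?thesis using Nil 0
        by - (rule exI[of _ None], rule exI[of _ 4], rule exI[of _ "[]"],
          rule exI[of _ "j + length (takeWhile (\<lambda>x. x) U)"], rule exI[of _ 0],
          simp del: dropWhile_eq_Nil_conv)
    next
      case (Suc q')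
      have "nxt U j q = Some ([], Suc (j + length (takeWhile (\<lambda>x. x) U)), q')"
        using nx Nil Suc by (simp del: dropWhile_eq_Nil_conv)
      then show ?thesis using Nil Suc
        by - (rule exI[of _ "Some True"], rule exI[of _ 3], rule exI[of _ "[]"],
          rule exI[of _ "Suc (j + length (takeWhile (\<lambda>x. x) U))"], rule exI[of _ q'],
          simp del: dropWhile_eq_Nil_conv)
    qed
  next
    case (Cons x V)
    then show ?thesis
      by - (rule exI[of _ "Some x"], rule exI[of _ 3], rule exI[of _ "True # V"],
        rule exI[of _ "j + length (takeWhile (\<lambda>x. x) U)"], rule exI[of _ q], simp add: nx)
  qed
  have "exec t_next ((5, r), st6 N (ones q) U (ones j) [] Z, y) (4 * length U + 15) (ev ?t ?S)"
    unfolding t_next_def using exec_semi[OF 1 2] by (rule exec_mono) simp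
  then show ?thesis using 3 by metis
qed

definition qword :: "bool list \<Rightarrow> nat \<Rightarrow> bool list" where
  "qword U j = rev U @ True # replicate j False"

text \<open>Moving the path to stack 4 reverses it; moving it back writes it in reading order and
  restores stack 2. The count on stack 3 is restored likewise.\<close>

lemma t_query:
  "exec t_query ((m, r), st6 N P U (ones j) [] Z, blank) (10 * length U + 10 * j + 20)
    ((m, None), st6 N P U (ones j) [] Z, wtape (qword U j))"
proof -
  have b: "\<exists>r. exec (push_reg 4) ((m, Some x), st6 N P xs J z Z, y) 1
      ((m, r), st6 N P xs J (x # z) Z, y)" for x xs z J y
    by (rule exI, rule exec_ev) auto
  have 1: "exec (each 2 (push_reg 4)) ((m, r), st6 N P U (ones j) [] Z, y) (4 * length U + 3)
      ((m, None), st6 N P [] (ones j) (rev U) Z, y)" for r y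
    using exec_each[where A = "\<lambda>xs z. st6 N P xs (ones j) z Z" and Y = "\<lambda>_. y",
        where j = 2, OF _ _ b, where r = r and xs = U and z = "[]"]
    by (rule exec_conv) (simp_all add: fold_Cons_rev)
  have b: "\<exists>r. exec (push_reg 2 ;; aux_write (\<lambda>r. r))
      ((m, Some x), st6 N P (fst z) J xs Z, wtape (snd z)) 3
      ((m, r), st6 N P (fst (x # fst z, snd z @ [x])) J xs Z, wtape (snd (x # fst z, snd z @ [x])))"
    for x xs z J
    by (rule exI, rule exec_ev) auto
  have f: "fold (\<lambda>x z. (x # fst z, snd z @ [x])) xs (v, z) = (rev xs @ v, z @ xs)"
    for xs and v z :: "bool list"
    by (induction xs arbitrary: v z) auto
  have 2: "exec (each 4 (push_reg 2 ;; aux_write (\<lambda>r. r)))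
      ((m, None), st6 N P [] (ones j) (rev U) Z, blank) (6 * length U + 3)
      ((m, None), st6 N P U (ones j) [] Z, wtape (rev U))"
    using exec_each[where A = "\<lambda>xs z. st6 N P (fst z) (ones j) xs Z" and Y = "\<lambda>z. wtape (snd z)",
        where j = 4, OF _ _ b, where r = None and xs = "rev U" and z = "([], [])"]
    by (rule exec_conv) (simp_all add: f wtape_Nil)
  have 3: "exec (aux_write (\<lambda>_. Some True)) ((m, None), s, wtape (rev U)) 1
      ((m, None), s, wtape (rev U @ [True]))" for s
    by (rule exec_ev) auto
  have b: "\<exists>r. exec (push_const 4 True) ((m, Some x), st6 N P U xs (ones z) Z, y) 1
      ((m, r), st6 N P U xs (ones (z + 1)) Z, y)" for x xs z y
    by (rule exI, rule exec_ev) auto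
  have 4: "exec (each 3 (push_const 4 True)) ((m, None), st6 N P U (ones j) [] Z, y) (4 * j + 3)
      ((m, None), st6 N P U [] (ones j) Z, y)" for y
    using exec_each[where A = "\<lambda>xs z. st6 N P U xs (ones z) Z" and Y = "\<lambda>_. y",
        where j = 3, OF _ _ b, where r = None and xs = "ones j" and z = 0]
    by (rule exec_conv) (simp_all add: fold_tally funpow_tally)
  have b: "\<exists>r. exec (push_const 3 True ;; aux_write (\<lambda>_. Some False))
      ((m, Some x), st6 N P U (ones z) xs Z, wtape (v @ replicate z False)) 3
      ((m, r), st6 N P U (ones (z + 1)) xs Z, wtape (v @ replicate (z + 1) False))" for x xs z v
    by (rule exI, rule exec_ev) (auto simp: replicate_append_same)
  have 5: "exec (each 4 (push_const 3 True ;; aux_write (\<lambda>_. Some False)))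
      ((m, None), st6 N P U [] (ones j) Z, wtape v) (6 * j + 3)
      ((m, None), st6 N P U (ones j) [] Z, wtape (v @ replicate j False))" for v
    using exec_each[where A = "\<lambda>xs z. st6 N P U (ones z) xs Z"
        and Y = "\<lambda>z. wtape (v @ replicate z False)",
        where j = 4, OF _ _ b, where r = None and xs = "ones j" and z = 0]
    by (rule exec_conv) (simp_all add: fold_tally funpow_tally)
  show ?thesis unfolding t_query_def
    using exec_semi[OF 1 exec_semi[OF 2 exec_semi[OF 3 exec_semi[OF 4 5]]], of r]
    by (rule exec_conv) (simp_all add: qword_def)
qed

lemma t_output:
  "exec t_output ((m, r), st6 N P U J V Z, blank) (4 * length Z + 5)
    ((m, None), st6 N P U J V [], otape Z)"
proof -
  have 1: "exec (aux_write (\<lambda>_. None)) ((m, r), st6 N P U J V Z, blank) 1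
      ((m, r), st6 N P U J V Z, otape [])"
    by (rule exec_ev) (auto simp: otape_Nil[simplified])
  have b: "\<exists>r. exec (aux_write (\<lambda>r. r)) ((m, Some x), st6 N P U J V xs, otape z) 1
      ((m, r), st6 N P U J V xs, otape (z @ [x]))" for x xs z
    by (rule exI, rule exec_ev) auto
  have f: "fold (\<lambda>x z. z @ [x]) xs z = z @ xs" for xs z :: "bool list"
    by (induction xs arbitrary: z) auto
  have 2: "exec (each 5 (aux_write (\<lambda>r. r))) ((m, r), st6 N P U J V Z, otape []) (4 * length Z + 3)
      ((m, None), st6 N P U J V [], otape Z)"
    using exec_each[where A = "\<lambda>xs z. st6 N P U J V xs" and Y = otape,
        where j = 5, OF _ _ b, where r = r and xs = Z and z = "[]"]
    by (rule exec_conv) (simp_all add: f)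
  show ?thesis unfolding t_output_def
    using exec_semi[OF 1 2] by (rule exec_conv) simp_all
qed

lemma nxt_length: "nxt U j q = Some (U', j', q') \<Longrightarrow> length U' + j' \<le> Suc (length U + j)"
  by (induction U j q rule: nxt.induct) auto

section \<open>Depth-first search guided by the oracle\<close>

context
  fixes e n :: nat and Orc :: "bool list set"
begin

abbreviation "tst q U j Z \<equiv> (st6 (ones (n + e)) (ones q) U (ones j) [] Z, blank :: bool ftape)"

abbreviation "t_reach \<equiv> reach (sstep (t_prog e) Orc)"

text \<open>Rounds are cut right after the oracle answer, when the query tape is blank and only mode
  and stacks carry information.\<close>

definition asked where
  "asked q U j Z = ([code (t_prog e)], (if qword U j \<in> Orc then 1 else 2, None), tst q U j Z)"

text \<open>The subtree below \<open>U\<close> is finished: within \<open>R\<close> steps the search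
  stands at the node chosen by \<open>nxt\<close>, or at the output if no node is left.\<close>

definition arrives where
  "arrives R S q U j Z \<longleftrightarrow> (case nxt U j q of
     Some (U', j', q') \<Rightarrow> t_reach R S (asked q' U' j' Z)
   | None \<Rightarrow> \<exists>r q' U' j'. t_reach R S ([t_finish], (4, r), tst q' U' j' Z))"

lemma arrives_trans: "t_reach R S S' \<Longrightarrow> arrives R' S' q U j Z \<Longrightarrow> arrives (R + R') S q U j Z"
  unfolding arrives_def by (cases "nxt U j q") (auto intro: reach_trans, meson reach_trans)

lemma arrives_mono: "arrives R S q U j Z \<Longrightarrow> R \<le> R' \<Longrightarrow> arrives R' S q U j Z"
  unfolding arrives_def by (cases "nxt U j q") (auto intro: reach_mono, meson reach_mono)

lemma ask_query:
  "t_reach (10 * length U + 10 * j + 30) ([t_finish], (3, r), tst q U j Z) (asked q U j Z)"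
proof -
  have "exec t_finish ((3, r), tst q U j Z) (Suc (10 * length U + 10 * j + 20))
      ((3, None), st6 (ones (n + e)) (ones q) U (ones j) [] Z, wtape (qword U j))"
    unfolding t_finish_def by (rule exec_cond) (simp add: t_query)
  note 1 = exec_reach[OF this, of "t_prog e" Orc "[]"]
  have 2: "sstep (t_prog e) Orc ([], (3, None), st6 (ones (n + e)) (ones q) U (ones j) [] Z,
      wtape (qword U j)) = asked q U j Z"
    by (simp add: t_prog_def asked_def wtape_def)
  have "t_reach (Suc 0) ([], (3, None), st6 (ones (n + e)) (ones q) U (ones j) [] Z,
      wtape (qword U j)) (asked q U j Z)"
    by (rule reach_step, rule 2) simp
  from reach_trans[OF 1 this] show ?thesis by (rule reach_mono) simp
qed

lemma answer_then:
  assumes "exec t_answer ((m, None), S) t ((m', r'), tst q' U' j' Z')" "m \<noteq> 0"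
  shows "t_reach (t + 2) ([code (t_prog e)], (m, None), S) ([t_finish], (m', r'), tst q' U' j' Z')"
proof -
  have "exec (Cond (\<lambda>(m, r). m = 0) (t_init e ;; set_mode (\<lambda>_ _. 3)) t_answer) ((m, None), S)
      (Suc t) ((m', r'), tst q' U' j' Z')"
    using assms by (intro exec_cond) simp
  note 1 = exec_reach[OF this, of "t_prog e" Orc "[t_finish]"]
  have "t_reach (Suc (Suc t)) ([code (t_prog e)], (m, None), S) ([t_finish], (m', r'), tst q' U' j' Z')"
    by (rule reach_step[OF _ 1]) (cases S, simp add: t_prog_def)
  then show ?thesis by simp
qed

lemma answer_next:
  assumes "exec t_answer ((m, None), S) t ((m', r'), tst q' U' j' Z)" "m \<noteq> 0"
    and "case nxt U j q of None \<Rightarrow> m' = 4 | Some X \<Rightarrow> m' = 3 \<and> X = (U', j', q')"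
  shows "arrives (t + 2 + (10 * (length U + j) + 40)) ([code (t_prog e)], (m, None), S) q U j Z"
proof (cases "nxt U j q")
  case None
  then have "m' = 4" using assms(3) by simp
  then have "t_reach (t + 2) ([code (t_prog e)], (m, None), S) ([t_finish], (4, r'), tst q' U' j' Z)"
    using answer_then[OF assms(1,2)] by simp
  then have "t_reach (t + 2 + (10 * (length U + j) + 40)) ([code (t_prog e)], (m, None), S)
      ([t_finish], (4, r'), tst q' U' j' Z)"
    by (rule reach_mono) simp
  then show ?thesis unfolding arrives_def None option.case by blast
next
  case (Some X)
  then have X: "nxt U j q = Some (U', j', q')" and "m' = 3" using assms(3) by auto
  then have "t_reach (t + 2) ([code (t_prog e)], (m, None), S) ([t_finish], (3, r'), tst q' U' j' Z)"
    using answer_then[OF assms(1,2)] by simp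
  from reach_trans[OF this ask_query]
  have "t_reach (t + 2 + (10 * (length U + j) + 40)) ([code (t_prog e)], (m, None), S)
      (asked q' U' j' Z)"
    by (rule reach_mono) (use nxt_length[OF X] in simp)
  then show ?thesis unfolding arrives_def X by simp
qed

lemma t_answer_next:
  assumes "exec t_branch ((m, None), S) t ((5, r), tst q U j Z)"
  shows "\<exists>r' m' U' j' q'. exec t_answer ((m, None), S) (t + 4 * length U + 17)
    ((m', r'), tst q' U' j' Z) \<and>
    (case nxt U j q of None \<Rightarrow> m' = 4 | Some X \<Rightarrow> m' = 3 \<and> X = (U', j', q'))"
proof -
  obtain r' m' U' j' q' where
    2: "exec t_next ((5, r), tst q U j Z) (4 * length U + 15) ((m', r'), tst q' U' j' Z)" and
    3: "case nxt U j q of None \<Rightarrow> m' = 4 | Some X \<Rightarrow> m' = 3 \<and> X = (U', j', q')"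
    using t_next by blast
  have "exec (Cond (\<lambda>(m, r). m = 5) t_next (set_mode (\<lambda>m _. m))) ((5, r), tst q U j Z)
      (Suc (4 * length U + 15)) ((m', r'), tst q' U' j' Z)"
    by (rule exec_cond) (simp add: 2)
  from exec_semi[OF assms this]
  have "exec t_answer ((m, None), S) (t + 4 * length U + 17) ((m', r'), tst q' U' j' Z)"
    unfolding t_answer_def by (rule exec_mono) simp
  then show ?thesis using 3 by blast
qed

text \<open>Per letter, 12 steps record a word, 4 backtrack and 10 write the next query.
  \<open>B\<close> bounds the path length plus the missing letters.\<close>

definition "t_round B = 26 * B + 100" for B :: nat

lemma round_no:
  assumes "qword U j \<notin> Orc" "length U + j \<le> B"
  shows "arrives (t_round B) (asked q U j Z) q U j Z"
proof -
  have "exec t_branch ((2, None), tst q U j Z) (Suc 1) ((5, None), tst q U j Z)"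
    by (rule exec_cond) (simp, rule exec_ev, simp_all)
  from t_answer_next[OF this] obtain r' m' U' j' q' where
    1: "exec t_answer ((2, None), tst q U j Z) (Suc 1 + 4 * length U + 17) ((m', r'), tst q' U' j' Z)"
    and 2: "case nxt U j q of None \<Rightarrow> m' = 4 | Some X \<Rightarrow> m' = 3 \<and> X = (U', j', q')" by blast
  from answer_next[OF 1 _ 2] have "arrives (Suc 1 + 4 * length U + 17 + 2 + (10 * (length U + j) + 40))
     (asked q U j Z) q U j Z"
    using assms(1) by (simp add: asked_def)
  moreover have "Suc 1 + 4 * length U + 17 + 2 + (10 * (length U + j) + 40) \<le> t_round B"
    using assms(2) by (simp add: t_round_def)
  ultimately show ?thesis by (rule arrives_mono)
qed

lemma round_leaf:
  assumes "qword U 0 \<in> Orc" "length U \<le> B"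
  shows "arrives (t_round B) (asked q U 0 Z) q U 0 (enc_word (rev U) @ Z)"
proof -
  have p: "exec (pop 3) ((1, None), tst q U 0 Z) 1 ((1, None), tst q U 0 Z)"
    by (rule exec_ev) simp_all
  have s: "exec (set_mode (\<lambda>_ _. 5)) ((1, None), S, y) 1 ((5, None), S, y)" for S and y :: "bool ftape"
    by (rule exec_ev) simp_all
  have c: "exec (Cond has (push_const 2 False ;; set_mode (\<lambda>_ _. 3)) (t_word ;; set_mode (\<lambda>_ _. 5)))
     ((1, None), tst q U 0 Z) (Suc (Suc (12 * length U + 9 + 1)))
     ((5, None), tst q U 0 (enc_word (rev U) @ Z))"
    by (rule exec_cond) (simp only: fst_conv has_simps if_False, rule exec_semi[OF t_word s])
  have "exec t_branch ((1, None), tst q U 0 Z) (12 * length U + 20)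
     ((5, None), tst q U 0 (enc_word (rev U) @ Z))"
    by (rule exec_mono, rule exec_cond) (simp only: fst_conv prod.case if_True refl,
        rule exec_semi[OF p c], simp)
  from t_answer_next[OF this] obtain r' m' U' j' q' where
    1: "exec t_answer ((1, None), tst q U 0 Z) (12 * length U + 20 + 4 * length U + 17)
      ((m', r'), tst q' U' j' (enc_word (rev U) @ Z))"
    and 2: "case nxt U 0 q of None \<Rightarrow> m' = 4 | Some X \<Rightarrow> m' = 3 \<and> X = (U', j', q')" by blast
  from answer_next[OF 1 _ 2] have "arrives (12 * length U + 20 + 4 * length U + 17 + 2 + (10 * (length U + 0) + 40))
     (asked q U 0 Z) q U 0 (enc_word (rev U) @ Z)"
    using assms(1) by (simp add: asked_def)
  moreover have "12 * length U + 20 + 4 * length U + 17 + 2 + (10 * (length U + 0) + 40) \<le> t_round B"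
    using assms(2) by (simp add: t_round_def)
  ultimately show ?thesis by (rule arrives_mono)
qed

lemma round_inner:
  assumes "qword U (Suc j) \<in> Orc" "length U + Suc j \<le> B"
  shows "t_reach (t_round B) (asked q U (Suc j) Z) (asked q (False # U) j Z)"
proof -
    have p: "exec (pop 3) ((1, None), tst q U (Suc j) Z) 1 ((1, Some True), tst q U j Z)"
    by (rule exec_ev) simp_all
  have c: "exec (Cond has (push_const 2 False ;; set_mode (\<lambda>_ _. 3)) (t_word ;; set_mode (\<lambda>_ _. 5)))
     ((1, Some True), tst q U j Z) (Suc 3) ((3, Some True), tst q (False # U) j Z)"
    by (rule exec_cond) (simp, rule exec_ev, simp_all)
  have a: "exec t_branch ((1, None), tst q U (Suc j) Z) 8 ((3, Some True), tst q (False # U) j Z)"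
    by (rule exec_mono, rule exec_cond) (simp only: fst_conv prod.case if_True refl,
        rule exec_semi[OF p c], simp)
  have b: "exec (Cond (\<lambda>(m, r). m = 5) t_next (set_mode (\<lambda>m _. m)))
      ((3, Some True), tst q (False # U) j Z) (Suc 1) ((3, Some True), tst q (False # U) j Z)"
    by (rule exec_cond) (simp, rule exec_ev, simp_all)
  have "exec t_answer ((1, None), tst q U (Suc j) Z) 11 ((3, Some True), tst q (False # U) j Z)"
    unfolding t_answer_def by (rule exec_mono[OF exec_semi[OF a b]]) simp
  from reach_trans[OF answer_then[OF this] ask_query] assms show ?thesis
    by (auto simp: asked_def t_round_def elim!: reach_mono)
qed

text \<open>Defined from the oracle answers alone; that the result consists of words of
  \<open>S\<close> is a property of the prefix language, shown in \<open>set_leaves\<close>.\<close>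

primrec leaves :: "nat \<Rightarrow> bool list \<Rightarrow> bool list list" where
  "leaves 0 U = (if qword U 0 \<in> Orc then [rev U] else [])"
| "leaves (Suc j) U =
    (if qword U (Suc j) \<in> Orc then leaves j (False # U) @ leaves j (True # U) else [])"

primrec visits :: "nat \<Rightarrow> bool list \<Rightarrow> nat" where
  "visits 0 U = 1"
| "visits (Suc j) U =
    (if qword U (Suc j) \<in> Orc then Suc (visits j (False # U) + visits j (True # U)) else 1)"

text \<open>The reversal reflects that each new word is put on top of the output stack.\<close>

definition add_words :: "bool list list \<Rightarrow> bool list \<Rightarrow> bool list" where
  "add_words ws Z = concat (map enc_word (rev ws)) @ Z"

lemma add_words_append: "add_words (vs @ ws) Z = add_words ws (add_words vs Z)"
  by (simp add: add_words_def)

text \<open>By the clauses of \<open>nxt\<close>, leaving the child \<open>False # U\<close> means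
  arriving at its sibling \<open>True # U\<close>, and leaving that one means leaving
  \<open>U\<close>. So the two inductive runs can be joined.\<close>

lemma explore:
  "length U + j \<le> B \<Longrightarrow>
    arrives (visits j U * t_round B) (asked q U j Z) q U j (add_words (leaves j U) Z)"
proof (induction j arbitrary: U Z)
  case 0
  then show ?case
    using round_no[of U 0 B q Z] round_leaf[of U B q Z] by (auto simp: add_words_def)
next
  case (Suc j)
  show ?case
  proof (cases "qword U (Suc j) \<in> Orc")
    case True
    let ?Z = "add_words (leaves j (False # U)) Z"
    have 1: "t_reach (t_round B) (asked q U (Suc j) Z) (asked q (False # U) j Z)"
      using round_inner True Suc.prems by blast
    have "arrives (visits j (False # U) * t_round B) (asked q (False # U) j Z) q (False # U) j ?Z"
      using Suc by simp
    then have 2: "t_reach (visits j (False # U) * t_round B) (asked q (False # U) j Z)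
        (asked q (True # U) j ?Z)"
      unfolding arrives_def by simp
    have "arrives (visits j (True # U) * t_round B) (asked q (True # U) j ?Z) q (True # U) j
        (add_words (leaves j (True # U)) ?Z)"
      using Suc by simp
    then have 3: "arrives (visits j (True # U) * t_round B) (asked q (True # U) j ?Z) q U (Suc j)
        (add_words (leaves j (True # U)) ?Z)"
      unfolding arrives_def by simp
    from arrives_trans[OF reach_trans[OF 1 2] 3] show ?thesis
      using True by (simp add: add_words_append algebra_simps)
  next
    case False
    then show ?thesis using round_no[OF _ Suc.prems] by (simp add: add_words_def)
  qed
qed

text \<open>The total word length is fixed within a tree, so every length up to the bound needs its
  own search from the empty path.\<close>

lemma search:
  "j + q \<le> B \<Longrightarrow> \<exists>r q' U' j'. t_reach ((\<Sum>i = j..j + q. visits i []) * t_round B) (asked q [] j Z)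
    ([t_finish], (4, r), tst q' U' j' (add_words (concat (map (\<lambda>i. leaves i []) [j..<Suc (j + q)])) Z))"
proof (induction q arbitrary: j Z)
  case 0
  then show ?case using explore[of "[]" j B 0 Z] by (simp add: arrives_def)
next
  case (Suc q)
  have "arrives (visits j [] * t_round B) (asked (Suc q) [] j Z) (Suc q) [] j (add_words (leaves j []) Z)"
    using explore[of "[]" j B "Suc q" Z] Suc.prems by simp
  then have 1: "t_reach (visits j [] * t_round B) (asked (Suc q) [] j Z)
      (asked q [] (Suc j) (add_words (leaves j []) Z))"
    by (simp add: arrives_def)
  obtain r q' U' j' where 2: "t_reach ((\<Sum>i = Suc j..Suc j + q. visits i []) * t_round B)
    (asked q [] (Suc j) (add_words (leaves j []) Z))
    ([t_finish], (4, r), tst q' U' j' (add_words (concat (map (\<lambda>i. leaves i []) [Suc j..<Suc (Suc j + q)]))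
      (add_words (leaves j []) Z)))"
    using Suc.IH[of "Suc j" "add_words (leaves j []) Z"] Suc.prems by auto
  have s: "(\<Sum>i = j..j + Suc q. visits i []) = visits j [] + (\<Sum>i = Suc j..Suc j + q. visits i [])"
    by (subst sum.atLeast_Suc_atMost) simp_all
  have l: "[j..<Suc (j + Suc q)] = j # [Suc j..<Suc (Suc j + q)]"
    by (subst upt_conv_Cons) simp_all
  show ?case
    using reach_trans[OF 1 2] unfolding s l distrib_right list.map concat.simps add_words_append
    by blast
qed

definition advice :: "bool list" where
  "advice = add_words (concat (map (\<lambda>i. leaves i []) [0..<Suc (t_bound e n)])) (ones (t_bound e n))"

definition t_steps :: nat where
  "t_steps = t_init_time e n + 40 + (\<Sum>i\<le>t_bound e n. visits i []) * t_round (t_bound e n) +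
     4 * length advice + 10"

lemma t_prog_run:
  "\<exists>s. (sstep (t_prog e) Orc ^^ t_steps)
      ([code (t_prog e)], cinit (t_prog e), \<lambda>_. [], (word_fun (ones n), 0)) =
    ([], (4, None), s, otape advice)"
proof -
  let ?p = "t_bound e n"
  obtain r where i: "exec (t_init e) ((0, None), st6 [] [] [] [] [] [], (word_fun (ones n), 0))
      (t_init_time e n) ((0, r), tst ?p [] 0 (ones ?p))"
    using t_init[of e 0 None n] by auto
  have m: "exec (set_mode (\<lambda>_ _. 3)) ((0, r), tst ?p [] 0 (ones ?p)) 1 ((3, r), tst ?p [] 0 (ones ?p))"
    by (rule exec_ev) simp_all
  have "exec (Cond (\<lambda>(m, r). m = 0) (t_init e ;; set_mode (\<lambda>_ _. 3)) t_answer)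
      ((0, None), st6 [] [] [] [] [] [], (word_fun (ones n), 0)) (Suc (Suc (t_init_time e n + 1)))
      ((3, r), tst ?p [] 0 (ones ?p))"
    by (rule exec_cond) (simp only: fst_conv prod.case if_True refl, rule exec_semi[OF i m])
  note 1 = exec_reach[OF this, of "t_prog e" Orc "[t_finish]"]
  have e: "st6 [] [] [] [] [] [] = (\<lambda>_. [])"
    by (auto simp: st6_def)
  have 0: "sstep (t_prog e) Orc ([code (t_prog e)], cinit (t_prog e), \<lambda>_. [], (word_fun (ones n), 0)) =
     ([Cond (\<lambda>(m, r). m = 0) (t_init e ;; set_mode (\<lambda>_ _. 3)) t_answer, t_finish],
      (0, None), st6 [] [] [] [] [] [], (word_fun (ones n), 0))"
    by (simp add: t_prog_def e)
  have 2: "t_reach 30 ([t_finish], (3, r), tst ?p [] 0 (ones ?p)) (asked ?p [] 0 (ones ?p))"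
    using ask_query[of "[]" 0] by simp
  obtain r q' U' j' where 3: "t_reach ((\<Sum>i\<le>?p. visits i []) * t_round ?p) (asked ?p [] 0 (ones ?p))
    ([t_finish], (4, r), tst q' U' j' advice)"
    using search[of 0 ?p ?p "ones ?p"] by (auto simp: advice_def atLeast0AtMost)
  have "exec t_finish ((4, r), tst q' U' j' advice) (Suc (4 * length advice + 5))
    ((4, None), st6 (ones (n + e)) (ones q') U' (ones j') [] [], otape advice)"
    unfolding t_finish_def by (rule exec_cond) (simp add: t_output)
  note 4 = exec_reach[OF this, of "t_prog e" Orc "[]"]
  define s where "s = st6 (ones (n + e)) (ones q') U' (ones j') [] []"
  from reach_step[OF 0 reach_trans[OF 1 reach_trans[OF 2 reach_trans[OF 3 4]]]]
  have "t_reach t_steps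
      ([code (t_prog e)], cinit (t_prog e), \<lambda>_. [], (word_fun (ones n), 0))
      ([], (4, None), s, otape advice)"
    unfolding s_def by (rule reach_mono) (simp add: t_steps_def)
  then obtain k where k: "k \<le> t_steps" "(sstep (t_prog e) Orc ^^ k)
      ([code (t_prog e)], cinit (t_prog e), \<lambda>_. [], (word_fun (ones n), 0)) =
      ([], (4, None), s, otape advice)"
    by (auto simp: reach_def)
  \<comment> \<open>The final configuration has verdict \<open>Emit\<close> and is a fixed point, so
    the upper bound \<open>t_steps\<close> becomes an exact number of steps.\<close>
  have "(sstep (t_prog e) Orc ^^ i) ([], (4, None), s, otape advice) =
      ([], (4, None), s, otape advice)" for i
    by (induction i) (simp_all add: t_prog_def)
  moreover have "t_steps = (t_steps - k) + k" using k(1) by simp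
  ultimately show ?thesis by (metis funpow_add comp_apply k(2))
qed

end

section \<open>Simulating an oracle machine by table lookup\<close>

subsection \<open>A tape as a pair of stacks\<close>

definition cells :: "'a option list \<Rightarrow> nat \<Rightarrow> 'a option" where
  "cells xs p = (if p < length xs then xs ! p else None)"

text \<open>\<open>L\<close> has the cell next to the head on top, \<open>R\<close> starts with the
  cell under the head. Blank cells already visited are entries \<open>None\<close>; an exhausted
  \<open>R\<close> stands for the blank rest of the tape, and \<open>cell_of\<close> identifies the
  two.\<close>

definition tp :: "'a option list \<Rightarrow> 'a option list \<Rightarrow> 'a ftape" where
  "tp L R = (cells (rev L @ R), length L)"

definition cell_of :: "'a option option \<Rightarrow> 'a option" where
  "cell_of r = (case r of None \<Rightarrow> None | Some s \<Rightarrow> s)"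

lemma cell_of_simps [simp]: "cell_of None = None" "cell_of (Some s) = s"
  by (simp_all add: cell_of_def)

lemma fread_tp: "fread (tp L R) = cell_of (top R)"
  by (cases R) (auto simp: tp_def cells_def nth_append)

lemma tp_blank: "tp [] [] = blank"
  by (auto simp: tp_def cells_def blank_def)

lemma tp_word: "tp [] (map Some x) = (word_fun x, 0)"
  by (auto simp: tp_def cells_def word_fun_def)

lemma fst_tp: "fst (tp L R) = cells (rev L @ R)"
  by (simp add: tp_def)

fun put :: "'a option \<Rightarrow> int \<Rightarrow> 'a option list \<Rightarrow> 'a option list \<Rightarrow>
    'a option list \<times> 'a option list" where
  "put w m L R = (if m = 1 then (w # L, R) else if m = -1 then
     (case L of [] \<Rightarrow> ([], w # R) | s # L' \<Rightarrow> (L', s # w # R)) else (L, w # R))"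

lemma cells_update: "cells (rev L @ w # tl R) = (cells (rev L @ R))(length L := w)"
  by (cases R) (auto simp: cells_def fun_eq_iff nth_append nth_Cons')

text \<open>\<open>tl R\<close> appears because the symbol under the head has been popped before. A
  left move with empty \<open>L\<close> keeps the head at cell 0, as the truncation by
  \<open>nat\<close> does in \<open>fwr\<close>.\<close>

lemma tp_put:
  assumes "m \<in> {-1, 0, 1}" "put w m L (tl R) = (L', R')"
  shows "tp L' R' = fwr w m (tp L R)"
  using assms cells_update[of L w R]
  by (auto simp: tp_def fwr_def split: if_splits list.splits)

lemma put_length: "put w m L R = (L', R') \<Longrightarrow> length L' + length R' = Suc (length L + length R)"
  by (auto split: if_splits list.splits)

subsection \<open>The program\<close>

text \<open>Stacks 0 and 1 are the two halves of the simulated work tape, 2 and 3 those of the query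
  tape, and 4 is the clock.\<close>

definition st5 :: "'a list \<Rightarrow> 'a list \<Rightarrow> 'a list \<Rightarrow> 'a list \<Rightarrow> 'a list \<Rightarrow> nat \<Rightarrow> 'a list" where
  "st5 A B C D E = (\<lambda>_. [])(0 := A, 1 := B, 2 := C, 3 := D, 4 := E)"

lemma st5_upd [simp]:
  "(st5 A B C D E)(0 := X) = st5 X B C D E"
  "(st5 A B C D E)(Suc 0 := X) = st5 A X C D E"
  "(st5 A B C D E)(2 := X) = st5 A B X D E"
  "(st5 A B C D E)(3 := X) = st5 A B C X E"
  "(st5 A B C D E)(4 := X) = st5 A B C D X"
  by (auto simp: st5_def fun_eq_iff)

lemma st5_get [simp]:
  "st5 A B C D E 0 = A" "st5 A B C D E (Suc 0) = B" "st5 A B C D E 2 = C"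
  "st5 A B C D E 3 = D" "st5 A B C D E 4 = E"
  by (auto simp: st5_def)

text \<open>State of \<open>M\<close>, the symbols read on its two tapes, and the flag of the table
  scan.\<close>

type_synonym dmode = "nat \<times> bool option \<times> bool option \<times> nat"
type_synonym dcmd = "(bool option, dmode \<times> bool option option) cmd"

abbreviation skip :: dcmd where
  "skip \<equiv> set_mode (\<lambda>m _. m)"

definition set_flag :: "nat \<Rightarrow> dcmd" where
  "set_flag k = set_mode (\<lambda>(q, a, b, f) _. (q, a, b, k))"

definition d_put :: "nat \<Rightarrow> nat \<Rightarrow> (dmode \<Rightarrow> bool option) \<Rightarrow> (dmode \<Rightarrow> int) \<Rightarrow> dcmd" where
  "d_put i j w d = Cond (\<lambda>(m, r). d m = 1) (Push i (\<lambda>(m, r). w m))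
     (Push j (\<lambda>(m, r). w m) ;;
      Cond (\<lambda>(m, r). d m = -1) (pop i ;; Cond has (push_reg j) skip) skip)"

lemma loopfree_d_put [simp]: "loopfree (d_put i j w d)"
  by (simp add: d_put_def)

lemma sz_d_put [simp]: "sz (d_put i j w d) = 11"
  by (simp add: d_put_def)

lemma ev_d_put_01:
  assumes "put (w m) (d m) L R = (L', R')"
  shows "\<exists>r'. ev (d_put 0 1 w d) ((m, r), st5 L R L2 R2 E, y) = ((m, r'), st5 L' R' L2 R2 E, y)"
  using assms by (cases L) (auto simp: d_put_def)

lemma ev_d_put_23:
  assumes "put (w m) (d m) L R = (L', R')"
  shows "\<exists>r'. ev (d_put 2 3 w d) ((m, r), st5 L1 R1 L R E, y) = ((m, r'), st5 L1 R1 L' R' E, y)"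
  using assms by (cases L) (auto simp: d_put_def)

text \<open>Scanning the table: flags 0 and 1 expect a token (\<open>True\<close> announces a letter, \<open>False\<close> ends
  the word), flags 2 and 3 a letter; the word agrees with the query so far for 0 and 2. Flag 4 means
  found, flag 5 means that the table is exhausted.\<close>

definition d_back :: dcmd where
  "d_back = each 2 (push_reg 3)"

definition d_stop :: dcmd where
  "d_stop = Cond (\<lambda>((q, a, b, f), r). f = 0)
     (pop 3 ;; Cond (\<lambda>(m, r). cell_of r = None) (set_flag 4) (push_reg 3 ;; d_back))
     (d_back ;; set_flag 0)"

definition d_token :: dcmd where
  "d_token = Cond (\<lambda>(m, r). r = Some (Some True))
     (set_mode (\<lambda>(q, a, b, f) _. (q, a, b, if f = 0 then 2 else 3))) d_stop"

text \<open>The table letter is parked in the component \<open>a\<close>, since popping the query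
  letter overwrites the register.\<close>

definition d_letter :: dcmd where
  "d_letter = Cond (\<lambda>((q, a, b, f), r). f = 3) (set_flag 1)
     (set_mode (\<lambda>(q, a, b, f) r. (q, the r, b, f)) ;; pop 3 ;;
      Cond has (push_reg 2 ;; set_mode (\<lambda>(q, a, b, f) r. (q, a, b, if r = Some a then 0 else 1)))
        (set_flag 1))"

definition d_scan_body :: dcmd where
  "d_scan_body = aux_read ;; Cond (\<lambda>(m, r). r = None) (set_flag 5)
     (Cond (\<lambda>((q, a, b, f), r). f < 2) d_token d_letter)"

abbreviation d_scan :: dcmd where
  "d_scan \<equiv> Loop (\<lambda>((q, a, b, f), r). f < 4) d_scan_body"

text \<open>The head stays put only on the separator \<open>Some None\<close>; \<open>None\<close>
  is a blank cell behind the input and is left like a letter.\<close>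

definition d_left :: dcmd where
  "d_left = Aux (\<lambda>(m, r) a. ((m, a), a, if a = Some None then 0 else -1))"

abbreviation d_seek :: dcmd where
  "d_seek \<equiv> Loop (\<lambda>(m, r). r \<noteq> Some None) d_left"

definition d_lookup :: dcmd where
  "d_lookup = d_back ;; (d_left ;; d_seek) ;; aux_move 1 ;;
     set_flag 0 ;; d_scan ;; each 2 skip ;; each 3 skip ;;
     set_mode (\<lambda>(q, a, b, f) _. (if f = 4 then 4 else 5, a, b, 0))"

lemma d_back:
  "exec d_back ((m, r), st5 L1 R1 L R E, y) (4 * length L + 3)
    ((m, None), st5 L1 R1 [] (rev L @ R) E, y)"
proof -
  have b: "\<exists>r. exec (push_reg 3) ((m, Some x), st5 L1 R1 xs z E, y) 1
      ((m, r), st5 L1 R1 xs (x # z) E, y)" for x xs z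
    by (rule exI, rule exec_ev) auto
  show ?thesis unfolding d_back_def
    using exec_each[where A = "\<lambda>xs z. st5 L1 R1 xs z E" and Y = "\<lambda>_. y",
        where j = 2, OF _ _ b, where r = r and xs = L and z = R]
    by (rule exec_conv) (simp_all add: fold_Cons_rev)
qed

fun scan_step :: "bool option \<Rightarrow> nat \<times> bool option list \<times> bool option list \<Rightarrow>
    nat \<times> bool option list \<times> bool option list" where
  "scan_step s (f, L, R) =
    (if f < 2 then
       if s = Some True then (if f = 0 then 2 else 3, L, R)
       else if f = 0 then (if cell_of (top R) = None then (4, L, tl R) else (0, [], rev L @ R))
       else (0, [], rev L @ R)
     else if f = 3 then (1, L, R)
     else (case R of [] \<Rightarrow> (1, L, []) | a # R' \<Rightarrow> (if a = s then 0 else 1, a # L, R')))"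

lemma scan_step_length:
  "scan_step s (f, L, R) = (f', L', R') \<Longrightarrow> length L' + length R' \<le> length L + length R"
  by (auto split: if_splits list.splits)

lemma set_flag:
  "exec (set_flag k) (((q, a, b, f), r), S, y) 1 (((q, a, b, k), r), S, y)"
  by (rule exec_ev) (simp_all add: set_flag_def)

lemma d_stop:
  assumes f: "f < 2" and st: "s \<noteq> Some True" "scan_step s (f, L, R) = (f', L', R')"
  shows "\<exists>r'. exec d_stop (((q, a, b, f), r), st5 L1 R1 L R E, y) (4 * length L + 10)
    (((q, a, b, f'), r'), st5 L1 R1 L' R' E, y)"
proof (cases "f = 0")
  case f0: True
  have p: "exec (pop 3) (((q, a, b, f), r), st5 L1 R1 L R E, y) 1
      (((q, a, b, f), top R), st5 L1 R1 L (tl R) E, y)"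
    by (rule exec_ev) simp_all
  show ?thesis
  proof (cases "cell_of (top R) = None")
    case True
    have "exec (Cond (\<lambda>(m, r). cell_of r = None) (set_flag 4) (push_reg 3 ;; d_back))
        (((q, a, b, f), top R), st5 L1 R1 L (tl R) E, y) (Suc 1)
        (((q, a, b, 4), top R), st5 L1 R1 L (tl R) E, y)"
      by (rule exec_cond_True[OF _ set_flag]) (simp add: True)
    note e = exec_semi[OF p this]
    have "exec d_stop (((q, a, b, f), r), st5 L1 R1 L R E, y) (Suc (Suc (1 + Suc 1)))
        (((q, a, b, 4), top R), st5 L1 R1 L (tl R) E, y)"
      unfolding d_stop_def by (rule exec_cond_True[OF _ e]) (simp add: f0)
    moreover have "f' = 4" "L' = L" "R' = tl R" using st f0 True by auto
    ultimately show ?thesis by (intro exI[of _ "top R"]) (auto elim: exec_mono)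
  next
    case False
    then obtain c R0 where R: "R = c # R0" by (cases R) auto
    have p2: "exec (push_reg 3) (((q, a, b, f), top R), st5 L1 R1 L (tl R) E, y) 1
        (((q, a, b, f), top R), st5 L1 R1 L R E, y)"
      by (rule exec_ev) (simp_all add: R)
    have "exec (Cond (\<lambda>(m, r). cell_of r = None) (set_flag 4) (push_reg 3 ;; d_back))
      (((q, a, b, f), top R), st5 L1 R1 L (tl R) E, y) (Suc (Suc (1 + (4 * length L + 3))))
      (((q, a, b, f), None), st5 L1 R1 [] (rev L @ R) E, y)"
      by (rule exec_cond_False[OF _ exec_semi[OF p2 d_back]]) (simp add: False)
    note e = exec_semi[OF p this]
    have "exec d_stop (((q, a, b, f), r), st5 L1 R1 L R E, y)
        (Suc (Suc (1 + Suc (Suc (1 + (4 * length L + 3))))))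
        (((q, a, b, f), None), st5 L1 R1 [] (rev L @ R) E, y)"
      unfolding d_stop_def by (rule exec_cond_True[OF _ e]) (simp add: f0)
    moreover have "f' = f" "L' = []" "R' = rev L @ R" using st f0 False by auto
    ultimately show ?thesis by (intro exI[of _ None]) (auto elim: exec_mono)
  qed
next
  case False
  have "exec d_stop (((q, a, b, f), r), st5 L1 R1 L R E, y)
      (Suc (Suc (4 * length L + 3 + 1))) (((q, a, b, 0), None), st5 L1 R1 [] (rev L @ R) E, y)"
    unfolding d_stop_def by (rule exec_cond_False[OF _ exec_semi[OF d_back set_flag]]) (simp add: False)
  moreover have "f' = 0" "L' = []" "R' = rev L @ R" using st False f by auto
  ultimately show ?thesis by (intro exI[of _ None]) (auto elim: exec_mono)
qed

lemma d_token:
  assumes f: "f < 2" and st: "scan_step s (f, L, R) = (f', L', R')"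
  shows "\<exists>r'. exec d_token (((q, a, b, f), Some s), st5 L1 R1 L R E, y) (4 * length L + 11)
    (((q, a, b, f'), r'), st5 L1 R1 L' R' E, y)"
proof (cases "s = Some True")
  case True
  have e: "exec (set_mode (\<lambda>(q, a, b, f) _. (q, a, b, if f = 0 then 2 else 3)))
      (((q, a, b, f), Some s), st5 L1 R1 L R E, y) 1 (((q, a, b, f'), Some s), st5 L1 R1 L' R' E, y)"
    by (rule exec_ev) (use True st f in \<open>auto split: if_splits\<close>)
  have "exec d_token (((q, a, b, f), Some s), st5 L1 R1 L R E, y) (Suc 1)
      (((q, a, b, f'), Some s), st5 L1 R1 L' R' E, y)"
    unfolding d_token_def by (rule exec_cond_True[OF _ e]) (simp add: True)
  then show ?thesis by (intro exI, rule exec_mono) simp_all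
next
  case False
  obtain r' where e: "exec d_stop (((q, a, b, f), Some s), st5 L1 R1 L R E, y) (4 * length L + 10)
      (((q, a, b, f'), r'), st5 L1 R1 L' R' E, y)"
    using d_stop[OF f False st] by blast
  have "exec d_token (((q, a, b, f), Some s), st5 L1 R1 L R E, y) (Suc (4 * length L + 10))
      (((q, a, b, f'), r'), st5 L1 R1 L' R' E, y)"
    unfolding d_token_def by (rule exec_cond_False[OF _ e]) (simp add: False)
  then show ?thesis by (intro exI, rule exec_mono) simp_all
qed

lemma d_letter:
  assumes f: "f = 2 \<or> f = 3" and st: "scan_step s (f, L, R) = (f', L', R')"
  shows "\<exists>a' r'. exec d_letter (((q, a, b, f), Some s), st5 L1 R1 L R E, y) 11
    (((q, a', b, f'), r'), st5 L1 R1 L' R' E, y)"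
proof -
  have e: "exec d_letter (((q, a, b, f), Some s), st5 L1 R1 L R E, y) 11
      (ev d_letter (((q, a, b, f), Some s), st5 L1 R1 L R E, y))"
    by (rule exec_ev) (simp_all add: d_letter_def set_flag_def)
  have "\<exists>a' r'. ev d_letter (((q, a, b, f), Some s), st5 L1 R1 L R E, y) =
      (((q, a', b, f'), r'), st5 L1 R1 L' R' E, y)"
    using f st by (cases R) (auto simp: d_letter_def set_flag_def split: if_splits)
  then show ?thesis using e by metis
qed

lemma d_scan_body_None:
  assumes "fread y = None"
  shows "exec d_scan_body (((q, a, b, f), r), S, y) 10 (((q, a, b, 5), None), S, fwr None 1 y)"
proof -
  have 1: "exec aux_read (((q, a, b, f), r), S, y) 1 (((q, a, b, f), None), S, fwr None 1 y)"
    by (rule exec_ev) (simp_all add: assms)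
  have "exec (Cond (\<lambda>(m, r). r = None) (set_flag 5)
     (Cond (\<lambda>((q, a, b, f), r). f < 2) d_token d_letter)) (((q, a, b, f), None), S, fwr None 1 y)
     (Suc 1) (((q, a, b, 5), None), S, fwr None 1 y)"
    by (rule exec_cond_True[OF _ set_flag]) simp
  from exec_semi[OF 1 this] show ?thesis
    unfolding d_scan_body_def by (rule exec_mono) simp
qed

lemma d_scan_body:
  assumes y: "fread y = Some s" and f: "f < 4" and st: "scan_step s (f, L, R) = (f', L', R')"
  shows "\<exists>a' r'. exec d_scan_body (((q, a, b, f), r), st5 L1 R1 L R E, y) (4 * length L + 20)
    (((q, a', b, f'), r'), st5 L1 R1 L' R' E, fwr (Some s) 1 y)"
proof -
  let ?y = "fwr (Some s) 1 y"
  have 1: "exec aux_read (((q, a, b, f), r), S, y) 1 (((q, a, b, f), Some s), S, ?y)" for S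
    by (rule exec_ev) (simp_all add: y)
  have "\<exists>a' r'. exec (Cond (\<lambda>((q, a, b, f), r). f < 2) d_token d_letter)
      (((q, a, b, f), Some s), st5 L1 R1 L R E, ?y) (Suc (4 * length L + 11))
      (((q, a', b, f'), r'), st5 L1 R1 L' R' E, ?y)"
  proof (cases "f < 2")
    case True
    obtain r' where e: "exec d_token (((q, a, b, f), Some s), st5 L1 R1 L R E, ?y) (4 * length L + 11)
        (((q, a, b, f'), r'), st5 L1 R1 L' R' E, ?y)"
      using d_token[OF True st] by blast
    show ?thesis by (intro exI, rule exec_cond_True[OF _ e]) (simp add: True)
  next
    case False
    obtain a' r' where e: "exec d_letter (((q, a, b, f), Some s), st5 L1 R1 L R E, ?y) 11
        (((q, a', b, f'), r'), st5 L1 R1 L' R' E, ?y)"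
    proof -
      have "f = 2 \<or> f = 3" using f False by linarith
      from d_letter[OF this st] show ?thesis using that by blast
    qed
    show ?thesis by (intro exI, rule exec_cond_False[OF _ exec_mono[OF e]]) (simp_all add: False)
  qed
  then obtain a' r' where 2: "exec (Cond (\<lambda>((q, a, b, f), r). f < 2) d_token d_letter)
      (((q, a, b, f), Some s), st5 L1 R1 L R E, ?y) (Suc (4 * length L + 11))
      (((q, a', b, f'), r'), st5 L1 R1 L' R' E, ?y)"
    by blast
  have "exec (Cond (\<lambda>(m, r). r = None) (set_flag 5)
      (Cond (\<lambda>((q, a, b, f), r). f < 2) d_token d_letter))
      (((q, a, b, f), Some s), st5 L1 R1 L R E, ?y) (Suc (Suc (4 * length L + 11)))
      (((q, a', b, f'), r'), st5 L1 R1 L' R' E, ?y)"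
    by (rule exec_cond_False[OF _ 2]) simp
  from exec_semi[OF 1 this]
  have "exec d_scan_body (((q, a, b, f), r), st5 L1 R1 L R E, y) (4 * length L + 20)
      (((q, a', b, f'), r'), st5 L1 R1 L' R' E, ?y)"
    unfolding d_scan_body_def by (rule exec_mono) simp
  then show ?thesis by blast
qed

fun scan :: "nat \<times> bool option list \<times> bool option list \<Rightarrow> bool option list \<Rightarrow>
    nat \<times> bool option list \<times> bool option list" where
  "scan (f, L, R) [] = (5, L, R)"
| "scan (f, L, R) (s # ys) = (case scan_step s (f, L, R) of (f', L', R') \<Rightarrow>
     if f' = 4 then (4, L', R') else scan (f', L', R') ys)"

definition found :: "bool option list \<Rightarrow> bool option list \<Rightarrow> bool" where
  "found ys R \<longleftrightarrow> fst (scan (0, [], R) ys) = 4"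

lemma scan_step_flag: "f < 4 \<Longrightarrow> fst (scan_step s (f, L, R)) \<le> 4"
  by (auto split: list.splits)

declare scan_step.simps [simp del]

text \<open>\<open>4 * B\<close> steps per symbol pay for rewinding the query at the end of a word;
  \<open>B\<close> bounds the query throughout because no scan step lengthens it. The bounds on
  \<open>p'\<close> keep the head where the next lookup can walk back to a separator.\<close>

lemma d_scan_loop:
  assumes "f < 4" "length L + length R \<le> B" "drop p z = ys" "p \<le> length z"
  shows "\<exists>a' r' L' R' p'. exec d_scan
      (((q, a, b, f), r), st5 L1 R1 L R E, (word_fun z, p)) ((4 * B + 25) * (length ys + 1))
      (((q, a', b, fst (scan (f, L, R) ys)), r'), st5 L1 R1 L' R' E, (word_fun z, p')) \<and>
    length L' + length R' \<le> B \<and> p \<le> p' \<and> p' \<le> Suc (length z)"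
  using assms
proof (induction ys arbitrary: f L R p a r)
  case Nil
  then have p: "p = length z" by simp
  then have n: "word_fun z p = None" by (simp add: word_fun_def)
  have 1: "exec d_scan_body (((q, a, b, f), r), st5 L1 R1 L R E, (word_fun z, p)) 10
      (((q, a, b, 5), None), st5 L1 R1 L R E, (word_fun z, Suc p))"
  proof -
    have "fread (word_fun z, p) = None" by (simp add: n)
    from d_scan_body_None[OF this] show ?thesis
      by (rule exec_conv) (use n in \<open>simp_all add: fun_upd_idem\<close>)
  qed
  have 2: "exec d_scan
      (((q, a, b, 5), None), st5 L1 R1 L R E, (word_fun z, Suc p)) 1
      (((q, a, b, 5), None), st5 L1 R1 L R E, (word_fun z, Suc p))"
    by (rule exec_loop_end) simp
  have "exec d_scan
      (((q, a, b, f), r), st5 L1 R1 L R E, (word_fun z, p)) (Suc (10 + 1))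
      (((q, a, b, 5), None), st5 L1 R1 L R E, (word_fun z, Suc p))"
    by (rule exec_loop_step[OF _ 1 2]) (simp add: Nil)
  then have 3: "exec d_scan
      (((q, a, b, f), r), st5 L1 R1 L R E, (word_fun z, p)) ((4 * B + 25) * (length [] + 1))
      (((q, a, b, fst (scan (f, L, R) [])), None), st5 L1 R1 L R E, (word_fun z, Suc p))"
    by (rule exec_conv) simp_all
  show ?case
    by (intro exI conjI, rule 3, rule Nil.prems(2), use p in linarith, use p in linarith)
next
  case (Cons s ys)
  have p: "p < length z" using Cons.prems(3) by (metis drop_eq_Nil linorder_not_less list.distinct(1))
  then have zp: "word_fun z p = Some s" and dr: "drop (Suc p) z = ys"
    using Cons_nth_drop_Suc[OF p] Cons.prems(3) p by (simp_all add: word_fun_def)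
  obtain f' L' R' where s: "scan_step s (f, L, R) = (f', L', R')" by (metis prod_cases3)
  have f': "f' \<le> 4" using scan_step_flag[OF Cons.prems(1), of s L R] s by simp
  have len: "length L' + length R' \<le> B" using scan_step_length[OF s] Cons.prems(2) by simp
  obtain a' r' where "exec d_scan_body (((q, a, b, f), r), st5 L1 R1 L R E, (word_fun z, p))
      (4 * length L + 20) (((q, a', b, f'), r'), st5 L1 R1 L' R' E, fwr (Some s) 1 (word_fun z, p))"
  proof -
    have "fread (word_fun z, p) = Some s" using zp by simp
    from d_scan_body[OF this Cons.prems(1) s] show ?thesis using that by blast
  qed
  then have 1: "exec d_scan_body (((q, a, b, f), r), st5 L1 R1 L R E, (word_fun z, p))
      (4 * B + 20) (((q, a', b, f'), r'), st5 L1 R1 L' R' E, (word_fun z, Suc p))"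
    by (rule exec_conv) (use zp Cons.prems(2) in \<open>simp_all add: fun_upd_idem\<close>)
  have "\<exists>a'' r'' L'' R'' p'. exec d_scan
      (((q, a', b, f'), r'), st5 L1 R1 L' R' E, (word_fun z, Suc p)) ((4 * B + 25) * (length ys + 1))
      (((q, a'', b, fst (scan (f, L, R) (s # ys))), r''), st5 L1 R1 L'' R'' E, (word_fun z, p')) \<and>
    length L'' + length R'' \<le> B \<and> p \<le> p' \<and> p' \<le> Suc (length z)"
  proof (cases "f' = 4")
    case True
    have "exec d_scan
      (((q, a', b, f'), r'), st5 L1 R1 L' R' E, (word_fun z, Suc p)) 1
      (((q, a', b, f'), r'), st5 L1 R1 L' R' E, (word_fun z, Suc p))"
      by (rule exec_loop_end) (simp add: True)
    then have 2: "exec d_scan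
      (((q, a', b, f'), r'), st5 L1 R1 L' R' E, (word_fun z, Suc p)) ((4 * B + 25) * (length ys + 1))
      (((q, a', b, fst (scan (f, L, R) (s # ys))), r'), st5 L1 R1 L' R' E, (word_fun z, Suc p))"
      by (rule exec_conv) (use True s in simp_all)
    show ?thesis
      by (intro exI conjI, rule 2, rule len, use p in linarith, use p in linarith)
  next
    case False
    then have "fst (scan (f, L, R) (s # ys)) = fst (scan (f', L', R') ys)" using s by simp
    moreover have "f' < 4" using f' False by simp
    from Cons.IH[OF this len dr, of a' r'] p obtain a'' r'' L'' R'' p' where
      "exec d_scan
      (((q, a', b, f'), r'), st5 L1 R1 L' R' E, (word_fun z, Suc p)) ((4 * B + 25) * (length ys + 1))
      (((q, a'', b, fst (scan (f', L', R') ys)), r''), st5 L1 R1 L'' R'' E, (word_fun z, p'))"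
      "length L'' + length R'' \<le> B" "Suc p \<le> p'" "p' \<le> Suc (length z)"
      by auto
    ultimately show ?thesis by (metis Suc_leD)
  qed
  then obtain a'' r'' L'' R'' p' where 2: "exec d_scan
      (((q, a', b, f'), r'), st5 L1 R1 L' R' E, (word_fun z, Suc p)) ((4 * B + 25) * (length ys + 1))
      (((q, a'', b, fst (scan (f, L, R) (s # ys))), r''), st5 L1 R1 L'' R'' E, (word_fun z, p'))"
    and 3: "length L'' + length R'' \<le> B" "p \<le> p'" "p' \<le> Suc (length z)" by blast
  have "exec d_scan
      (((q, a, b, f), r), st5 L1 R1 L R E, (word_fun z, p)) (Suc (4 * B + 20 + (4 * B + 25) * (length ys + 1)))
      (((q, a'', b, fst (scan (f, L, R) (s # ys))), r''), st5 L1 R1 L'' R'' E, (word_fun z, p'))"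
    by (rule exec_loop_step[OF _ 1 2]) (simp add: Cons.prems(1))
  then have "exec d_scan
      (((q, a, b, f), r), st5 L1 R1 L R E, (word_fun z, p)) ((4 * B + 25) * (length (s # ys) + 1))
      (((q, a'', b, fst (scan (f, L, R) (s # ys))), r''), st5 L1 R1 L'' R'' E, (word_fun z, p'))"
    by (rule exec_mono) simp
  then show ?case using 3 by blast
qed

subsection \<open>Correctness of the table\<close>

declare scan_step.simps [simp]

fun agrees :: "bool list \<Rightarrow> bool option list \<Rightarrow> bool" where
  "agrees [] R \<longleftrightarrow> cell_of (top R) = None"
| "agrees (b # w) R \<longleftrightarrow> R \<noteq> [] \<and> hd R = Some b \<and> agrees w (tl R)"

lemma agrees_iff: "agrees w R \<longleftrightarrow> fcontent (cells R) = w"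
proof -
  have "agrees w R \<longleftrightarrow> (\<forall>i<length w. cells R i = Some (w ! i)) \<and> cells R (length w) = None"
  proof (induction w R rule: agrees.induct)
    case (1 R)
    then show ?case by (cases R) (auto simp: cells_def)
  next
    case (2 b w R)
    then show ?case
      by (cases R) (auto simp: cells_def All_less_Suc2)
  qed
  also have "\<dots> \<longleftrightarrow> fcontent (cells R) = w"
  proof
    assume "fcontent (cells R) = w"
    moreover have "cells R (length R) = None" by (simp add: cells_def)
    ultimately show "(\<forall>i<length w. cells R i = Some (w ! i)) \<and> cells R (length w) = None"
      using fcontentD[of "cells R" "length R"] by auto
  qed (auto intro: fcontentI)
  finally show ?thesis .
qed

lemma scan_mismatch: "scan (1, L, R) (map Some (enc_word w) @ ys) = scan (0, [], rev L @ R) ys"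
  by (induction w arbitrary: L R) (simp_all add: enc_word_def)

text \<open>\<open>L\<close> holds the letters matched so far. On failure the whole query
  \<open>rev L @ R\<close> is restored before the next word, so the tests of the words are
  independent.\<close>

lemma scan_word:
  "fst (scan (0, L, R) (map Some (enc_word w) @ ys)) = 4 \<longleftrightarrow>
    agrees w R \<or> fst (scan (0, [], rev L @ R) ys) = 4"
proof (induction w arbitrary: L R)
  case Nil
  then show ?case by (cases "cell_of (top R)") (simp_all add: enc_word_def)
next
  case (Cons b w)
  show ?case
  proof (cases R)
    case Nil
    then show ?thesis using scan_mismatch[of L "[]" w ys] by (simp add: enc_word_def)
  next
    case (Cons s R')
    then show ?thesis
      using Cons.IH[of "s # L" R'] scan_mismatch[of "s # L" R' w ys]
      by (cases "s = Some b") (simp_all add: enc_word_def)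
  qed
qed

text \<open>Success needs an end token, which differs from \<open>Some True\<close> and so does not
  occur in the padding.\<close>

lemma scan_ones: "f < 4 \<Longrightarrow> fst (scan (f, L, R) (replicate k (Some True))) \<noteq> 4"
proof (induction k arbitrary: f L R)
  case (Suc k)
  obtain f' L' R' where s: "scan_step (Some True) (f, L, R) = (f', L', R')" by (metis prod_cases3)
  then have "f' < 4" using Suc.prems by (auto split: if_splits list.splits)
  then show ?case using Suc.IH[of f' L' R'] s by simp
qed simp

lemma found_add_words:
  "found (map Some (add_words ws (ones k))) R \<longleftrightarrow> fcontent (cells R) \<in> set ws"
proof -
  have "fst (scan (0, [], R) (map Some (concat (map enc_word vs) @ ones k))) = 4 \<longleftrightarrow>
      (\<exists>w\<in>set vs. agrees w R)" for vs
  proof (induction vs)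
    case Nil
    then show ?case using scan_ones[of 0 "[]" R k] by (simp add: map_replicate)
  next
    case (Cons v vs)
    then show ?case using scan_word[of "[]" R v "map Some (concat (map enc_word vs) @ ones k)"] by simp
  qed
  from this[of "rev ws"] show ?thesis
    by (auto simp: found_def add_words_def agrees_iff)
qed

subsection \<open>Lookup and simulated steps\<close>

text \<open>The walk terminates as \<open>h\<close> is a separator not to the right of the head; a
  separator further right stops it earlier.\<close>

lemma d_left_loop:
  assumes "h \<le> p" "p \<le> Suc (length z)" "h < length z" "z ! h = None"
  shows "\<exists>h' r'. exec (d_left ;; d_seek) ((m, r), S, (word_fun z, p))
      (2 * (p - h) + 3) ((m, r'), S, (word_fun z, h')) \<and> h \<le> h' \<and> h' < length z \<and> z ! h' = None"
proof -
  have left: "exec d_left ((m, r), S, (word_fun z, p)) 1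
      ((m, word_fun z p), S, (word_fun z, if word_fun z p = Some None then p else p - 1))" for p r
    by (rule exec_ev) (simp_all add: d_left_def fun_upd_idem)
  have "\<exists>h' r'. exec d_seek
      ((m, word_fun z p), S, (word_fun z, if word_fun z p = Some None then p else p - 1))
      (2 * (p - h) + 1) ((m, r'), S, (word_fun z, h')) \<and> h \<le> h' \<and> h' < length z \<and> z ! h' = None"
    if "h \<le> p" for p
    using that
  proof (induction "p - h" arbitrary: p rule: less_induct)
    case less
    show ?case
    proof (cases "word_fun z p = Some None")
      case True
      have "exec d_seek ((m, word_fun z p), S, (word_fun z, p)) 1
        ((m, word_fun z p), S, (word_fun z, p))"
        by (rule exec_loop_end) (simp add: True)
      then have "exec d_seek ((m, word_fun z p), S, (word_fun z, p))
        (2 * (p - h) + 1) ((m, word_fun z p), S, (word_fun z, p))"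
        by (rule exec_mono) simp
      moreover have "p < length z" "z ! p = None"
        using True by (auto simp: word_fun_def split: if_splits)
      ultimately show ?thesis using True less.prems by (auto simp only: if_True refl)
    next
      case False
      have ne: "p \<noteq> h" using False assms by (auto simp: word_fun_def)
      then have p: "h \<le> p - 1" "(p - 1) - h < p - h" using less.prems by auto
      from less.hyps[OF p(2,1)] obtain h' r' where
        2: "exec d_seek
          ((m, word_fun z (p - 1)), S,
            (word_fun z, if word_fun z (p - 1) = Some None then p - 1 else p - 1 - 1))
          (2 * (p - 1 - h) + 1) ((m, r'), S, (word_fun z, h'))"
        and h': "h \<le> h'" "h' < length z" "z ! h' = None" by blast
      have "exec d_seek ((m, word_fun z p), S, (word_fun z, p - 1))
          (Suc (1 + (2 * (p - 1 - h) + 1))) ((m, r'), S, (word_fun z, h'))"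
        by (rule exec_loop_step[OF _ left 2]) (use False in simp)
      then have "exec d_seek
          ((m, word_fun z p), S, (word_fun z, if word_fun z p = Some None then p else p - 1))
          (2 * (p - h) + 1) ((m, r'), S, (word_fun z, h'))"
        by (rule exec_conv) (use False p ne in auto)
      then show ?thesis using h' by blast
    qed
  qed
  from this[OF assms(1)] obtain h' r' where
    2: "exec d_seek
      ((m, word_fun z p), S, (word_fun z, if word_fun z p = Some None then p else p - 1))
      (2 * (p - h) + 1) ((m, r'), S, (word_fun z, h'))"
    and h': "h \<le> h'" "h' < length z" "z ! h' = None" by blast
  have "exec (d_left ;; d_seek) ((m, r), S, (word_fun z, p))
      (2 * (p - h) + 3) ((m, r'), S, (word_fun z, h'))"
    using exec_semi[OF left 2] by (rule exec_mono) simp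
  then show ?thesis using h' by blast
qed

lemma d_clear:
  "exec (each 2 skip) ((m, r), st5 L1 R1 L R E, y) (4 * length L + 3) ((m, None), st5 L1 R1 [] R E, y)"
  "exec (each 3 skip) ((m, r), st5 L1 R1 L R E, y) (4 * length R + 3) ((m, None), st5 L1 R1 L [] E, y)"
proof -
  have b: "\<exists>r. exec skip ((m, Some x), S, y) 1 ((m, r), S, y)" for S x
    by (rule exI, rule exec_ev) simp_all
  show "exec (each 2 skip) ((m, r), st5 L1 R1 L R E, y) (4 * length L + 3) ((m, None), st5 L1 R1 [] R E, y)"
    using exec_each[where A = "\<lambda>xs (z :: nat). st5 L1 R1 xs R E" and Y = "\<lambda>_. y",
        where j = 2, OF _ _ b, where r = r and xs = L]
    by (rule exec_conv) simp_all
  show "exec (each 3 skip) ((m, r), st5 L1 R1 L R E, y) (4 * length R + 3) ((m, None), st5 L1 R1 L [] E, y)"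
    using exec_each[where A = "\<lambda>xs (z :: nat). st5 L1 R1 L xs E" and Y = "\<lambda>_. y",
        where j = 3, OF _ _ b, where r = r and xs = R]
    by (rule exec_conv) simp_all
qed

definition sharp :: "bool option list \<Rightarrow> nat" where
  "sharp z = length (takeWhile (\<lambda>s. s \<noteq> None) z)"

definition d_time :: "nat \<Rightarrow> nat \<Rightarrow> nat" where
  "d_time B n = (4 * B + 25) * (n + 1) + 12 * B + 2 * n + 60"

text \<open>In a word with several separators the scan may start behind a later one. Only the running
  time matters then.\<close>
lemma d_lookup:
  assumes p: "h \<le> p" "p \<le> Suc (length z)" "h < length z" "z ! h = None"
    and B: "length L + length R \<le> B"
  shows "\<exists>a' h' p'. exec d_lookup (((q, a, b, f), r), st5 L1 R1 L R E, (word_fun z, p))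
      (d_time B (length z))
      (((if found (drop (Suc h') z) (rev L @ R) then 4 else 5, a', b, 0), None),
        st5 L1 R1 [] [] E, (word_fun z, p')) \<and>
    h \<le> h' \<and> h' < length z \<and> z ! h' = None \<and> h \<le> p' \<and> p' \<le> Suc (length z)"
proof -
  let ?n = "length z" and ?R = "rev L @ R"
  obtain h' r2 where 2: "exec (d_left ;; d_seek)
      (((q, a, b, f), None), st5 L1 R1 [] ?R E, (word_fun z, p)) (2 * (p - h) + 3)
      (((q, a, b, f), r2), st5 L1 R1 [] ?R E, (word_fun z, h'))"
    and h': "h \<le> h'" "h' < length z" "z ! h' = None"
    using d_left_loop[OF p] by blast
  have 3: "exec (aux_move 1) (((q, a, b, f), r2), st5 L1 R1 [] ?R E, (word_fun z, h')) 1
      (((q, a, b, f), r2), st5 L1 R1 [] ?R E, (word_fun z, Suc h'))"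
    by (rule exec_ev) simp_all
  let ?ys = "drop (Suc h') z"
  obtain a' r' L' R' p' where 4: "exec d_scan
      (((q, a, b, 0), r2), st5 L1 R1 [] ?R E, (word_fun z, Suc h')) ((4 * B + 25) * (length ?ys + 1))
      (((q, a', b, fst (scan (0, [], ?R) ?ys)), r'), st5 L1 R1 L' R' E, (word_fun z, p'))"
    and 5: "length L' + length R' \<le> B" "Suc h' \<le> p'" "p' \<le> Suc (length z)"
    using d_scan_loop[of 0 "[]" ?R B "Suc h'" z ?ys q a b r2 L1 R1 E] B h'(2) by auto
  let ?f = "fst (scan (0, [], ?R) ?ys)"
  have 6: "exec (set_mode (\<lambda>(q, a, b, f) _. (if f = 4 then 4 else 5, a, b, 0)))
      (((q, a', b, ?f), None), st5 L1 R1 [] [] E, (word_fun z, p')) 1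
      (((if found ?ys ?R then 4 else 5, a', b, 0), None), st5 L1 R1 [] [] E, (word_fun z, p'))"
    by (rule exec_ev) (simp_all add: found_def)
  have l: "length L \<le> B" "length L' \<le> B" "length R' \<le> B" "length ?ys \<le> ?n" "p - h \<le> Suc ?n"
    using B 5 p by auto
  have t: "(4 * B + 25) * (length ?ys + 1) \<le> (4 * B + 25) * (?n + 1)"
    using l(4) by (intro mult_le_mono2) simp
  have 7: "exec d_lookup (((q, a, b, f), r), st5 L1 R1 L R E, (word_fun z, p))
      (d_time B ?n)
      (((if found ?ys ?R then 4 else 5, a', b, 0), None), st5 L1 R1 [] [] E, (word_fun z, p'))"
    unfolding d_lookup_def
    by (rule exec_mono, rule exec_semi, rule d_back, rule exec_semi, rule 2, rule exec_semi, rule 3,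
        rule exec_semi, rule set_flag, rule exec_semi, rule 4, rule exec_semi, rule d_clear,
        rule exec_semi, rule d_clear, rule 6, unfold d_time_def, use l t in linarith)
  show ?thesis
    by (intro exI conjI, rule 7, rule h', rule h', rule h', use h' 5 in linarith, rule 5)
qed

context
  fixes M :: "bool tm"
  assumes wfM: "wf_tm M" and detM: "deterministic M"
begin

definition act :: "dmode \<Rightarrow> nat \<times> bool option \<times> int \<times> bool option \<times> int" where
  "act m = (case m of (q, a, b, f) \<Rightarrow> hd (delta M q a b))"

text \<open>Both symbols read stay in the mode until the end, so that \<open>act\<close> denotes the
  same transition for the two tapes and for the new state.\<close>

definition d_step :: dcmd where
  "d_step = pop 1 ;; set_mode (\<lambda>(q, a, b, f) r. (q, cell_of r, b, f)) ;;
     pop 3 ;; set_mode (\<lambda>(q, a, b, f) r. (q, a, cell_of r, f)) ;;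
     d_put 0 1 (\<lambda>m. fst (snd (act m))) (\<lambda>m. fst (snd (snd (act m)))) ;;
     d_put 2 3 (\<lambda>m. fst (snd (snd (snd (act m))))) (\<lambda>m. snd (snd (snd (snd (act m))))) ;;
     set_mode (\<lambda>m _. case m of (q, a, b, f) \<Rightarrow> (fst (act m), a, b, f))"

lemma act_moves:
  assumes "q < nstates M" "hd (delta M q a b) = (q', w1, m1, w2, m2)"
  shows "m1 \<in> {-1, 0, 1} \<and> m2 \<in> {-1, 0, 1}"
proof -
  have "delta M q a b = [(q', w1, m1, w2, m2)]"
    using det_delta(1)[OF wfM detM assms(1)] assms(2) by metis
  moreover have "\<forall>(q', w1, m1, w2, m2)\<in>set (delta M q a b).
      q' < nstates M \<and> m1 \<in> {-1, 0, 1} \<and> m2 \<in> {-1, 0, 1}"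
    using wfM assms(1) unfolding wf_tm_def by blast
  ultimately show ?thesis by simp
qed

lemma d_step:
  assumes q: "q < nstates M" "q \<noteq> 1" "q \<noteq> 2" "q \<noteq> 3"
  shows "\<exists>q' a' b' r' L1' R1' L2' R2'.
    exec d_step (((q, a, b, f), r), st5 L1 R1 L2 R2 E, y) 33
      (((q', a', b', f), r'), st5 L1' R1' L2' R2' E, y) \<and>
    (q', tp L1' R1', tp L2' R2') = dstep Orc M (q, tp L1 R1, tp L2 R2) \<and>
    length L2' + length R2' \<le> Suc (length L2 + length R2)"
proof -
  let ?a = "cell_of (top R1)" and ?b = "cell_of (top R2)"
  obtain q' w1 m1 w2 m2 where d: "hd (delta M q ?a ?b) = (q', w1, m1, w2, m2)"
    by (metis prod_cases5)
  note m = act_moves[OF q(1) d]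
  obtain L1' R1' where 1: "put w1 m1 L1 (tl R1) = (L1', R1')" by fastforce
  obtain L2' R2' where 2: "put w2 m2 L2 (tl R2) = (L2', R2')" by fastforce
  obtain r1 where e1: "ev (d_put 0 1 (\<lambda>m. fst (snd (act m))) (\<lambda>m. fst (snd (snd (act m)))))
      (((q, ?a, ?b, f), top R2), st5 L1 (tl R1) L2 (tl R2) E, y) =
      (((q, ?a, ?b, f), r1), st5 L1' R1' L2 (tl R2) E, y)"
    using ev_d_put_01[where w = "\<lambda>m. fst (snd (act m))" and d = "\<lambda>m. fst (snd (snd (act m)))"
        and m = "(q, ?a, ?b, f)" and L = L1 and R = "tl R1" and L' = L1' and R' = R1'
        and r = "top R2" and ?L2.0 = L2 and ?R2.0 = "tl R2" and E = E and y = y] 1 d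
    by (auto simp: act_def)
  obtain r2 where e2: "ev (d_put 2 3 (\<lambda>m. fst (snd (snd (snd (act m))))) (\<lambda>m. snd (snd (snd (snd (act m))))))
      (((q, ?a, ?b, f), r1), st5 L1' R1' L2 (tl R2) E, y) =
      (((q, ?a, ?b, f), r2), st5 L1' R1' L2' R2' E, y)"
    using ev_d_put_23[where w = "\<lambda>m. fst (snd (snd (snd (act m))))"
        and d = "\<lambda>m. snd (snd (snd (snd (act m))))"
        and m = "(q, ?a, ?b, f)" and L = L2 and R = "tl R2" and L' = L2' and R' = R2'
        and r = r1 and ?L1.0 = L1' and ?R1.0 = R1' and E = E and y = y] 2 d
    by (auto simp: act_def)
  have "exec d_step (((q, a, b, f), r), st5 L1 R1 L2 R2 E, y) 33
      (((q', ?a, ?b, f), r2), st5 L1' R1' L2' R2' E, y)"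
    by (rule exec_ev) (simp_all add: d_step_def e1[unfolded One_nat_def] e2, simp add: act_def d)
  moreover have "(q', tp L1' R1', tp L2' R2') = dstep Orc M (q, tp L1 R1, tp L2 R2)"
    using q m tp_put[OF _ 1] tp_put[OF _ 2] by (simp add: gstep_def fread_tp d)
  moreover have "length L2' + length R2' \<le> Suc (length L2 + length R2)"
    using put_length[OF 2] by simp
  ultimately show ?thesis by blast
qed

definition d_body :: dcmd where
  "d_body = Cond (\<lambda>((q, a, b, f), r). q = 3) d_lookup d_step"

text \<open>Time and size bounds hold unconditionally; only the agreement with \<open>M\<close>
  presupposes that the lookup answers like \<open>Orc\<close>. On malformed inputs just the bounds
  remain.\<close>

lemma d_body:
  assumes q: "q < nstates M" "q \<noteq> 1" "q \<noteq> 2"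
    and p: "h \<le> p" "p \<le> Suc (length z)" "h < length z" "z ! h = None"
    and B: "length L2 + length R2 \<le> B"
  shows "\<exists>q' a' b' r' L1' R1' L2' R2' p'.
    exec d_body (((q, a, b, 0), r), st5 L1 R1 L2 R2 E, (word_fun z, p)) (d_time B (length z) + 1)
      (((q', a', b', 0), r'), st5 L1' R1' L2' R2' E, (word_fun z, p')) \<and>
    q' < nstates M \<and> h \<le> p' \<and> p' \<le> Suc (length z) \<and>
    length L2' + length R2' \<le> Suc (length L2 + length R2) \<and>
    ((\<forall>h'. h \<le> h' \<longrightarrow> h' < length z \<longrightarrow> z ! h' = None \<longrightarrow>
        found (drop (Suc h') z) (rev L2 @ R2) \<longleftrightarrow> fcontent (cells (rev L2 @ R2)) \<in> Orc) \<longrightarrow>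
      (q', tp L1' R1', tp L2' R2') = dstep Orc M (q, tp L1 R1, tp L2 R2))"
proof (cases "q = 3")
  case True
  obtain a' h' p' where e: "exec d_lookup (((q, a, b, 0), r), st5 L1 R1 L2 R2 E, (word_fun z, p))
      (d_time B (length z))
      (((if found (drop (Suc h') z) (rev L2 @ R2) then 4 else 5, a', b, 0), None),
        st5 L1 R1 [] [] E, (word_fun z, p'))"
    and h': "h \<le> h'" "h' < length z" "z ! h' = None" and p': "h \<le> p'" "p' \<le> Suc (length z)"
    using d_lookup[OF p B] by blast
  let ?q = "if found (drop (Suc h') z) (rev L2 @ R2) then 4 else 5 :: nat"
  have 1: "exec d_body (((q, a, b, 0), r), st5 L1 R1 L2 R2 E, (word_fun z, p)) (d_time B (length z) + 1)
      (((?q, a', b, 0), None), st5 L1 R1 [] [] E, (word_fun z, p'))"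
    unfolding d_body_def Suc_eq_plus1[symmetric]
    by (rule exec_cond_True[OF _ e]) (simp add: True)
  have 2: "?q < nstates M" using wfM by (auto simp: wf_tm_def)
  have 3: "(\<forall>h'. h \<le> h' \<longrightarrow> h' < length z \<longrightarrow> z ! h' = None \<longrightarrow>
        found (drop (Suc h') z) (rev L2 @ R2) \<longleftrightarrow> fcontent (cells (rev L2 @ R2)) \<in> Orc) \<longrightarrow>
      (?q, tp L1 R1, tp [] []) = dstep Orc M (q, tp L1 R1, tp L2 R2)"
    using True h' by (simp add: gstep_def fst_tp tp_blank)
  show ?thesis
    by (intro exI conjI, rule 1, rule 2, rule p'(1), rule p'(2), simp, rule 3)
next
  case False
  obtain q' a' b' r' L1' R1' L2' R2' where
    e: "exec d_step (((q, a, b, 0), r), st5 L1 R1 L2 R2 E, (word_fun z, p)) 33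
      (((q', a', b', 0), r'), st5 L1' R1' L2' R2' E, (word_fun z, p))"
    and d: "(q', tp L1' R1', tp L2' R2') = dstep Orc M (q, tp L1 R1, tp L2 R2)"
    and l: "length L2' + length R2' \<le> Suc (length L2 + length R2)"
    using d_step[OF q False, where a = a and b = b and f = 0 and r = r and ?L1.0 = L1 and ?R1.0 = R1
        and ?L2.0 = L2 and ?R2.0 = R2 and E = E and y = "(word_fun z, p)" and Orc = Orc] by blast
  have "exec d_body (((q, a, b, 0), r), st5 L1 R1 L2 R2 E, (word_fun z, p)) (Suc 33)
      (((q', a', b', 0), r'), st5 L1' R1' L2' R2' E, (word_fun z, p))"
    unfolding d_body_def by (rule exec_cond_False[OF _ e]) (simp add: False)
  then have 1: "exec d_body (((q, a, b, 0), r), st5 L1 R1 L2 R2 E, (word_fun z, p)) (d_time B (length z) + 1)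
      (((q', a', b', 0), r'), st5 L1' R1' L2' R2' E, (word_fun z, p))"
    by (rule exec_mono) (simp add: d_time_def)
  have 2: "q' < nstates M"
    using dstep_state[OF wfM detM, of "(q, tp L1 R1, tp L2 R2)" Orc] d[symmetric] q(1) by simp
  show ?thesis
    by (intro exI conjI impI, rule 1, rule 2, rule p, rule p, rule l, rule d)
qed

end

subsection \<open>The simulation\<close>

text \<open>Lookups may start behind any separator from \<open>h\<close> on, hence the quantifier
  over \<open>h'\<close>. Only query tapes with at most \<open>T\<close> cells count, as longer
  words need not be listed.\<close>

definition sound :: "bool option list \<Rightarrow> nat \<Rightarrow> bool list set \<Rightarrow> nat \<Rightarrow> bool" where
  "sound z h Orc T \<longleftrightarrow> (\<forall>h' R. h \<le> h' \<longrightarrow> h' < length z \<longrightarrow> z ! h' = None \<longrightarrow> length R \<le> T \<longrightarrow>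
     (found (drop (Suc h') z) R \<longleftrightarrow> fcontent (cells R) \<in> Orc))"

definition d_loop :: "bool tm \<Rightarrow> dcmd" where
  "d_loop M = Loop (\<lambda>((q, a, b, f), r). r \<noteq> None \<and> q \<noteq> 1 \<and> q \<noteq> 2) (d_body M ;; pop 4)"

text \<open>The invariant \<open>length L2 + length R2 \<le> i\<close> expresses that a step uses at
  most one new cell of the query tape. Each round consumes one clock symbol, which bounds the time
  for arbitrary tables.\<close>

lemma d_loop:
  assumes wfM: "wf_tm M" and detM: "deterministic M"
    and z: "h < length z" "z ! h = None"
  shows "q < nstates M \<Longrightarrow> h \<le> p \<Longrightarrow> p \<le> Suc (length z) \<Longrightarrow>
    length L2 + length R2 + length E \<le> B \<Longrightarrow>
    \<exists>q' a' b' r' s' y'. exec (d_loop M)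
        (((q, a, b, 0), top E), st5 L1 R1 L2 R2 (tl E), (word_fun z, p))
        ((d_time B (length z) + 5) * length E + 1) (((q', a', b', 0), r'), s', y') \<and>
      (sound z h Orc T \<longrightarrow> fhalted ((dstep Orc M ^^ T) C0) \<longrightarrow>
       (q, tp L1 R1, tp L2 R2) = (dstep Orc M ^^ i) C0 \<longrightarrow> length L2 + length R2 \<le> i \<longrightarrow>
       q' = fst ((dstep Orc M ^^ (i + length E)) C0))"
proof (induction E arbitrary: q a b L1 R1 L2 R2 p i)
  case Nil
  have 1: "exec (d_loop M) (((q, a, b, 0), top []), st5 L1 R1 L2 R2 (tl []), (word_fun z, p)) 1
      (((q, a, b, 0), top []), st5 L1 R1 L2 R2 (tl []), (word_fun z, p))"
    unfolding d_loop_def by (rule exec_loop_end) simp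
  have 2: "q = fst ((dstep Orc M ^^ (i + length ([] :: bool option list))) C0)"
    if "(q, tp L1 R1, tp L2 R2) = (dstep Orc M ^^ i) C0"
    using that[symmetric] by simp
  show ?case
    by (intro exI conjI impI, rule exec_mono, rule 1, simp, rule 2, assumption)
next
  case (Cons e E)
  let ?S = "(((q, a, b, 0), top (e # E)), st5 L1 R1 L2 R2 (tl (e # E)), (word_fun z, p))"
  show ?case
  proof (cases "q = 1 \<or> q = 2")
    case True
    have 1: "exec (d_loop M) ?S 1 ?S"
      unfolding d_loop_def by (rule exec_loop_end) (use True in auto)
    have 2: "q = fst ((dstep Orc M ^^ (i + length (e # E))) C0)"
      if d: "(q, tp L1 R1, tp L2 R2) = (dstep Orc M ^^ i) C0"
    proof -
      have "fhalted ((dstep Orc M ^^ i) C0)" using d[symmetric] True by simp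
      from dstep_halted_mono[OF this, of "i + length (e # E)"] show ?thesis
        using d[symmetric] by simp
    qed
    show ?thesis
      by (intro exI conjI impI, rule exec_mono, rule 1, simp, rule 2, assumption)
  next
    case False
    have q: "q \<noteq> 1" "q \<noteq> 2" using False by auto
    have B: "length L2 + length R2 \<le> B" using Cons.prems(4) by simp
    obtain q1 a1 b1 r1 L1' R1' L2' R2' p' where
      1: "exec (d_body M) ?S (d_time B (length z) + 1)
        (((q1, a1, b1, 0), r1), st5 L1' R1' L2' R2' E, (word_fun z, p'))"
      and q1: "q1 < nstates M" and p': "h \<le> p'" "p' \<le> Suc (length z)"
      and len: "length L2' + length R2' \<le> Suc (length L2 + length R2)"
      and next_cfg: "(\<forall>h'. h \<le> h' \<longrightarrow> h' < length z \<longrightarrow> z ! h' = None \<longrightarrow>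
        found (drop (Suc h') z) (rev L2 @ R2) \<longleftrightarrow> fcontent (cells (rev L2 @ R2)) \<in> Orc) \<longrightarrow>
        (q1, tp L1' R1', tp L2' R2') = dstep Orc M (q, tp L1 R1, tp L2 R2)"
      using d_body[OF wfM detM Cons.prems(1) q Cons.prems(2,3) z B, of a b "top (e # E)" L1 R1 E Orc]
      unfolding list.sel by blast
    have 2: "exec (pop 4) (((q1, a1, b1, 0), r1), st5 L1' R1' L2' R2' E, (word_fun z, p')) 1
        (((q1, a1, b1, 0), top E), st5 L1' R1' L2' R2' (tl E), (word_fun z, p'))"
      by (rule exec_ev) simp_all
    have B': "length L2' + length R2' + length E \<le> B" using len Cons.prems(4) by simp
    obtain q' a' b' r' s' y' where
      3: "exec (d_loop M) (((q1, a1, b1, 0), top E), st5 L1' R1' L2' R2' (tl E), (word_fun z, p'))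
        ((d_time B (length z) + 5) * length E + 1) (((q', a', b', 0), r'), s', y')"
      and fin: "sound z h Orc T \<longrightarrow> fhalted ((dstep Orc M ^^ T) C0) \<longrightarrow>
       (q1, tp L1' R1', tp L2' R2') = (dstep Orc M ^^ Suc i) C0 \<longrightarrow>
       length L2' + length R2' \<le> Suc i \<longrightarrow>
       q' = fst ((dstep Orc M ^^ (Suc i + length E)) C0)"
      using Cons.IH[OF q1 p' B', of a1 b1 L1' R1' "Suc i"] by blast
    have 4: "exec (d_loop M) ?S (Suc (Suc (d_time B (length z) + 1 + 1) +
        ((d_time B (length z) + 5) * length E + 1))) (((q', a', b', 0), r'), s', y')"
      unfolding d_loop_def
      by (rule exec_loop_step[OF _ exec_semi[OF 1 2] 3[unfolded d_loop_def]]) (use False in simp)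
    have 5: "q' = fst ((dstep Orc M ^^ (i + length (e # E))) C0)"
      if s: "sound z h Orc T" and T: "fhalted ((dstep Orc M ^^ T) C0)"
        and d: "(q, tp L1 R1, tp L2 R2) = (dstep Orc M ^^ i) C0" and l: "length L2 + length R2 \<le> i"
    proof -
      have "\<not> fhalted ((dstep Orc M ^^ i) C0)" using d[symmetric] False by simp
      \<comment> \<open>\<open>M\<close> is halted at time \<open>T\<close> with the true oracle, so
        a configuration still running has index below \<open>T\<close>, and its query tape is short
        enough for \<open>sound\<close>.\<close>
      then have "i < T" using dstep_halted_mono[OF T, of i] T by (metis not_less)
      then have "length (rev L2 @ R2) \<le> T" using l by simp
      then have "(q1, tp L1' R1', tp L2' R2') = dstep Orc M (q, tp L1 R1, tp L2 R2)"
        using next_cfg s unfolding sound_def by blast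
      then have "(q1, tp L1' R1', tp L2' R2') = (dstep Orc M ^^ Suc i) C0" using d by simp
      then show ?thesis using fin s T len l by auto
    qed
    show ?thesis
      by (intro exI conjI impI, rule exec_mono, rule 4, simp, rule 5, assumption+)
  qed
qed

text \<open>The loop stops at the separator (\<open>Some None\<close>) as well as at the end of the
  input (\<open>None\<close>); the condition in \<open>d_prog\<close> rejects in the second
  case.\<close>

definition d_input :: dcmd where
  "d_input = aux_read ;; Loop (\<lambda>(m, r). cell_of r \<noteq> None) (push_reg 0 ;; aux_read)"

text \<open>Only the height of stack 4 counts: one tick per symbol behind the separator.\<close>

definition d_clock :: dcmd where
  "d_clock = aux_read ;; Loop has (push_const 4 None ;; aux_read)"

definition d_prog :: "bool tm \<Rightarrow> (bool option, dmode \<times> bool option option) prg" where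
  "d_prog M = \<lparr>code = d_input ;; Cond (\<lambda>(m, r). r = None) (set_mode (\<lambda>(q, a, b, f) _. (2, a, b, f)))
      (each 0 (push_reg 1) ;; d_clock ;; pop 4 ;; d_loop M),
     cinit = ((0, None, None, 0), None), cyes = ((0, None, None, 0), None),
     cno = ((0, None, None, 0), None), verd = (\<lambda>((q, a, b, f), r). Halt (q = 1))\<rparr>"

lemma sharp_less: "p < sharp z \<Longrightarrow> p < length z \<and> z ! p \<noteq> None"
proof -
  assume a: "p < sharp z"
  then have "takeWhile (\<lambda>s. s \<noteq> None) z ! p \<in> set (takeWhile (\<lambda>s. s \<noteq> None) z)"
    unfolding sharp_def by (rule nth_mem)
  then have "takeWhile (\<lambda>s. s \<noteq> None) z ! p \<noteq> None" by (blast dest: set_takeWhileD)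
  then show ?thesis
    using a length_takeWhile_le[of "\<lambda>s. s \<noteq> None" z] takeWhile_nth[of p "\<lambda>s. s \<noteq> None" z]
    unfolding sharp_def by simp
qed

lemma sharp_le: "sharp z \<le> length z"
  by (simp add: sharp_def length_takeWhile_le)

lemma sharp_eq: "sharp z < length z \<Longrightarrow> z ! sharp z = None"
  using nth_length_takeWhile[of "\<lambda>s. s \<noteq> None" z] by (simp add: sharp_def)

lemma exec_aux_read:
  "exec aux_read ((m, r), s, (word_fun z, p)) 1 ((m, word_fun z p), s, (word_fun z, Suc p))"
  by (rule exec_ev) simp_all

lemma d_input:
  "exec d_input ((m, r), st5 [] [] [] [] [], (word_fun z, 0)) (4 * sharp z + 3)
    ((m, word_fun z (sharp z)), st5 (rev (take (sharp z) z)) [] [] [] [], (word_fun z, Suc (sharp z)))"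
proof -
  let ?h = "sharp z"
  have "exec (Loop (\<lambda>(m, r). cell_of r \<noteq> None) (push_reg 0 ;; aux_read))
      ((m, word_fun z p), st5 (rev (take p z)) [] [] [] [], (word_fun z, Suc p)) (4 * k + 1)
      ((m, word_fun z ?h), st5 (rev (take ?h z)) [] [] [] [], (word_fun z, Suc ?h))"
    if "p + k = ?h" for p k
    using that
  proof (induction k arbitrary: p)
    case 0
    have "cell_of (word_fun z ?h) = None"
      using sharp_eq[of z] by (auto simp: word_fun_def)
    then show ?case using 0 by (intro exec_conv[OF exec_loop_end]) simp_all
  next
    case (Suc k)
    have p: "p < length z" "z ! p \<noteq> None" using sharp_less[of p z] Suc.prems by auto
    have 1: "exec (push_reg 0) ((m, word_fun z p), st5 (rev (take p z)) [] [] [] [], (word_fun z, Suc p)) 1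
        ((m, word_fun z p), st5 (rev (take (Suc p) z)) [] [] [] [], (word_fun z, Suc p))"
      by (rule exec_ev) (use p in \<open>simp_all add: word_fun_def take_Suc_conv_app_nth\<close>)
    have 2: "exec (Loop (\<lambda>(m, r). cell_of r \<noteq> None) (push_reg 0 ;; aux_read))
      ((m, word_fun z (Suc p)), st5 (rev (take (Suc p) z)) [] [] [] [], (word_fun z, Suc (Suc p)))
      (4 * k + 1)
      ((m, word_fun z ?h), st5 (rev (take ?h z)) [] [] [] [], (word_fun z, Suc ?h))"
      using Suc by simp
    have "exec (Loop (\<lambda>(m, r). cell_of r \<noteq> None) (push_reg 0 ;; aux_read))
      ((m, word_fun z p), st5 (rev (take p z)) [] [] [] [], (word_fun z, Suc p))
      (Suc (Suc (1 + 1) + (4 * k + 1)))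
      ((m, word_fun z ?h), st5 (rev (take ?h z)) [] [] [] [], (word_fun z, Suc ?h))"
      by (rule exec_loop_step[OF _ exec_semi[OF 1 exec_aux_read] 2])
        (use p in \<open>simp add: word_fun_def\<close>)
    then show ?case by (rule exec_mono) simp
  qed
  from exec_semi[OF exec_aux_read this[of 0 ?h], of r]
  show ?thesis unfolding d_input_def by (rule exec_conv) simp_all
qed

lemma d_clock:
  assumes "h < length z"
  shows "exec d_clock ((m, r), st5 A D [] [] [], (word_fun z, Suc h)) (4 * length z + 3)
    ((m, None), st5 A D [] [] (replicate (length z - Suc h) None), (word_fun z, Suc (length z)))"
proof -
  have "exec (Loop has (push_const 4 None ;; aux_read))
      ((m, word_fun z p), st5 A D [] [] (replicate (p - Suc h) None), (word_fun z, Suc p)) (4 * k + 1)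
      ((m, None), st5 A D [] [] (replicate (length z - Suc h) None), (word_fun z, Suc (length z)))"
    if "p + k = length z" "h < p" for p k
    using that
  proof (induction k arbitrary: p)
    case 0
    have n: "word_fun z (length z) = None" by (simp add: word_fun_def)
    show ?case using 0 by (intro exec_conv[OF exec_loop_end]) (simp_all add: n)
  next
    case (Suc k)
    have p: "word_fun z p = Some (z ! p)" using Suc.prems by (simp add: word_fun_def)
    have 1: "exec (push_const 4 None)
        ((m, word_fun z p), st5 A D [] [] (replicate (p - Suc h) None), (word_fun z, Suc p)) 1
        ((m, word_fun z p), st5 A D [] [] (replicate (Suc p - Suc h) None), (word_fun z, Suc p))"
      by (rule exec_ev) (use Suc.prems in \<open>simp_all flip: replicate_Suc add: Suc_diff_Suc\<close>)
    have 2: "exec (Loop has (push_const 4 None ;; aux_read))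
      ((m, word_fun z (Suc p)), st5 A D [] [] (replicate (Suc p - Suc h) None), (word_fun z, Suc (Suc p)))
      (4 * k + 1)
      ((m, None), st5 A D [] [] (replicate (length z - Suc h) None), (word_fun z, Suc (length z)))"
      using Suc.IH[of "Suc p"] Suc.prems by simp
    have "exec (Loop has (push_const 4 None ;; aux_read))
      ((m, word_fun z p), st5 A D [] [] (replicate (p - Suc h) None), (word_fun z, Suc p))
      (Suc (Suc (1 + 1) + (4 * k + 1)))
      ((m, None), st5 A D [] [] (replicate (length z - Suc h) None), (word_fun z, Suc (length z)))"
      by (rule exec_loop_step[OF _ exec_semi[OF 1 exec_aux_read] 2]) (simp add: p)
    then show ?case by (rule exec_mono) simp
  qed
  note loop = this[of "Suc h" "length z - Suc h"]
  show ?thesis unfolding d_clock_def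
    by (rule exec_conv, rule exec_semi, rule exec_aux_read, rule loop) (use assms in simp_all)
qed

definition d_total :: "nat \<Rightarrow> nat" where
  "d_total n = (d_time n n + 5) * n + 20 * n + 40"

lemma d_prog_exec:
  assumes wfM: "wf_tm M" and detM: "deterministic M"
  shows "\<exists>q a b r s y. exec (code (d_prog M))
      (((0, None, None, 0), None), st5 [] [] [] [] [], (word_fun z, 0)) (d_total (length z))
      (((q, a, b, 0), r), s, y) \<and>
    (z = sep_word x w \<longrightarrow> sound z (length x) Orc T \<longrightarrow> T \<le> length w \<longrightarrow>
       fhalted ((dstep Orc M ^^ T) (finit x)) \<longrightarrow>
       q = fst ((dstep Orc M ^^ T) (finit x)))"
proof (cases "sharp z < length z")
  case False
  then have e: "sharp z = length z" using sharp_le[of z] by simp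
  have n: "word_fun z (sharp z) = None" by (simp add: e word_fun_def)
  let ?S = "st5 (rev (take (sharp z) z)) [] [] [] []"
  have 1: "exec (set_mode (\<lambda>(q, a, b, f) _. (2, a, b, f)))
      (((0, None, None, 0), word_fun z (sharp z)), ?S, (word_fun z, Suc (sharp z))) 1
      (((2, None, None, 0), word_fun z (sharp z)), ?S, (word_fun z, Suc (sharp z)))"
    by (rule exec_ev) simp_all
  have 2: "exec (code (d_prog M)) (((0, None, None, 0), None), st5 [] [] [] [] [], (word_fun z, 0))
      (Suc (4 * sharp z + 3 + Suc 1))
      (((2, None, None, 0), word_fun z (sharp z)), ?S, (word_fun z, Suc (sharp z)))"
    unfolding d_prog_def prg.simps by (rule exec_semi[OF d_input exec_cond_True[OF _ 1]]) (simp add: n)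
  have 3: "z \<noteq> sep_word x w" for x w
    using False sharp_less[of "length x" z] by (auto simp: sep_word_def nth_append)
  show ?thesis
    by (intro exI conjI, rule exec_mono, rule 2) (use 3 sharp_le[of z] in \<open>auto simp: d_total_def\<close>)
next
  case True
  let ?h = "sharp z" and ?n = "length z"
  let ?x = "take ?h z" and ?E = "replicate (?n - Suc ?h) (None :: bool option)"
  have zh: "z ! ?h = None" by (rule sharp_eq[OF True])
  have b: "\<exists>r. exec (push_reg 1) ((m, Some x), st5 xs v [] [] [], y) 1
      ((m, r), st5 xs (x # v) [] [] [], y)" for m x xs v y
    by (rule exI, rule exec_ev) auto
  have 1: "exec (each 0 (push_reg 1)) ((m, r), st5 (rev ?x) [] [] [] [], y) (4 * ?h + 3)
      ((m, None), st5 [] ?x [] [] [], y)" for m r y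
    using exec_each[where A = "\<lambda>xs v. st5 xs v [] [] []" and Y = "\<lambda>_. y",
        where j = 0, OF _ _ b, where r = r and xs = "rev ?x" and z = "[]"]
    by (rule exec_conv) (simp_all add: fold_Cons_rev)
  have 2: "exec (pop 4) ((m, r), st5 [] ?x [] [] ?E, y) 1
      ((m, top ?E), st5 [] ?x [] [] (tl ?E), y)" for m r y
    by (rule exec_ev) simp_all
  have q0: "0 < nstates M" using wfM by (simp add: wf_tm_def)
  have p: "?h \<le> Suc ?n" "Suc ?n \<le> Suc ?n" using True by simp_all
  have B: "length ([] :: bool option list) + length ([] :: bool option list) + length ?E \<le> ?n"
    by simp
  obtain q a b r s y where
    3: "exec (d_loop M) (((0, None, None, 0), top ?E), st5 [] ?x [] [] (tl ?E), (word_fun z, Suc ?n))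
        ((d_time ?n ?n + 5) * length ?E + 1) (((q, a, b, 0), r), s, y)"
    and fin: "sound z ?h Orc T \<longrightarrow> fhalted ((dstep Orc M ^^ T) (finit x)) \<longrightarrow>
       (0, tp [] ?x, tp [] []) = (dstep Orc M ^^ 0) (finit x) \<longrightarrow>
       length ([] :: bool option list) + length ([] :: bool option list) \<le> 0 \<longrightarrow>
       q = fst ((dstep Orc M ^^ (0 + length ?E)) (finit x))"
    using d_loop[OF wfM detM True zh q0 p B, where ?L1.0 = "[]" and ?R1.0 = ?x and a = None
        and b = None and i = 0 and Orc = Orc and T = T and ?C0.0 = "finit x"] by blast
  have "exec (Cond (\<lambda>(m, r). r = None) (set_mode (\<lambda>(q, a, b, f) _. (2, a, b, f)))
      (each 0 (push_reg 1) ;; d_clock ;; pop 4 ;; d_loop M))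
      (((0, None, None, 0), word_fun z ?h), st5 (rev ?x) [] [] [] [], (word_fun z, Suc ?h))
      (Suc (Suc (4 * ?h + 3 + Suc (4 * ?n + 3 + Suc (1 + ((d_time ?n ?n + 5) * length ?E + 1))))))
      (((q, a, b, 0), r), s, y)"
    by (rule exec_cond_False[OF _ exec_semi[OF 1 exec_semi[OF d_clock[OF True] exec_semi[OF 2 3]]]])
      (use True in \<open>simp add: word_fun_def\<close>)
  note 4 = exec_semi[OF d_input this]
  have l: "(d_time ?n ?n + 5) * length ?E \<le> (d_time ?n ?n + 5) * ?n"
    by (intro mult_le_mono2) simp
  have 5: "exec (code (d_prog M)) (((0, None, None, 0), None), st5 [] [] [] [] [], (word_fun z, 0))
      (d_total ?n) (((q, a, b, 0), r), s, y)"
    unfolding d_prog_def prg.simps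
    by (rule exec_mono, rule 4, unfold d_total_def, use l p in linarith)
  have 6: "q = fst ((dstep Orc M ^^ T) (finit x))"
    if z: "z = sep_word x w" and s: "sound z (length x) Orc T" and T: "T \<le> length w"
      and halts: "fhalted ((dstep Orc M ^^ T) (finit x))"
  proof -
    have "takeWhile (\<lambda>s. s \<noteq> None) z = map Some x"
      unfolding z sep_word_def by (subst takeWhile_append2) auto
    then have h: "?h = length x" by (simp add: sharp_def)
    have "q = fst ((dstep Orc M ^^ length ?E) (finit x))"
    proof -
      have "(0, tp [] ?x, tp [] []) = (dstep Orc M ^^ 0) (finit x)"
        by (simp add: h) (simp add: z sep_word_def tp_word tp_blank finit_def)
      moreover have "sound z ?h Orc T" using s by (simp add: h)
      ultimately show ?thesis using fin halts by auto
    qed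
    \<comment> \<open>The clock has one tick per advice symbol, hence at least \<open>T\<close>
      ticks; from time \<open>T\<close> on the configuration is constant.\<close>
    moreover have "length ?E = length w" by (simp add: h) (simp add: z sep_word_def)
    ultimately show ?thesis using dstep_halted_mono[OF halts T] by simp
  qed
  show ?thesis
    by (intro exI conjI impI, rule 5, rule 6, assumption+)
qed

lemma d_prog_wf:
  assumes wfM: "wf_tm M" and detM: "deterministic M"
  shows "wf_cmd 5 (({..<nstates M} \<times> UNIV \<times> UNIV \<times> {..<6}) \<times> UNIV) (code (d_prog M))"
proof -
  have act: "fst (act M (q, a, b, f)) < nstates M" if "q < nstates M" for q a b f
    using det_delta(2)[OF wfM detM that] by (simp add: act_def[OF wfM detM])
  have "2 < nstates M" "4 < nstates M" "5 < nstates M" using wfM by (auto simp: wf_tm_def)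
  then show ?thesis
    using act
    by (auto simp: d_prog_def d_input_def d_clock_def d_loop_def d_body_def[OF wfM detM]
        d_step_def[OF wfM detM] d_lookup_def d_scan_body_def d_token_def d_letter_def d_stop_def
        d_back_def d_put_def set_flag_def d_left_def)
qed

text \<open>The time bound refers to all words because the simulating machine has to halt on
  words that are not of the form \<open>x#a\<close>, too.\<close>
lemma lookup_machine:
  assumes wfM: "wf_tm M" and detM: "deterministic M"
  shows "\<exists>N t. wf_tm N \<and> deterministic N \<and> poly_bounded t \<and>
    (\<forall>z. runs_within {} N z (t (length z))) \<and>
    (\<forall>x Orc T w. sound (sep_word x w) (length x) Orc T \<longrightarrow> T \<le> length w \<longrightarrow>
       fhalted ((dstep Orc M ^^ T) (finit x)) \<longrightarrow>
       (accepts {} N (sep_word x w) \<longleftrightarrow> fst ((dstep Orc M ^^ T) (finit x)) = 1))"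
proof -
  let ?C = "({..<nstates M} \<times> (UNIV :: bool option set) \<times> (UNIV :: bool option set) \<times> {..<6 :: nat}) \<times>
    (UNIV :: bool option option set)"
  have C: "finite ?C" "cinit (d_prog M) \<in> ?C" "cyes (d_prog M) \<in> ?C" "cno (d_prog M) \<in> ?C"
    using wfM by (auto simp: d_prog_def wf_tm_def)
  obtain N where N: "wf_tm N" "deterministic N"
    and run: "\<And>Orc x n c s y b T. (sstep (d_prog M) Orc ^^ n)
        ([code (d_prog M)], cinit (d_prog M), \<lambda>_. [], (word_fun x, 0)) = ([], c, s, y) \<Longrightarrow>
      verd (d_prog M) c = Halt b \<Longrightarrow> 2 * length x + 5 + (2 * (5 + 4) * (n * n) + 1) \<le> T \<Longrightarrow>
      runs_within Orc N x T \<and> (accepts Orc N x \<longleftrightarrow> b)"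
  proof -
    from ex_tm_of_prg[OF d_prog_wf[OF wfM detM] C] obtain N where N: "wf_tm N" "deterministic N"
      and "\<forall>Orc x n c s y b T. (sstep (d_prog M) Orc ^^ n)
        ([code (d_prog M)], cinit (d_prog M), \<lambda>_. [], (word_fun x, 0)) = ([], c, s, y) \<longrightarrow>
        verd (d_prog M) c = Halt b \<longrightarrow> 2 * length x + 5 + (2 * (5 + 4) * (n * n) + 1) \<le> T \<longrightarrow>
        runs_within Orc N x T \<and> (accepts Orc N x \<longleftrightarrow> b)"
      by blast
    then show ?thesis by (intro that[OF N]) blast
  qed
  define t where "t n = 2 * n + 5 + (2 * (5 + 4) * (d_total n * d_total n) + 1)" for n
  have e: "st5 [] [] [] [] [] = (\<lambda>_. [])" by (auto simp: st5_def)
  have main: "\<exists>q. runs_within {} N z (t (length z)) \<and> (accepts {} N z \<longleftrightarrow> q = 1) \<and>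
     (z = sep_word x w \<longrightarrow> sound z (length x) Orc T \<longrightarrow> T \<le> length w \<longrightarrow>
       fhalted ((dstep Orc M ^^ T) (finit x)) \<longrightarrow> q = fst ((dstep Orc M ^^ T) (finit x)))"
    for z x w Orc T
  proof -
    obtain q a b r s y where ex: "exec (code (d_prog M))
      (((0, None, None, 0), None), st5 [] [] [] [] [], (word_fun z, 0)) (d_total (length z))
      (((q, a, b, 0), r), s, y)"
      and q: "z = sep_word x w \<longrightarrow> sound z (length x) Orc T \<longrightarrow> T \<le> length w \<longrightarrow>
       fhalted ((dstep Orc M ^^ T) (finit x)) \<longrightarrow> q = fst ((dstep Orc M ^^ T) (finit x))"
      using d_prog_exec[OF wfM detM, of z x w Orc T] by blast
    obtain k where k: "k \<le> d_total (length z)" "(sstep (d_prog M) {} ^^ k)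
        ([code (d_prog M)], cinit (d_prog M), \<lambda>_. [], (word_fun z, 0)) = ([], ((q, a, b, 0), r), s, y)"
      using exec_reach[OF ex, of "d_prog M" "{}" "[]"] unfolding reach_def e
      by (auto simp: d_prog_def)
    have "k * k \<le> d_total (length z) * d_total (length z)" using k(1) by (rule mult_le_mono) (rule k(1))
    then have "2 * length z + 5 + (2 * (5 + 4) * (k * k) + 1) \<le> t (length z)" by (simp add: t_def)
    from run[OF k(2) _ this, of "q = 1"] show ?thesis using q by (auto simp: d_prog_def)
  qed
  have pb: "poly_bounded t"
    unfolding t_def d_total_def d_time_def by (intro poly_bounded_intros)
  show ?thesis
  proof (intro exI[of _ N] exI[of _ t] conjI allI impI)
    fix z show "runs_within {} N z (t (length z))" using main[of z] by blast
  next
    fix x Orc T w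
    assume "sound (sep_word x w) (length x) Orc T" "T \<le> length w"
      "fhalted ((dstep Orc M ^^ T) (finit x))"
    then show "accepts {} N (sep_word x w) \<longleftrightarrow> fst ((dstep Orc M ^^ T) (finit x)) = 1"
      using main[of "sep_word x w" x w Orc T] by metis
  qed (fact N pb)+
qed

section \<open>The prefix language is in NP\<close>

definition prefix_lang :: "bool list set \<Rightarrow> bool list set" where
  "prefix_lang S = {u @ True # replicate (length v) False | u v. u @ v \<in> S}"

text \<open>The last \<open>True\<close> is the marker, so a query word determines both the prefix
  and the number of missing letters.\<close>

lemma last_True_unique:
  "u @ True # replicate i False = u' @ True # replicate j False \<Longrightarrow> u = u' \<and> i = j"
proof (induction i arbitrary: j)
  case 0
  then show ?case
  proof (cases j)
    case (Suc j')
    then have "last (u @ True # replicate 0 False) = False" using 0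
      by (simp add: last_append)
    then show ?thesis by simp
  qed simp
next
  case (Suc i)
  show ?case
  proof (cases j)
    case 0
    then have "last (u @ True # replicate (Suc i) False) = True" using Suc.prems by simp
    moreover have "last (u @ True # replicate (Suc i) False) = False"
      by (simp only: last_append last_ConsR replicate_Suc list.distinct if_False)
        (simp add: last_conv_nth nth_Cons')
    ultimately show ?thesis by simp
  next
    case (Suc j')
    have snoc: "u @ True # replicate (Suc k) False = (u @ True # replicate k False) @ [False]" for u k
      by (simp flip: replicate_append_same)
    have "u @ True # replicate i False = u' @ True # replicate j' False"
      using Suc.prems unfolding Suc snoc by simp
    then show ?thesis using Suc.IH Suc by simp
  qed
qed

lemma word_fun_append_upd:
  "(word_fun (xs @ y # zs))(length xs := Some c) = word_fun (xs @ c # zs)"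
  by (auto simp: word_fun_def fun_eq_iff nth_append nth_Cons')

context
  fixes M :: "bool tm"
  assumes wfM: "wf_tm M" and detM: "deterministic M"
begin

abbreviation "N0 \<equiv> nstates M"

text \<open>State 0 must be the start of the guessing machine itself, so the start state of
  \<open>M\<close> moves to \<open>N0\<close>, also when \<open>M\<close> returns to it
  later.\<close>

definition ren :: "nat \<Rightarrow> nat" where
  "ren q = (if q = 0 then N0 else q)"

text \<open>The machine marks cell 0 of the query tape and moves both heads in lockstep. It keeps
  a prefix (state \<open>0\<close> or \<open>N0 + 1\<close>), replaces the last \<open>True\<close> and all later symbols but one by guesses
  (state \<open>N0 + 2\<close>), and returns to the mark (state \<open>N0 + 4\<close>).\<close>
definition guess_delta :: "nat \<Rightarrow> bool option \<Rightarrow> bool option \<Rightarrow> bool action list" where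
  "guess_delta q a r =
    (if q = 0 \<or> q = N0 + 1 then
       let m = (if q = 0 then Some True else r) in
       (case a of None \<Rightarrow> [(2, a, 0, r, 0)]
        | Some b \<Rightarrow> (N0 + 1, a, 1, m, 1) # (if b then
            [(N0 + 2, Some True, 1, m, 1), (N0 + 2, Some False, 1, m, 1), (N0 + 3, None, 1, m, 1)]
            else []))
     else if q = N0 + 2 then
       (if a = Some False then
          [(N0 + 2, Some True, 1, r, 1), (N0 + 2, Some False, 1, r, 1), (N0 + 3, None, 1, r, 1)]
        else [(2, a, 0, r, 0)])
     else if q = N0 + 3 then
       (if a = None then [(N0 + 4, None, -1, r, -1)] else [(2, a, 0, r, 0)])
     else if q = N0 + 4 then
       (if r = None then [(N0 + 4, a, -1, r, -1)] else [(N0, a, 0, None, 0)])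
     else map (\<lambda>(q', x). (ren q', x)) (delta M (if q = N0 then 0 else q) a r))"

definition guess_tm :: "bool tm" where
  "guess_tm = \<lparr>nstates = N0 + 5, delta = guess_delta\<rparr>"

lemma N0: "6 \<le> N0"
  using wfM by (simp add: wf_tm_def)

lemma wf_guess_tm: "wf_tm guess_tm"
  unfolding wf_tm_def
proof (intro conjI allI impI)
  show "6 \<le> nstates guess_tm" using N0 by (simp add: guess_tm_def)
  fix q a r assume q: "q < nstates guess_tm"
  have old: "delta M p a r \<noteq> [] \<and> (\<forall>(q', w1, m1, w2, m2)\<in>set (delta M p a r).
      q' < N0 \<and> m1 \<in> {-1, 0, 1} \<and> m2 \<in> {-1, 0, 1})" if "p < N0" for p
    using wfM that by (simp add: wf_tm_def)
  consider "q \<in> {0, N0 + 1, N0 + 2, N0 + 3, N0 + 4}" | "q = N0" | "q < N0" "q \<noteq> 0"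
    using q by (force simp: guess_tm_def)
  note cs = this
  show "delta guess_tm q a r \<noteq> []"
    using cs old[of 0] old[of q] N0
    by cases (auto simp: guess_tm_def guess_delta_def Let_def split: option.split)
  show "\<forall>(q', w1, m1, w2, m2)\<in>set (delta guess_tm q a r).
      q' < nstates guess_tm \<and> m1 \<in> {- 1, 0, 1} \<and> m2 \<in> {- 1, 0, 1}"
    using cs
  proof cases
    case 1
    then show ?thesis using N0
      by (auto simp: guess_tm_def guess_delta_def Let_def split: option.splits if_splits)
  next
    case 2
    then show ?thesis using old[of 0] N0
      by (fastforce simp: guess_tm_def guess_delta_def ren_def)
  next
    case 3
    then show ?thesis using old[of q] N0
      by (fastforce simp: guess_tm_def guess_delta_def ren_def)
  qed
qed

section \<open>Soundness: all configurations of the guessing machine\<close>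

definition mark :: "nat \<Rightarrow> bool ftape" where
  "mark k = ((\<lambda>_. None)(0 := Some True), k)"

definition emb_cfg :: "(nat, bool) fconfig \<Rightarrow> (nat, bool) fconfig" where
  "emb_cfg C = (ren (fst C), snd C)"

text \<open>What can be reached in \<open>k\<close> steps on input \<open>z\<close>.\<close>
inductive stage :: "bool list set \<Rightarrow> bool list \<Rightarrow> nat \<Rightarrow> (nat, bool) fconfig \<Rightarrow> bool"
  for Orc :: "bool list set" and z :: "bool list" where
  start: "stage Orc z 0 (finit z)"
| keep: "1 \<le> k \<Longrightarrow> k \<le> length z \<Longrightarrow> stage Orc z k (N0 + 1, (word_fun z, k), mark k)"
| guess: "z = u @ True # replicate (length v) False @ y \<Longrightarrow>
    stage Orc z (length u + length v + 1) (N0 + 2, (word_fun (u @ v @ c # y), length u + length v + 1),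
      mark (length u + length v + 1))"
| check: "z = u @ True # replicate (length v) False @ y \<Longrightarrow>
    stage Orc z (length u + length v + 1)
      (N0 + 3, ((word_fun (u @ v @ True # y))(length u + length v := None), length u + length v + 1),
       mark (length u + length v + 1))"
| return: "z = u @ True # replicate (length v) False \<Longrightarrow> p + k = 2 * length u + 2 * length v + 2 \<Longrightarrow>
    p \<le> length u + length v \<Longrightarrow>
    stage Orc z k (N0 + 4, (word_fun (u @ v), p), mark p)"
| reject: "k \<le> Suc (length z) \<Longrightarrow> stage Orc z (Suc k) (2, X)"
| sim: "z = u @ True # replicate (length v) False \<Longrightarrow>
    \<forall>i'<i. \<not> fhalted ((dstep Orc M ^^ i') (finit (u @ v))) \<Longrightarrow>
    stage Orc z (2 * (length u + length v) + 3 + i) (emb_cfg ((dstep Orc M ^^ i) (finit (u @ v))))"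

lemma sim_step:
  assumes "fst C < N0"
  shows "nstep Orc guess_tm (emb_cfg C) C' \<longleftrightarrow> \<not> fhalted C \<and> C' = emb_cfg (dstep Orc M C)"
proof -
  obtain q w x where C: "C = (q, w, x)" by (cases C)
  have q: "q < N0" using assms C by simp
  obtain v where v: "delta M q (fread w) (fread x) = [v]"
    using det_delta(1)[OF wfM detM q] by blast
  have r: "ren q = 1 \<longleftrightarrow> q = 1" "ren q = 2 \<longleftrightarrow> q = 2" "ren q = 3 \<longleftrightarrow> q = 3"
    using N0 by (auto simp: ren_def)
  have d: "delta guess_tm (ren q) (fread w) (fread x) = map (\<lambda>(q', x). (ren q', x)) [v]"
    using v q by (auto simp: guess_tm_def guess_delta_def ren_def)
  have 45: "ren 4 = 4" "ren 5 = 5" by (simp_all add: ren_def)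
  show ?thesis
    unfolding C emb_cfg_def nstep_def gstep_def
    by (auto simp: r[simplified] d v 45 split: prod.splits)
qed

lemma mark_simps [simp]:
  "fread (mark 0) = Some True" "0 < k \<Longrightarrow> fread (mark k) = None"
  "0 < k \<Longrightarrow> fwr None 1 (mark k) = mark (Suc k)"
  "0 < k \<Longrightarrow> fwr None (-1) (mark k) = mark (k - 1)"
  "fwr None 0 (mark 0) = blank"
  by (auto simp: mark_def blank_def fun_eq_iff)

lemma mark_blank: "fwr (Some True) 1 blank = mark 1" "fread blank = None"
  by (auto simp: mark_def blank_def fun_eq_iff)

lemma nstep_guess:
  assumes "q = 0 \<or> N0 < q"
  shows "nstep Orc guess_tm (q, w, x) C' \<longleftrightarrow> (\<exists>(q', w1, m1, w2, m2) \<in> set (guess_delta q (fread w) (fread x)).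
    C' = (q', fwr w1 m1 w, fwr w2 m2 x))"
  using assms N0 by (auto simp: nstep_def guess_tm_def)

text \<open>The start state and the copying state differ only in the symbol put on the query tape,
  so both are treated together.\<close>

lemma stage_letter:
  assumes "k < length z" and C: "C = (q, (word_fun z, k), x)" and q: "q = 0 \<or> q = N0 + 1"
    and x: "fwr (if q = 0 then Some True else fread x) 1 x = mark (Suc k)"
    and st: "nstep Orc guess_tm C C'"
  shows "stage Orc z (Suc k) C'"
proof -
  define u y where "u = take k z" and "y = drop (Suc k) z"
  have z: "z = u @ z ! k # y" and u: "length u = k"
    using assms(1) by (simp_all add: u_def y_def id_take_nth_drop[symmetric])
  have a: "word_fun z k = Some (z ! k)" using assms(1) by (simp add: word_fun_def)
  have upd: "(word_fun z)(k := Some c) = word_fun (u @ c # y)" for c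
    using word_fun_append_upd[of u "z ! k" y c] z u by simp
  have self: "word_fun (u @ z ! k # y) = word_fun z" using z by metis
  then have self_False: "word_fun (u @ False # y) = word_fun z" if "\<not> z ! k" using that by simp
  let ?m = "if q = 0 then Some True else fread x"
  have "C' = (N0 + 1, (word_fun z, Suc k), mark (Suc k)) \<or>
     z ! k \<and> ((\<exists>c. C' = (N0 + 2, (word_fun (u @ c # y), Suc k), mark (Suc k))) \<or>
      C' = (N0 + 3, ((word_fun z)(k := None), Suc k), mark (Suc k)))"
    using st x q N0 unfolding C
    by (subst (asm) nstep_guess)
      (auto simp: guess_delta_def Let_def a upd self self_False split: if_splits)
  then show ?thesis
  proof (elim disjE conjE exE)
    assume "C' = (N0 + 1, (word_fun z, Suc k), mark (Suc k))"
    then show ?thesis using stage.keep[of "Suc k" z Orc] assms(1) by simp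
  next
    fix c assume c: "C' = (N0 + 2, (word_fun (u @ c # y), Suc k), mark (Suc k))" and "z ! k"
    then show ?thesis using stage.guess[of z u "[]" y Orc c] z u by simp
  next
    assume c: "C' = (N0 + 3, ((word_fun z)(k := None), Suc k), mark (Suc k))" and "z ! k"
    then show ?thesis using stage.check[of z u "[]" y Orc] z u by simp
  qed
qed

lemma nstep_reject:
  assumes "q = 0 \<or> N0 < q" "guess_delta q (fread w) (fread x) = [(2, fread w, 0, fread x, 0)]"
    "nstep Orc guess_tm (q, w, x) C'" "k \<le> Suc (length z)"
  shows "stage Orc z (Suc k) C'"
  using assms(3,4) by (subst (asm) nstep_guess[OF assms(1)]) (auto simp: assms(2) intro: stage.reject)

text \<open>\<open>stage\<close> is an invariant of all nondeterministic branches that also records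
  the step number; acceptance and time bound can be read off from it.\<close>

lemma stage_step:
  assumes "stage Orc z k C" "nstep Orc guess_tm C C'"
  shows "stage Orc z (Suc k) C'"
  using assms
proof (cases rule: stage.cases)
  case start
  show ?thesis
  proof (cases z)
    case Nil
    show ?thesis
      by (rule nstep_reject[of 0 "(word_fun z, 0)" blank Orc C'])
        (use assms(2) start Nil in \<open>simp_all add: guess_delta_def finit_def word_fun_def Let_def\<close>)
  next
    case (Cons b y)
    show ?thesis unfolding start
      by (rule stage_letter[of 0 z C 0 blank])
        (use Cons start assms(2) mark_blank in \<open>simp_all add: finit_def\<close>)
  qed
next
  case keep
  show ?thesis
  proof (cases "k < length z")
    case True
    show ?thesis
      by (rule stage_letter[OF True keep(1)]) (use keep assms(2) in simp_all)
  next
    case False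
    show ?thesis
      by (rule nstep_reject[of "N0 + 1" "(word_fun z, k)" "mark k" Orc C'])
        (use False assms(2) keep in \<open>simp_all add: guess_delta_def word_fun_def Let_def\<close>)
  qed
next
  case (guess u v y c)
  let ?k = "length u + length v + 1"
  let ?w = "u @ v @ c # y"
  show ?thesis
  proof (cases "\<exists>y'. y = False # y'")
    case True
    then obtain y' where y: "y = False # y'" by blast
    have l: "length (u @ v @ [c]) = ?k" by simp
    have a: "word_fun ?w ?k = Some False" by (simp add: word_fun_def y nth_append)
    have upd: "(word_fun ?w)(?k := Some b) = word_fun (u @ (v @ [c]) @ b # y')" for b
      using word_fun_append_upd[of "u @ v @ [c]" False y' b] by (simp add: y)
    have none: "(word_fun ?w)(?k := None) = (word_fun (u @ (v @ [c]) @ True # y'))(?k := None)"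
      using upd[of True] by (metis fun_upd_upd)
    have z: "z = u @ True # replicate (length (v @ [c])) False @ y'"
      using guess(3) y by (simp add: replicate_app_Cons_same)
    have "(\<exists>b. C' = (N0 + 2, (word_fun (u @ (v @ [c]) @ b # y'), Suc ?k), mark (Suc ?k))) \<or>
       C' = (N0 + 3, ((word_fun (u @ (v @ [c]) @ True # y'))(?k := None), Suc ?k), mark (Suc ?k))"
      using assms(2) unfolding guess(2)
      by (subst (asm) nstep_guess)
        (use a upd none in \<open>auto simp: guess_delta_def\<close>)
    then show ?thesis
      using stage.guess[OF z, of Orc] stage.check[OF z, of Orc] guess(1) by auto
  next
    case False
    have "word_fun ?w ?k \<noteq> Some False"
      using False by (cases y) (auto simp: word_fun_def nth_append)
    then show ?thesis
      by (intro nstep_reject[of "N0 + 2" "(word_fun ?w, ?k)" "mark ?k" Orc C'])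
        (use assms(2) guess in \<open>simp_all add: guess_delta_def\<close>)
  qed
next
  case (check u v y)
  let ?k = "length u + length v + 1"
  let ?f = "(word_fun (u @ v @ True # y))(length u + length v := None)"
  show ?thesis
  proof (cases y)
    case Nil
    \<comment> \<open>Marker and zeros occupy one cell more than \<open>v\<close>; the surplus cell
      is the erased one.\<close>
    have f: "?f = word_fun (u @ v)"
      by (auto simp: Nil word_fun_def fun_eq_iff nth_append less_Suc_eq)
    have z: "z = u @ True # replicate (length v) False" using check(3) Nil by simp
    have a: "word_fun (u @ v) ?k = None" by (simp add: word_fun_def)
    have "C' = (N0 + 4, (word_fun (u @ v), length u + length v), mark (length u + length v))"
      using assms(2) unfolding check(2) f
      by (subst (asm) nstep_guess) (use a in \<open>auto simp: guess_delta_def fun_upd_idem\<close>)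
    then show ?thesis using stage.return[OF z, of "length u + length v" "Suc k"] check(1) by simp
  next
    \<comment> \<open>A symbol behind the erased cell shows that the guess ended too early; this
      branch rejects.\<close>
    case (Cons b y')
    have "?f ?k = Some b" by (simp add: word_fun_def nth_append Cons)
    then show ?thesis
      by (intro nstep_reject[of "N0 + 3" "(?f, ?k)" "mark ?k" Orc C'])
        (use assms(2) check in \<open>simp_all add: guess_delta_def\<close>)
  qed
next
  case (return u v p)
  show ?thesis
  proof (cases p)
    case 0
    have "C' = (N0, (word_fun (u @ v), 0), blank)"
      using assms(2) unfolding return(1) 0
      by (subst (asm) nstep_guess) (auto simp: guess_delta_def Let_def)
    then have "C' = emb_cfg ((dstep Orc M ^^ 0) (finit (u @ v)))"
      by (simp add: emb_cfg_def finit_def ren_def)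
    moreover have "Suc k = 2 * (length u + length v) + 3 + 0" using return(3) 0 by simp
    ultimately show ?thesis by (simp only:) (rule stage.sim[OF return(2)], simp)
  next
    case (Suc p')
    have "C' = (N0 + 4, (word_fun (u @ v), p'), mark p')"
      using assms(2) unfolding return(1) Suc
      by (subst (asm) nstep_guess) (auto simp: guess_delta_def Let_def)
    then show ?thesis using stage.return[OF return(2), of p' "Suc k"] return(3,4) Suc by simp
  qed
next
  case (reject k X)
  then show ?thesis using assms(2) by (simp add: nstep_def)
next
  case (sim u v i)
  have "fst ((dstep Orc M ^^ i) (finit (u @ v))) < N0"
    using dsteps_state[OF wfM detM finit_state[OF wfM detM]] .
  from assms(2)[unfolded sim(2) sim_step[OF this]]
  have "\<not> fhalted ((dstep Orc M ^^ i) (finit (u @ v)))"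
    "C' = emb_cfg ((dstep Orc M ^^ Suc i) (finit (u @ v)))" by auto
  then show ?thesis
    using stage.sim[OF sim(3), of "Suc i" Orc] sim(1,4) by (auto simp: less_Suc_eq)
qed

text \<open>The heads walk to the end of the input and back, then \<open>M\<close> runs on
  \<open>u @ v\<close>, which is shorter than the input.\<close>

lemma stage_bound:
  assumes "stage Orc z k C" and t: "\<And>w. length w \<le> length z \<Longrightarrow> fhalted ((dstep Orc M ^^ t) (finit w))"
  shows "k \<le> 2 * length z + 3 + t"
  using assms(1)
proof (cases rule: stage.cases)
  case (sim u v i)
  have "length (u @ v) \<le> length z" by (simp add: sim(3))
  from t[OF this] sim(4) have "i \<le> t" by (meson not_le)
  then show ?thesis using sim(1) by (simp add: sim(3))
qed simp_all

lemma stage_accept: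
  assumes "stage Orc z k C" "fst C = 1"
  shows "\<exists>u v. z = u @ True # replicate (length v) False \<and> accepts Orc M (u @ v)"
  using assms(1)
proof (cases rule: stage.cases)
  case (sim u v i)
  have "fst ((dstep Orc M ^^ i) (finit (u @ v))) = 1"
    using assms(2) N0 by (auto simp: sim(2) emb_cfg_def ren_def split: if_splits)
  then show ?thesis using sim(3) accepts_dstep[OF wfM detM] by blast
qed (use assms(2) N0 in \<open>simp_all add: finit_def\<close>)

lemma stage_steps: "(nstep Orc guess_tm ^^ k) (finit z) C \<Longrightarrow> stage Orc z k C"
proof (induction k arbitrary: C)
  case 0
  then show ?case using stage.start by (metis relpowp_0_E)
next
  case (Suc k)
  then obtain D where "(nstep Orc guess_tm ^^ k) (finit z) D" "nstep Orc guess_tm D C"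
    by (metis relpowp_Suc_E)
  then show ?case using Suc.IH stage_step by blast
qed

section \<open>Completeness: a run for the right guess\<close>

abbreviation "nsteps Orc \<equiv> (nstep Orc guess_tm)\<^sup>*\<^sup>*"

lemma keep_steps:
  assumes "z = u @ y"
  shows "u \<noteq> [] \<Longrightarrow> nsteps Orc (finit z) (N0 + 1, (word_fun z, length u), mark (length u))"
  using assms
proof (induction u arbitrary: y rule: rev_induct)
  case (snoc b u)
  have a: "word_fun z (length u) = Some b" "(word_fun z)(length u := Some b) = word_fun z"
    using snoc.prems word_fun_append_upd[of u b y b] by (simp_all add: word_fun_def nth_append)
  have C': "(N0 + 1, (word_fun z, length (u @ [b])), mark (length (u @ [b]))) =
      (N0 + 1, fwr (Some b) 1 (word_fun z, length u), mark (Suc (length u)))"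
    using a by simp
  show ?case
  proof (cases "u = []")
    case True
    have "nstep Orc guess_tm (finit z) (N0 + 1, fwr (Some b) 1 (word_fun z, length u), mark (Suc (length u)))"
      using a unfolding finit_def
      by (subst nstep_guess) (auto simp: True guess_delta_def Let_def mark_blank[simplified])
    then show ?thesis unfolding C' by blast
  next
    case False
    then have "nsteps Orc (finit z) (N0 + 1, (word_fun z, length u), mark (length u))"
      using snoc by simp
    moreover have "nstep Orc guess_tm (N0 + 1, (word_fun z, length u), mark (length u))
      (N0 + 1, fwr (Some b) 1 (word_fun z, length u), mark (Suc (length u)))"
      using a False by (subst nstep_guess) (auto simp: guess_delta_def Let_def)
    ultimately show ?thesis unfolding C' by (rule rtranclp.rtrancl_into_rtrancl)
  qed
qed simp

text \<open>For the empty prefix the machine is still in its start state when it reads the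
  marker.\<close>

definition at_marker :: "bool list \<Rightarrow> bool list \<Rightarrow> (nat, bool) fconfig" where
  "at_marker u z = (if u = [] then finit z else (N0 + 1, (word_fun z, length u), mark (length u)))"

lemma at_marker_step:
  assumes z: "z = u @ True # y"
    and c: "(q, b) \<in> {(N0 + 2, Some True), (N0 + 2, Some False), (N0 + 3, None)}"
  shows "nstep Orc guess_tm (at_marker u z)
    (q, ((word_fun z)(length u := b), Suc (length u)), mark (Suc (length u)))"
proof -
  have a: "word_fun z (length u) = Some True" by (simp add: z word_fun_def nth_append)
  show ?thesis
  proof (cases "u = []")
    case True
    then show ?thesis using a c unfolding at_marker_def finit_def
      by (simp, subst nstep_guess) (auto simp: guess_delta_def Let_def mark_blank[simplified])
  next
    case False
    then show ?thesis using a c unfolding at_marker_def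
      by (simp, subst nstep_guess) (auto simp: guess_delta_def Let_def)
  qed
qed

lemma guess_steps:
  assumes "z = u @ True # replicate j False" "length v \<le> j" "v \<noteq> []"
  shows "nsteps Orc (finit z) (N0 + 2, (word_fun (u @ v @ replicate (Suc j - length v) False),
    length (u @ v)), mark (length (u @ v)))"
  using assms(2,3)
proof (induction v rule: rev_induct)
  case (snoc b v)
  have m: "nsteps Orc (finit z) (at_marker u z)"
    using keep_steps[OF assms(1)] by (auto simp: at_marker_def)
  show ?case
  proof (cases "v = []")
    case True
    have "nstep Orc guess_tm (at_marker u z)
        (N0 + 2, ((word_fun z)(length u := Some b), Suc (length u)), mark (Suc (length u)))"
      by (rule at_marker_step[OF assms(1)]) (cases b; simp)
    moreover have "(word_fun z)(length u := Some b) = word_fun (u @ b # replicate j False)"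
      unfolding assms(1) by (rule word_fun_append_upd)
    ultimately show ?thesis using m True by (simp add: rtranclp.rtrancl_into_rtrancl)
  next
    case False
    let ?r = "replicate (Suc j - length (v @ [b])) False"
    have r: "replicate (Suc j - length v) False = False # ?r"
      using snoc.prems by (simp flip: replicate_Suc add: Suc_diff_Suc)
    have a: "word_fun (u @ v @ False # ?r) (length (u @ v)) = Some False"
      by (simp add: word_fun_def nth_append)
    have upd: "(word_fun (u @ v @ False # ?r))(length (u @ v) := Some b) = word_fun (u @ (v @ [b]) @ ?r)"
      using word_fun_append_upd[of "u @ v" False ?r b] by simp
    have "nsteps Orc (finit z) (N0 + 2, (word_fun (u @ v @ False # ?r), length (u @ v)), mark (length (u @ v)))"
      using snoc False unfolding r by simp
    moreover have "nstep Orc guess_tm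
        (N0 + 2, (word_fun (u @ v @ False # ?r), length (u @ v)), mark (length (u @ v)))
        (N0 + 2, fwr (Some b) 1 (word_fun (u @ v @ False # ?r), length (u @ v)), mark (Suc (length (u @ v))))"
      using a False by (cases b) (simp_all add: nstep_guess guess_delta_def)
    ultimately have "nsteps Orc (finit z)
        (N0 + 2, fwr (Some b) 1 (word_fun (u @ v @ False # ?r), length (u @ v)), mark (Suc (length (u @ v))))"
      by (rule rtranclp.rtrancl_into_rtrancl)
    then show ?thesis unfolding fwr_simps upd by simp
  qed
qed simp

text \<open>For empty \<open>v\<close> the marker itself is erased; otherwise it is the cell behind
  the guessed letters, which still holds the last zero.\<close>

lemma cut_steps:
  assumes z: "z = u @ True # replicate (length v) False"
  shows "nsteps Orc (finit z) (N0 + 3, (word_fun (u @ v), Suc (length (u @ v))), mark (Suc (length (u @ v))))"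
proof (cases "v = []")
  case True
  have "nsteps Orc (finit z) (at_marker u z)"
    using keep_steps[OF z] by (auto simp: at_marker_def)
  moreover have "nstep Orc guess_tm (at_marker u z)
      (N0 + 3, ((word_fun z)(length u := None), Suc (length u)), mark (Suc (length u)))"
    by (rule at_marker_step[OF z]) simp
  moreover have "(word_fun z)(length u := None) = word_fun (u @ v)"
    by (auto simp: z True word_fun_def fun_eq_iff nth_append)
  ultimately show ?thesis using True by (simp add: rtranclp.rtrancl_into_rtrancl)
next
  case False
  have "nsteps Orc (finit z) (N0 + 2, (word_fun (u @ v @ [False]), length (u @ v)), mark (length (u @ v)))"
    using guess_steps[OF z order_refl False] by simp
  moreover have "nstep Orc guess_tm
      (N0 + 2, (word_fun (u @ v @ [False]), length (u @ v)), mark (length (u @ v)))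
      (N0 + 3, fwr None 1 (word_fun (u @ v @ [False]), length (u @ v)), mark (Suc (length (u @ v))))"
    using False by (subst nstep_guess) (auto simp: guess_delta_def word_fun_def nth_append)
  moreover have "(word_fun (u @ v @ [False]))(length (u @ v) := None) = word_fun (u @ v)"
    by (auto simp: word_fun_def fun_eq_iff nth_append less_Suc_eq)
  ultimately show ?thesis unfolding fwr_simps by (metis rtranclp.rtrancl_into_rtrancl)
qed

lemma return_steps: "nsteps Orc (N0 + 4, (word_fun w, p), mark p) (emb_cfg (finit w))"
proof (induction p)
  case 0
  have "nstep Orc guess_tm (N0 + 4, (word_fun w, 0), mark 0) (emb_cfg (finit w))"
    by (subst nstep_guess) (auto simp: guess_delta_def emb_cfg_def finit_def ren_def)
  then show ?case by blast
next
  case (Suc p)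
  have "nstep Orc guess_tm (N0 + 4, (word_fun w, Suc p), mark (Suc p)) (N0 + 4, (word_fun w, p), mark p)"
    by (subst nstep_guess) (auto simp: guess_delta_def Let_def)
  then show ?case using Suc by (rule converse_rtranclp_into_rtranclp)
qed

lemma setup_steps:
  assumes z: "z = u @ True # replicate (length v) False"
  shows "nsteps Orc (finit z) (emb_cfg (finit (u @ v)))"
proof -
  let ?w = "u @ v"
  have "nstep Orc guess_tm (N0 + 3, (word_fun ?w, Suc (length ?w)), mark (Suc (length ?w)))
      (N0 + 4, (word_fun ?w, length ?w), mark (length ?w))"
    by (subst nstep_guess) (auto simp: guess_delta_def word_fun_def fun_eq_iff)
  with cut_steps[OF z] return_steps[of Orc ?w "length ?w"] show ?thesis
    by (meson rtranclp.rtrancl_into_rtrancl rtranclp_trans)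
qed

lemma sim_steps:
  "(\<And>j. j < i \<Longrightarrow> \<not> fhalted ((dstep Orc M ^^ j) (finit w))) \<Longrightarrow>
    nsteps Orc (emb_cfg (finit w)) (emb_cfg ((dstep Orc M ^^ i) (finit w)))"
proof (induction i)
  case (Suc i)
  have "fst ((dstep Orc M ^^ i) (finit w)) < N0"
    using dsteps_state[OF wfM detM finit_state[OF wfM detM]] .
  then have "nstep Orc guess_tm (emb_cfg ((dstep Orc M ^^ i) (finit w)))
      (emb_cfg (dstep Orc M ((dstep Orc M ^^ i) (finit w))))"
    using Suc.prems[of i] by (simp add: sim_step)
  moreover have "nsteps Orc (emb_cfg (finit w)) (emb_cfg ((dstep Orc M ^^ i) (finit w)))"
    using Suc by simp
  ultimately show ?case by (simp add: rtranclp.rtrancl_into_rtrancl)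
qed simp

lemma guess_accepts:
  "accepts Orc guess_tm z \<longleftrightarrow>
    (\<exists>u v. z = u @ True # replicate (length v) False \<and> accepts Orc M (u @ v))"
proof
  assume "accepts Orc guess_tm z"
  then show "\<exists>u v. z = u @ True # replicate (length v) False \<and> accepts Orc M (u @ v)"
    unfolding accepts_iff[of Orc guess_tm] using stage_steps stage_accept by blast
next
  assume "\<exists>u v. z = u @ True # replicate (length v) False \<and> accepts Orc M (u @ v)"
  then obtain u v where z: "z = u @ True # replicate (length v) False" and "accepts Orc M (u @ v)"
    by blast
  then obtain k C where "(nstep Orc M ^^ k) (finit (u @ v)) C" "fst C = 1"
    unfolding accepts_iff by blast
  then have C: "C = (dstep Orc M ^^ k) (finit (u @ v))" "fst C = 1"
    and h: "\<And>i. i < k \<Longrightarrow> \<not> fhalted ((dstep Orc M ^^ i) (finit (u @ v)))"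
    unfolding nsteps_dsteps[OF wfM detM finit_state[OF wfM detM]] by auto
  have "nsteps Orc (finit z) (emb_cfg C)"
    unfolding C(1) using setup_steps[OF z] sim_steps[OF h] by (rule rtranclp_trans)
  moreover have "fst (emb_cfg C) = 1" using C(2) by (simp add: emb_cfg_def ren_def)
  ultimately show "accepts Orc guess_tm z"
    unfolding accepts_iff rtranclp_power by blast
qed

lemma guess_runs_within:
  assumes "\<And>w. length w \<le> length z \<Longrightarrow> runs_within Orc M w t"
  shows "runs_within Orc guess_tm z (2 * length z + 3 + t)"
  unfolding runs_within_iff
proof
  assume "\<exists>C. (nstep Orc guess_tm ^^ Suc (2 * length z + 3 + t)) (finit z) C"
  then obtain C where "stage Orc z (Suc (2 * length z + 3 + t)) C"
    using stage_steps by blast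
  from stage_bound[OF this, of t] assms show False
    by (simp add: runs_within_dstep[OF wfM detM])
qed

end

lemma prefix_lang_NP:
  assumes "S \<in> P_O Orc"
  shows "prefix_lang S \<in> NP_O Orc"
proof -
  obtain M t where M: "wf_tm M" "deterministic M" and "poly_bounded t"
    and runs: "\<And>x. runs_within Orc M x (t (length x))"
    and acc: "\<And>x. x \<in> S \<longleftrightarrow> accepts Orc M x"
    using assms unfolding P_O_def by blast
  \<comment> \<open>\<open>t\<close> itself may fail to be monotone, but the simulated word differs
    in length from the input, so a monotone bound is taken instead.\<close>
  obtain k where k: "\<And>n. t n \<le> (n + k) ^ k"
    using poly_bounded_shift[OF \<open>poly_bounded t\<close>] by blast
  have "runs_within Orc M w ((n + k) ^ k)" if "length w \<le> n" for w n
  proof -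
    have "t (length w) \<le> (n + k) ^ k"
      by (rule order_trans[OF k]) (use that in \<open>simp add: power_mono\<close>)
    then show ?thesis
      using runs[of w] dstep_halted_mono unfolding runs_within_dstep[OF M] by metis
  qed
  then have "runs_within Orc (guess_tm M) z (2 * length z + 3 + (length z + k) ^ k)" for z
    by (intro guess_runs_within[OF M]) blast
  moreover have "poly_bounded (\<lambda>n. 2 * n + 3 + (n + k) ^ k)"
    by (intro poly_bounded_intros)
  moreover have "z \<in> prefix_lang S \<longleftrightarrow> accepts Orc (guess_tm M) z" for z
    unfolding guess_accepts[OF M] prefix_lang_def acc by blast
  ultimately show ?thesis
    unfolding NP_O_def using wf_guess_tm[OF M] by blast
qed

section \<open>The theorem\<close>

lemma qword_in_prefix_lang:
  "qword U j \<in> prefix_lang S \<longleftrightarrow> (\<exists>v. length v = j \<and> rev U @ v \<in> S)"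
  unfolding qword_def prefix_lang_def by (auto dest: last_True_unique)

lemma finite_words: "finite {w :: bool list. length w = n \<and> P w}"
  by (rule finite_subset[OF _ finite_lists_length_eq[of UNIV n]]) auto

text \<open>A no answer at a node excludes all words of \<open>S\<close> of the given length below
  it, so cutting the subtree loses nothing.\<close>

lemma set_leaves:
  "set (leaves (prefix_lang S) j U) = {rev U @ v | v. length v = j \<and> rev U @ v \<in> S}"
proof (induction j arbitrary: U)
  case 0
  then show ?case by (auto simp: qword_in_prefix_lang)
next
  case (Suc j)
  have "{rev U @ v | v. length v = Suc j \<and> rev U @ v \<in> S} =
      (\<Union>b. {rev (b # U) @ v | v. length v = j \<and> rev (b # U) @ v \<in> S})"
    by (auto simp: length_Suc_conv)
  also have "\<dots> = {rev (False # U) @ v | v. length v = j \<and> rev (False # U) @ v \<in> S} \<union>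
      {rev (True # U) @ v | v. length v = j \<and> rev (True # U) @ v \<in> S}"
    by (simp only: UNIV_bool UN_insert UN_empty Un_empty_right)
  finally have children: "{rev U @ v | v. length v = Suc j \<and> rev U @ v \<in> S} =
      set (leaves (prefix_lang S) j (False # U)) \<union> set (leaves (prefix_lang S) j (True # U))"
    using Suc.IH by simp
  show ?case
  proof (cases "qword U (Suc j) \<in> prefix_lang S")
    case True
    then show ?thesis by (simp add: children del: rev.simps)
  next
    case False
    then have "{rev U @ v | v. length v = Suc j \<and> rev U @ v \<in> S} = {}"
      by (auto simp: qword_in_prefix_lang)
    then show ?thesis using False by simp
  qed
qed

lemma length_leaves: "length (leaves Orc j U) \<le> visits Orc j U"
proof (induction j arbitrary: U)
  case (Suc j)
  have "length (leaves Orc j (False # U)) + length (leaves Orc j (True # U)) \<le>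
      Suc (visits Orc j (False # U) + visits Orc j (True # U))"
    using Suc[of "False # U"] Suc[of "True # U"] by linarith
  then show ?case by simp
qed simp

text \<open>Each visited node with answer yes is a prefix of a word in \<open>S\<close>, and each node with answer no is
  a child of such a node.\<close>
lemma visits_bound:
  "visits (prefix_lang S) j U \<le>
    1 + 2 * (j + 1) * card {v. length v = j \<and> rev U @ v \<in> S}"
proof (induction j arbitrary: U)
  case (Suc j)
  show ?case
  proof (cases "qword U (Suc j) \<in> prefix_lang S")
    case True
    let ?A = "\<lambda>b. {v. length v = j \<and> rev (b # U) @ v \<in> S}"
    let ?B = "{v. length v = Suc j \<and> rev U @ v \<in> S}"
    have B: "?B = (#) False ` ?A False \<union> (#) True ` ?A True"
    proof
      show "?B \<subseteq> (#) False ` ?A False \<union> (#) True ` ?A True"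
      proof
        fix v assume v: "v \<in> ?B"
        then obtain b v' where "v = b # v'" by (cases v) auto
        then show "v \<in> (#) False ` ?A False \<union> (#) True ` ?A True" using v by (cases b) auto
      qed
    qed auto
    have card: "card ?B = card (?A False) + card (?A True)"
      unfolding B by (subst card_Un_disjoint) (auto simp: finite_words card_image)
    \<comment> \<open>The answer yes guarantees a word below the node; the two additional visits are
      charged to it.\<close>
    have "?B \<noteq> {}" using True by (auto simp: qword_in_prefix_lang)
    then have "1 \<le> card ?B" using finite_words[of "Suc j" "\<lambda>v. rev U @ v \<in> S"]
      by (simp add: Suc_le_eq card_gt_0_iff)
    have "visits (prefix_lang S) (Suc j) U \<le>
        1 + (1 + 2 * (j + 1) * card (?A False)) + (1 + 2 * (j + 1) * card (?A True))"
      using Suc.IH[of "False # U"] Suc.IH[of "True # U"] True by simp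
    also have "\<dots> = 3 + 2 * (j + 1) * card ?B" by (simp add: card algebra_simps)
    also have "\<dots> \<le> 1 + 2 * (j + 1) * card ?B + 2 * card ?B" using \<open>1 \<le> card ?B\<close> by linarith
    also have "\<dots> = 1 + 2 * (Suc j + 1) * card ?B" by (simp add: algebra_simps)
    finally show ?thesis .
  qed simp
qed simp

lemma sparse_iff: "sparse S \<longleftrightarrow> poly_bounded (\<lambda>n. card {x \<in> S. length x = n})"
  by (simp add: sparse_def poly_bounded_def)

text \<open>A word of length \<open>n\<close> arises from a word of \<open>S\<close> of length
  \<open>n - 1\<close> by choosing a cut position, and everything behind the cut is replaced by
  marker and zeros.\<close>

lemma sparse_prefix_lang:
  assumes "sparse S"
  shows "sparse (prefix_lang S)"
proof -
  have le: "card {z \<in> prefix_lang S. length z = n} \<le> (n + 1) * card {w \<in> S. Suc (length w) = n}" for n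
  proof -
    let ?W = "{w \<in> S. Suc (length w) = n}"
    have fin: "finite ?W"
      by (rule finite_subset[OF _ finite_words[of "n - 1" "\<lambda>w. w \<in> S"]]) auto
    have "{z \<in> prefix_lang S. length z = n} \<subseteq>
        (\<lambda>(i, w). take i w @ True # replicate (length w - i) False) ` ({..n} \<times> ?W)"
    proof
      fix z assume "z \<in> {z \<in> prefix_lang S. length z = n}"
      then obtain u v where "z = u @ True # replicate (length v) False" "u @ v \<in> S" "length z = n"
        by (auto simp: prefix_lang_def)
      then show "z \<in> (\<lambda>(i, w). take i w @ True # replicate (length w - i) False) ` ({..n} \<times> ?W)"
        by (intro image_eqI[of _ _ "(length u, u @ v)"]) auto
    qed
    then have "card {z \<in> prefix_lang S. length z = n} \<le>
        card ((\<lambda>(i, w). take i w @ True # replicate (length w - i) False) ` ({..n} \<times> ?W))"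
      using fin by (intro card_mono) auto
    also have "\<dots> \<le> card ({..n} \<times> ?W)" using fin by (intro card_image_le) auto
    finally show ?thesis by (simp add: card_cartesian_product)
  qed
  obtain k where k: "\<And>n. card {x \<in> S. length x = n} \<le> (n + k) ^ k"
    using assms poly_bounded_shift unfolding sparse_iff by meson
  have "card {z \<in> prefix_lang S. length z = n} \<le> (n + 1) * (n + k) ^ k" for n
  proof (cases n)
    case 0
    have "{z \<in> prefix_lang S. length z = n} = {}" by (auto simp: 0 prefix_lang_def)
    then show ?thesis by (simp only: card.empty)
  next
    case (Suc m)
    have "card {w \<in> S. Suc (length w) = n} \<le> (n + k) ^ k"
      using k[of m] power_mono[of "m + k" "n + k" k] by (simp add: Suc)
    then show ?thesis using le[of n] by (meson le_trans mult_le_mono2)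
  qed
  moreover have "poly_bounded (\<lambda>n. (n + 1) * (n + k) ^ k)"
    by (intro poly_bounded_intros)
  ultimately show ?thesis unfolding sparse_iff by (blast intro: poly_bounded_mono)
qed

subsection \<open>Running time of the advice machine\<close>

text \<open>Each of the \<open>t_bound e n + 1\<close> trees has at most \<open>b n\<close> visited
  nodes by sparsity, and a word found has at most \<open>t_bound e n\<close> letters, each coded by
  two symbols.\<close>

lemma poly_advice:
  assumes "sparse S"
  shows "poly_bounded (\<lambda>n. t_steps e n (prefix_lang S))"
    and "poly_bounded (\<lambda>n. length (advice e n (prefix_lang S)))"
proof -
  let ?A = "prefix_lang S"
  obtain k where k: "\<And>n. card {x \<in> S. length x = n} \<le> (n + k) ^ k"
    using assms poly_bounded_shift unfolding sparse_iff by meson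
  define b where "b n = 1 + 2 * (t_bound e n + 1) * (t_bound e n + k) ^ k" for n
  have visits: "visits ?A i [] \<le> b n" if "i \<le> t_bound e n" for i n
  proof -
    have "card {v. length v = i \<and> v \<in> S} \<le> (i + k) ^ k"
      using k[of i] by (simp add: conj_commute)
    also have "\<dots> \<le> (t_bound e n + k) ^ k" using that by (simp add: power_mono)
    finally have "1 + 2 * (i + 1) * card {v. length v = i \<and> v \<in> S} \<le> b n"
      unfolding b_def using that by (intro add_mono mult_le_mono) simp_all
    then show ?thesis using visits_bound[of S i "[]"] by simp
  qed
  have sum: "(\<Sum>i\<le>t_bound e n. visits ?A i []) \<le> (t_bound e n + 1) * b n" for n
    using sum_bounded_above[of "{..t_bound e n}" "\<lambda>i. visits ?A i []" "b n"] visits[of _ n] by simp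
  have enc: "length (enc_word w) = 2 * length w + 1" for w
    by (induction w) (auto simp: enc_word_def)
  have add: "length (add_words ws Z) \<le> length ws * (2 * m + 1) + length Z"
    if "\<forall>w\<in>set ws. length w \<le> m" for ws Z m
  proof -
    have "length (concat (map enc_word vs)) \<le> length vs * (2 * m + 1)" if "\<forall>w\<in>set vs. length w \<le> m" for vs
      using that by (induction vs) (auto simp: enc)
    from this[of "rev ws"] that show ?thesis by (simp add: add_words_def)
  qed
  have adv: "length (advice e n ?A) \<le> (t_bound e n + 1) * b n * (2 * t_bound e n + 1) + t_bound e n" for n
  proof -
    let ?ws = "concat (map (\<lambda>i. leaves ?A i []) [0..<Suc (t_bound e n)])"
    have "\<forall>w\<in>set ?ws. length w \<le> t_bound e n"
      by (auto simp: set_leaves simp del: upt_Suc)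
    from add[OF this] have "length (advice e n ?A) \<le> length ?ws * (2 * t_bound e n + 1) + t_bound e n"
      unfolding advice_def by (metis length_replicate)
    moreover have "length ?ws \<le> (t_bound e n + 1) * b n"
    proof -
      have "length ?ws = (\<Sum>i\<le>t_bound e n. length (leaves ?A i []))"
        unfolding length_concat map_map comp_def
        by (subst sum_list_distinct_conv_sum_set)
          (auto simp: atLeast0LessThan lessThan_Suc_atMost simp del: upt_Suc)
      also have "\<dots> \<le> (\<Sum>i\<le>t_bound e n. visits ?A i [])"
        by (intro sum_mono length_leaves)
      finally show ?thesis using sum[of n] by simp
    qed
    ultimately show ?thesis by (meson add_le_mono1 le_trans mult_le_mono1)
  qed
  have pb: "poly_bounded b" and pt: "poly_bounded (t_bound e)"
    unfolding b_def t_bound_def by (intro poly_bounded_intros)+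
  show 1: "poly_bounded (\<lambda>n. length (advice e n ?A))"
    by (rule poly_bounded_mono[OF _ adv]) (intro poly_bounded_intros pb pt)
  have "t_steps e n ?A \<le> t_init_time e n + 40 + (t_bound e n + 1) * b n * t_round (t_bound e n) +
      4 * length (advice e n ?A) + 10" for n
    unfolding t_steps_def using sum[of n] by (intro add_mono mult_le_mono) auto
  moreover have "poly_bounded (\<lambda>n. t_init_time e n + 40 + (t_bound e n + 1) * b n * t_round (t_bound e n) +
      4 * length (advice e n ?A) + 10)"
    unfolding t_init_time_def t_round_def by (intro poly_bounded_intros pb pt 1)
  ultimately show "poly_bounded (\<lambda>n. t_steps e n ?A)" by (blast intro: poly_bounded_mono)
qed

lemma t_prog_wf: "wf_cmd 6 ({..<6} \<times> UNIV) (code (t_prog e))"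
proof -
  have rep: "wf_cmd 6 ({..<6} \<times> UNIV) p \<Longrightarrow> wf_cmd 6 ({..<6} \<times> UNIV) (rep k p)"
    for k and p :: tcmd
    by (induction k) auto
  show ?thesis
    by (auto simp: t_prog_def t_init_def t_load_def t_read_def t_mult_def t_answer_def t_word_def
        t_next_def t_finish_def t_query_def t_output_def intro!: rep)
qed

lemma advice_machine:
  assumes "sparse S"
  shows "\<exists>N t. wf_tm N \<and> deterministic N \<and> poly_bounded t \<and>
    (\<forall>n. runs_within (prefix_lang S) N (ones n) (t n) \<and>
      (\<exists>k c. (tm_step (prefix_lang S) N ^^ k) (init_config (ones n)) c \<and> halted c \<and>
         tape_content (work_tape c) = advice e n (prefix_lang S)))"
proof -
  let ?A = "prefix_lang S" and ?C = "{..<6 :: nat} \<times> (UNIV :: bool option set)"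
  have C: "finite ?C" "cinit (t_prog e) \<in> ?C" "cyes (t_prog e) \<in> ?C" "cno (t_prog e) \<in> ?C"
    by (auto simp: t_prog_def)
  from ex_tm_of_prg[OF t_prog_wf C] obtain N where N: "wf_tm N" "deterministic N"
    and run: "\<forall>Orc x n c s f w T. (sstep (t_prog e) Orc ^^ n)
        ([code (t_prog e)], cinit (t_prog e), \<lambda>_. [], (word_fun x, 0)) =
          ([], c, s, (f, Suc (length w))) \<longrightarrow>
      verd (t_prog e) c = Emit \<longrightarrow> f 0 = None \<longrightarrow> (\<forall>i<length w. f (Suc i) = Some (w ! i)) \<longrightarrow>
      f (Suc (length w)) = None \<longrightarrow>
      2 * length x + 5 + (2 * (6 + 4) * (n * n) + (2 * length w + 3)) \<le> T \<longrightarrow>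
      runs_within Orc N x T \<and> (\<exists>k c. (tm_step Orc N ^^ k) (init_config x) c \<and> halted c \<and>
        tape_content (work_tape c) = w)"
    by blast
  define t where "t n = 2 * n + 5 + (2 * (6 + 4) * (t_steps e n ?A * t_steps e n ?A) +
    (2 * length (advice e n ?A) + 3))" for n
  have "runs_within ?A N (ones n) (t n) \<and>
      (\<exists>k c. (tm_step ?A N ^^ k) (init_config (ones n)) c \<and> halted c \<and>
         tape_content (work_tape c) = advice e n ?A)" for n
  proof -
    let ?w = "advice e n ?A"
    obtain s where s: "(sstep (t_prog e) ?A ^^ t_steps e n ?A)
      ([code (t_prog e)], cinit (t_prog e), \<lambda>_. [], (word_fun (ones n), 0)) =
      ([], (4, None), s, otape ?w)"
      using t_prog_run by blast
    show ?thesis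
      by (rule run[rule_format, OF s[unfolded otape_def]])
        (auto simp: t_prog_def word_fun_def t_def)
  qed
  moreover have "poly_bounded t"
    unfolding t_def by (intro poly_bounded_intros poly_advice[OF assms])
  ultimately show ?thesis using N by blast
qed

lemma sound_advice:
  assumes "T \<le> t_bound e n" "length x = n"
  shows "sound (sep_word x (advice e n (prefix_lang S))) (length x) S T"
  unfolding sound_def
proof (intro allI impI)
  fix h' and R :: "bool option list"
  let ?w = "advice e n (prefix_lang S)" and ?z = "sep_word x (advice e n (prefix_lang S))"
  assume h': "length x \<le> h'" "h' < length ?z" "?z ! h' = None" and R: "length R \<le> T"
  \<comment> \<open>The advice part contains no separator, so the scan can only start at the first
    advice symbol.\<close>
  have "h' = length x"
  proof (rule ccontr)
    assume "h' \<noteq> length x"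
    then obtain i where "h' = length x + Suc i" using h'(1) by (metis le_iff_add not0_implies_Suc add_0_right)
    then show False using h'(2,3) by (auto simp: sep_word_def nth_append)
  qed
  then have drop: "drop (Suc h') ?z = map Some ?w" by (simp add: sep_word_def)
  \<comment> \<open>The query is no longer than the tape that carries it, hence within the range of
    lengths that were searched.\<close>
  have "length (fcontent (cells R)) \<le> length R"
    by (rule fcontentD(1)) (simp add: cells_def)
  then have "length (fcontent (cells R)) \<le> t_bound e n" using R assms(1) by simp
  then have mem: "fcontent (cells R) \<in> set (concat (map (\<lambda>i. leaves (prefix_lang S) i []) [0..<Suc (t_bound e n)]))
      \<longleftrightarrow> fcontent (cells R) \<in> S"
    by (auto simp: set_leaves simp del: upt_Suc)
  show "found (drop (Suc h') ?z) R \<longleftrightarrow> fcontent (cells R) \<in> S"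
    unfolding drop unfolding advice_def found_add_words by (rule mem)
qed

theorem theorem4:
  fixes B :: "bool list set set"
  shows "P_rel (SP (P_rel B)) \<subseteq> Ppoly_B (SP (NP_rel B))"
proof
  fix L assume "L \<in> P_rel (SP (P_rel B))"
  then obtain S Q where L: "L \<in> P_O S" and S: "S \<in> P_O Q" "Q \<in> B" and sp: "sparse S"
    by (auto simp: P_rel_def SP_def)
  let ?A = "prefix_lang S"
  have A: "?A \<in> SP (NP_rel B)"
    using prefix_lang_NP[OF S(1)] S(2) sparse_prefix_lang[OF sp] by (auto simp: SP_def NP_rel_def)
  obtain M t where M: "wf_tm M" "deterministic M" and "poly_bounded t"
    and runs: "\<And>x. runs_within S M x (t (length x))" and acc: "\<And>x. x \<in> L \<longleftrightarrow> accepts S M x"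
    using L unfolding P_O_def by blast
  \<comment> \<open>A bound of this shape is what the advice machine can compute; \<open>e\<close>
    is built into its program.\<close>
  obtain e where e: "\<And>n. t n \<le> t_bound e n"
    using poly_bounded_shift[OF \<open>poly_bounded t\<close>] unfolding t_bound_def by blast
  let ?a = "\<lambda>n. advice e n ?A"
  obtain N tN where N: "wf_tm N" "deterministic N" "poly_bounded tN"
    and N_runs: "\<And>z. runs_within {} N z (tN (length z))"
    and N_acc: "\<And>x Orc T w. sound (sep_word x w) (length x) Orc T \<Longrightarrow> T \<le> length w \<Longrightarrow>
       fhalted ((dstep Orc M ^^ T) (finit x)) \<Longrightarrow>
       accepts {} N (sep_word x w) \<longleftrightarrow> fst ((dstep Orc M ^^ T) (finit x)) = 1"
    using lookup_machine[OF M] by blast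
  have "{z. accepts {} N z} \<in> P_class"
    unfolding P_class_def P_O_def using N N_runs by blast
  moreover have "x \<in> L \<longleftrightarrow> sep_word x (?a (length x)) \<in> {z. accepts {} N z}" for x
  proof -
    let ?T = "t (length x)"
    have h: "fhalted ((dstep S M ^^ ?T) (finit x))"
      using runs[of x] unfolding runs_within_dstep[OF M] .
    \<comment> \<open>The padding alone has \<open>t_bound e (length x)\<close> symbols.\<close>
    have "?T \<le> length (?a (length x))"
      using e[of "length x"] by (simp add: advice_def add_words_def)
    from N_acc[OF sound_advice[OF e refl] this h]
    have "accepts {} N (sep_word x (?a (length x))) \<longleftrightarrow> fst ((dstep S M ^^ ?T) (finit x)) = 1" .
    moreover have "accepts S M x \<longleftrightarrow> fst ((dstep S M ^^ ?T) (finit x)) = 1"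
    proof
      assume "accepts S M x"
      then obtain k where k: "fst ((dstep S M ^^ k) (finit x)) = 1"
        unfolding accepts_dstep[OF M] by blast
      then have "(dstep S M ^^ max k ?T) (finit x) = (dstep S M ^^ k) (finit x)"
        by (intro dstep_halted_mono) auto
      moreover have "(dstep S M ^^ max k ?T) (finit x) = (dstep S M ^^ ?T) (finit x)"
        by (intro dstep_halted_mono h) auto
      ultimately show "fst ((dstep S M ^^ ?T) (finit x)) = 1" using k by simp
    qed (auto simp: accepts_dstep[OF M])
    ultimately show ?thesis using acc by simp
  qed
  moreover obtain N' t' where "wf_tm N'" "deterministic N'" "poly_bounded t'"
    "\<forall>n. runs_within ?A N' (ones n) (t' n) \<and>
      (\<exists>k c. (tm_step ?A N' ^^ k) (init_config (ones n)) c \<and> halted c \<and>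
         tape_content (work_tape c) = ?a n)"
    using advice_machine[OF sp, of e] by blast
  ultimately show "L \<in> Ppoly_B (SP (NP_rel B))"
    unfolding Ppoly_B_def using A by (intro CollectI exI[of _ ?a] conjI) blast+
qed

end
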